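(* Consider the $A_n$ quiver $[\mathbf v_0]\to(\mathbf v_1)\to(\mathbf v_2)\to\cdots\to(\mathbf v_n)$ with frozen node $0$ and gauge nodes $1,\dots,n$, with stability condition $\theta_k>0$ for $1\le k\le n$, and dimension vector satisfying $\mathbf v_k>\mathbf v_{k+1}$ and $\mathbf v_0-\mathbf v_k<\mathbf v_{k+1}-\mathbf v_{k+2}$ for all $0\le k\le n-1$ (where $\mathbf v_k=0$ for $k>n$). Let $\mathcal A$ be the associated cluster algebra and $\psi$ the injective algebra homomorphism described in the context. Then the images under $\psi$ of all the cluster variables are $$\psi(x[-\alpha_k])=\zeta_k\cdot c_t(V_k),\qquad \psi(x[kl])=\zeta_k\zeta_l^{-1}\cdot\delta_t(V_k,V_l),\qquad 0\le k\le l\le n.$$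
   Context: Quiver variety. $V_i=\mathbb C^{\mathbf v_i}$, $N=\bigoplus_{i=1}^n\mathrm{Hom}(V_{i-1},V_i)$, $G=\prod_{i=1}^nGL(\mathbf v_i)$ acting by $(g\cdot B)_i=g_iB_ig_{i-1}^{-1}$ ($g_0=1$), $T=(\mathbb C^* )^{\mathbf v_0}$ acting via $GL(V_0)$, $K=\prod_{i=1}^n(\mathbb C^* )^{\mathbf v_i}$, $W=\prod_{i=1}^nS_{\mathbf v_i}$, $X=N/\!\!/_\theta G$ for the character $\prod(\det g_i)^{\theta_i}$ (a partial flag variety), $X^{ab}=N/\!\!/_\theta K$ ($\theta$ generic, so that semistable equals stable with free action for $G$ and $K$). $\xi_j^{(i)}$, $1\le j\le \mathbf v_i$, are the standard characters of $K$ for $i\ge1$ and equivariant parameters of $T$ for $i=0$. $QH^{poly}_T(X)$. $\mathrm{Eff}(X)\subset\pi_1(G)=\mathbb Z^n$ and $\mathrm{Eff}(X^{ab})\subset X_*(K)$ are the monoids generated by degrees of quasimaps (maps $\mathbb P^1\to[N/G]$, resp. $[N/K]$, generically landing in $X$, resp. $X^{ab}$); $\mathbb C[Q]=\mathbb C[Q^{\mathrm{Eff}(X)}]$; $Q^{(k)}$ corresponds to the $k$-th basis vector; $d\mapsto\bar d$ is $X_*(K)\to\pi_1(G)$. With $K\times T$-weights $u_i+\lambda_i$ of $N$, $QH_T^{poly}(X)=H_T^*(\mathrm{pt})\otimes H_K^*(\mathrm{pt})^W[Q]/\mathcal J_{poly}$, where $\mathcal J_{poly}$ is generated by $\frac1e\sum_{w\in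 W}(-1)^{l(w)}w\cdot[g(\prod_{\langle\lambda_i,d\rangle>0}(u_i+\lambda_i)^{\langle\lambda_i,d\rangle}-(-1)^{\langle2\rho,d\rangle}Q^{\bar d}\prod_{\langle\lambda_i,d\rangle<0}(u_i+\lambda_i)^{-\langle\lambda_i,d\rangle})]$, $d\in\mathrm{Eff}(X^{ab})$, $g\in H^*_{K\times T}(\mathrm{pt})$ ($e$ = product, $2\rho$ = sum of positive roots of $G$). $c_t(V_i)=\prod_j(t+\xi_j^{(i)})$, $c_t(0)=1$; $\delta_t(V_k,V_l)$ is the part with nonnegative powers of $t$ of $c_t(V_k)/c_t(V_l)$ expanded in $t^{-1}$. Cluster algebra. $\mathcal A$ is the cluster algebra of geometric type of this quiver: initial cluster variables $x_1,\dots,x_n$, one frozen variable $x_0$, exchange matrix $b_{ij}=\#\{i\to j\}-\#\{j\to i\}$; it is the $\mathbb Z[x_0]$-subalgebra of $\mathbb Q(x_0,\dots,x_n)$ generated by all cluster variables. Let $\alpha_1,\dots,\alpha_n$ be the simple roots of type $A_n$. The initial cluster variables are written $x[-\alpha_k]=x_k$ (the formula for $\psi(x[-\alpha_k])$ is for $1\le k\le n$). The non-initial cluster variables are parametrized by positive roots $\alpha_{kl}=\alpha_{k+1}+\dots+\alpha_l$, $0\le k<l\le n$: $x[kl]=x[\alpha_{kl}]$ is the one whose Laurent expansion in the initial cluster has denominator $x_{k+1}\cdots x_l$; by convention $x[kk]=1$. The map $\psi$. $\mathbb C[\zeta^{\pm1}]=\mathbb C[\zeta_0^{\pm1},\dots,\zeta_n^{\pm1}]$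 is a $\mathbb C[Q]$-algebra via $Q^{(k)}\mapsto(-1)^{\mathbf v_{k-1}-\mathbf v_k}\zeta_{k-1}^{-1}\zeta_{k+1}$, with $\zeta_{n+1}=1$. $\psi:\mathcal A\hookrightarrow QH_T^{poly}(X)[t]\otimes_{\mathbb C[Q]}\mathbb C[\zeta^{\pm1}]$ is the injective algebra homomorphism determined by $\psi(x_i)=\zeta_ic_t(V_i)$ for $0\le i\le n$ and $\psi(x_k')=\zeta_k^{-1}\zeta_{k-1}\delta_t(V_{k-1},V_k)+\zeta_k^{-1}\zeta_{k+1}\delta_t(V_{k+1},V_k)$ for $1\le k\le n$, where $V_{n+1}=0$ and $x_k'$ is the mutation of $x_k$ in direction $k$ from the initial seed. *)

theory Defs
  imports
    "Jordan_Normal_Form.Determinant"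
    "Jordan_Normal_Form.Gauss_Jordan_Elimination"
    "HOL-Library.Poly_Mapping"
    "HOL-Computational_Algebra.Computational_Algebra"
    "HOL-Combinatorics.Permutations"
    "HOL-Algebra.Algebraic_Closure_Type"
    "HOL-Algebra.Generated_Rings"
    "HOL-Algebra.Algebra"
begin

text \<open>
  Conventions. A polynomial ring \<open>R[x\<^sub>a | a :: 'a]\<close> is the type \<open>('a \<Rightarrow>\<^sub>0 nat) \<Rightarrow>\<^sub>0 R\<close>, and a group
  ring \<open>R[\<int>\<^sup>k]\<close> (Laurent polynomials) is a subring of \<open>(nat \<Rightarrow>\<^sub>0 int) \<Rightarrow>\<^sub>0 R\<close>; the multiplication is
  convolution, \<open>Poly_Mapping.single 0 c\<close> is the constant \<open>c\<close>. Quiver nodes are \<open>0, \<dots>, n\<close>, and the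
  dimension vector \<open>v\<close> is extended by \<open>0\<close> beyond \<open>n\<close>. The indices \<open>j\<close> in \<open>\<xi>\<^sup>(\<^sup>i\<^sup>)\<^sub>j\<close> run over
  \<open>0, \<dots>, v i - 1\<close>, because matrices are indexed from \<open>0\<close>.
\<close>

type_synonym 'a mpoly_int = "('a \<Rightarrow>\<^sub>0 nat) \<Rightarrow>\<^sub>0 int"
type_synonym 'a mpoly_complex = "('a \<Rightarrow>\<^sub>0 nat) \<Rightarrow>\<^sub>0 complex"

definition mvar :: "'a \<Rightarrow> ('a \<Rightarrow>\<^sub>0 nat) \<Rightarrow>\<^sub>0 'b::zero_neq_one" where
  "mvar x = Poly_Mapping.single (Poly_Mapping.single x 1) 1"

definition mvars :: "(('a \<Rightarrow>\<^sub>0 nat) \<Rightarrow>\<^sub>0 'b::zero) \<Rightarrow> 'a set" where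
  "mvars p = (\<Union>m \<in> Poly_Mapping.keys p. Poly_Mapping.keys m)"

definition mconst :: "'b \<Rightarrow> ('a::zero) \<Rightarrow>\<^sub>0 'b::zero" where
  "mconst c = Poly_Mapping.single 0 c"

definition meval :: "('a \<Rightarrow> complex) \<Rightarrow> 'a mpoly_complex \<Rightarrow> complex" where
  "meval f p = (\<Sum>m \<in> Poly_Mapping.keys p.
     Poly_Mapping.lookup p m * (\<Prod>x \<in> Poly_Mapping.keys m. f x ^ Poly_Mapping.lookup m x))"


section \<open>The representation space and GIT semistability\<close>

type_synonym dimvec = "nat \<Rightarrow> nat"
type_synonym rep = "nat \<Rightarrow> complex mat"

definition rep_space :: "nat \<Rightarrow> dimvec \<Rightarrow> rep set" where
  "rep_space n v = {B. \<forall>i\<in>{1..n}. B i \<in> carrier_mat (v i) (v (i - 1))}"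

definition group_G :: "nat \<Rightarrow> dimvec \<Rightarrow> (nat \<Rightarrow> complex mat) set" where
  "group_G n v = {g. g 0 = 1\<^sub>m (v 0) \<and>
     (\<forall>i\<in>{1..n}. g i \<in> carrier_mat (v i) (v i) \<and> invertible_mat (g i))}"

definition group_K :: "nat \<Rightarrow> dimvec \<Rightarrow> (nat \<Rightarrow> complex mat) set" where
  "group_K n v = {g \<in> group_G n v. \<forall>i\<in>{1..n}. diagonal_mat (g i)}"

definition gact :: "(nat \<Rightarrow> complex mat) \<Rightarrow> rep \<Rightarrow> rep" where
  "gact g B = (\<lambda>i. g i * B i * the (mat_inverse (g (i - 1))))"

definition character :: "nat \<Rightarrow> (nat \<Rightarrow> int) \<Rightarrow> (nat \<Rightarrow> complex mat) \<Rightarrow> complex" where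
  "character n \<theta> g = (\<Prod>i=1..n. Determinant.det (g i) powi \<theta> i)"

text \<open>Matrix entries of \<open>B\<^sub>i\<close>, \<open>1 \<le> i \<le> n\<close>; these index both the coordinates and the weights of \<open>N\<close>.\<close>

definition entry_index :: "nat \<Rightarrow> dimvec \<Rightarrow> (nat \<times> nat \<times> nat) set" where
  "entry_index n v = {(i, j, m). 1 \<le> i \<and> i \<le> n \<and> j < v i \<and> m < v (i - 1)}"

definition regular_fun :: "(nat \<times> nat \<times> nat) mpoly_complex \<Rightarrow> rep \<Rightarrow> complex" where
  "regular_fun f B = meval (\<lambda>(i, j, m). B i $$ (j, m)) f"

text \<open>Semistability with respect to \<open>H\<close>, which will be \<open>G\<close> or \<open>K\<close>: some semi-invariant regular
  function of weight a positive multiple of \<open>\<theta>\<close> does not vanish at \<open>B\<close>.\<close>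

definition semistable ::
    "nat \<Rightarrow> dimvec \<Rightarrow> (nat \<Rightarrow> int) \<Rightarrow> (nat \<Rightarrow> complex mat) set \<Rightarrow> rep \<Rightarrow> bool" where
  "semistable n v \<theta> H B \<longleftrightarrow> B \<in> rep_space n v \<and>
     (\<exists>r f. r > 0 \<and> mvars f \<subseteq> entry_index n v \<and>
        (\<forall>g\<in>H. \<forall>B'\<in>rep_space n v.
           regular_fun f (gact g B') = character n \<theta> g ^ r * regular_fun f B') \<and>
        regular_fun f B \<noteq> 0)"


section \<open>Quasimaps and effective monoids\<close>

definition gauge_index :: "nat \<Rightarrow> dimvec \<Rightarrow> (nat \<times> nat) set" where
  "gauge_index n v = {(i, j). 1 \<le> i \<and> i \<le> n \<and> j < v i}"

text \<open>Sections of \<open>\<O>(a)\<close> on \<open>\<P>\<^sup>1\<close>, trivialised on the affine line.\<close>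

definition is_section :: "int \<Rightarrow> complex poly \<Rightarrow> bool" where
  "is_section a p \<longleftrightarrow> p = 0 \<or> int (Polynomial.degree p) \<le> a"

text \<open>
  A quasimap from \<open>\<P>\<^sup>1\<close> to \<open>[N/G]\<close> consists of vector bundles \<open>\<V>\<^sub>i\<close> of rank \<open>v i\<close> (\<open>1 \<le> i \<le> n\<close>, with
  \<open>\<V>\<^sub>0\<close> trivial) and a section of \<open>\<Oplus> Hom(\<V>\<^sub>i\<^sub>-\<^sub>1, \<V>\<^sub>i)\<close>. By the splitting theorem of Birkhoff and
  Grothendieck one may take \<open>\<V>\<^sub>i = \<Oplus>\<^sub>j \<O>(d\<^sub>i\<^sub>j)\<close>; for \<open>K\<close> in place of \<open>G\<close> the bundles come with such a
  splitting. Hence both kinds of quasimap are given by the degrees \<open>d\<close> and matrices \<open>F i\<close> of sections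
  of \<open>\<O>(d\<^sub>i\<^sub>j - d\<^sub>i\<^sub>-\<^sub>1\<^sub>,\<^sub>m)\<close>, and they differ in the group used for semistability. Note that
  \<open>d\<close> vanishes at the nodes \<open>(0, m)\<close>. The points of \<open>N\<close> are evaluated in the trivialisation on the
  affine line; landing generically in the semistable locus means at all but finitely many points.
\<close>

definition is_quasimap ::
    "nat \<Rightarrow> dimvec \<Rightarrow> (nat \<Rightarrow> int) \<Rightarrow> (nat \<Rightarrow> complex mat) set \<Rightarrow>
     (nat \<times> nat \<Rightarrow>\<^sub>0 int) \<Rightarrow> (nat \<Rightarrow> complex poly mat) \<Rightarrow> bool" where
  "is_quasimap n v \<theta> H d F \<longleftrightarrow>
     Poly_Mapping.keys d \<subseteq> gauge_index n v \<and>
     (\<forall>i\<in>{1..n}. F i \<in> carrier_mat (v i) (v (i - 1)) \<and>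
        (\<forall>j<v i. \<forall>m<v (i - 1).
           is_section (Poly_Mapping.lookup d (i, j) - Poly_Mapping.lookup d (i - 1, m))
             (F i $$ (j, m)))) \<and>
     finite {z. \<not> semistable n v \<theta> H (\<lambda>i. map_mat (\<lambda>p. poly p z) (F i))}"

text \<open>The map \<open>X\<^sub>*(K) \<rightarrow> \<pi>\<^sub>1(G) = \<int>\<^sup>n\<close>.\<close>

definition degree_bar :: "nat \<Rightarrow> dimvec \<Rightarrow> (nat \<times> nat \<Rightarrow>\<^sub>0 int) \<Rightarrow> (nat \<Rightarrow>\<^sub>0 int)" where
  "degree_bar n v d =
     (\<Sum>i=1..n. Poly_Mapping.single i (\<Sum>j<v i. Poly_Mapping.lookup d (i, j)))"

definition monoid_generated :: "'a::comm_monoid_add set \<Rightarrow> 'a set" where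
  "monoid_generated S = sum_list ` lists S"

definition Eff_X :: "nat \<Rightarrow> dimvec \<Rightarrow> (nat \<Rightarrow> int) \<Rightarrow> (nat \<Rightarrow>\<^sub>0 int) set" where
  "Eff_X n v \<theta> =
     monoid_generated {degree_bar n v d | d. \<exists>F. is_quasimap n v \<theta> (group_G n v) d F}"

definition Eff_Xab :: "nat \<Rightarrow> dimvec \<Rightarrow> (nat \<Rightarrow> int) \<Rightarrow> (nat \<times> nat \<Rightarrow>\<^sub>0 int) set" where
  "Eff_Xab n v \<theta> = monoid_generated {d. \<exists>F. is_quasimap n v \<theta> (group_K n v) d F}"


section \<open>The ring \<open>QH\<^sub>T\<^sup>p\<^sup>o\<^sup>l\<^sup>y(X)\<close>\<close>

text \<open>\<open>(i, j)\<close> stands for \<open>\<xi>\<^sup>(\<^sup>i\<^sup>)\<^sub>j\<close>, including the equivariant parameters of \<open>T\<close> at \<open>i = 0\<close>.\<close>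

type_synonym xipoly = "(nat \<times> nat) mpoly_complex"
type_synonym qxipoly = "(nat \<Rightarrow>\<^sub>0 int) \<Rightarrow>\<^sub>0 xipoly"

definition H_KT :: "nat \<Rightarrow> dimvec \<Rightarrow> xipoly set" where
  "H_KT n v = {p. mvars p \<subseteq> {(i, j). i \<le> n \<and> j < v i}}"

definition weyl_group :: "nat \<Rightarrow> dimvec \<Rightarrow> (nat \<times> nat \<Rightarrow> nat \<times> nat) set" where
  "weyl_group n v = {w. w permutes gauge_index n v \<and> (\<forall>x. fst (w x) = fst x)}"

text \<open>Positive roots \<open>\<xi>\<^sup>(\<^sup>i\<^sup>)\<^sub>j - \<xi>\<^sup>(\<^sup>i\<^sup>)\<^sub>m\<close> of \<open>G\<close>, \<open>j < m\<close>.\<close>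

definition pos_roots :: "nat \<Rightarrow> dimvec \<Rightarrow> (nat \<times> nat \<times> nat) set" where
  "pos_roots n v = {(i, j, m). 1 \<le> i \<and> i \<le> n \<and> j < m \<and> m < v i}"

definition weyl_length :: "nat \<Rightarrow> dimvec \<Rightarrow> (nat \<times> nat \<Rightarrow> nat \<times> nat) \<Rightarrow> nat" where
  "weyl_length n v w = card {(i, j, m) \<in> pos_roots n v. snd (w (i, m)) < snd (w (i, j))}"

text \<open>\<open>map_key w\<close> is composition with \<open>w\<close>; as it is applied twice, \<open>\<xi>\<^sub>x\<close> is sent to \<open>\<xi>\<close> with index \<open>w x\<close>.\<close>

definition weyl_act :: "(nat \<times> nat \<Rightarrow> nat \<times> nat) \<Rightarrow> xipoly \<Rightarrow> xipoly" where
  "weyl_act w p = Poly_Mapping.map_key (Poly_Mapping.map_key w) p"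

definition invariants :: "nat \<Rightarrow> dimvec \<Rightarrow> xipoly set" where
  "invariants n v = {p \<in> H_KT n v. \<forall>w\<in>weyl_group n v. weyl_act w p = p}"

definition euler_e :: "nat \<Rightarrow> dimvec \<Rightarrow> xipoly" where
  "euler_e n v = (\<Prod>(i, j, m)\<in>pos_roots n v. mvar (i, j) - mvar (i, m))"

definition two_rho :: "nat \<Rightarrow> dimvec \<Rightarrow> (nat \<times> nat \<Rightarrow>\<^sub>0 int) \<Rightarrow> int" where
  "two_rho n v d =
     (\<Sum>(i, j, m)\<in>pos_roots n v. Poly_Mapping.lookup d (i, j) - Poly_Mapping.lookup d (i, m))"

text \<open>The weight \<open>u + \<lambda> = \<xi>\<^sup>(\<^sup>i\<^sup>)\<^sub>j - \<xi>\<^sup>(\<^sup>i\<^sup>-\<^sup>1\<^sup>)\<^sub>m\<close> of \<open>K \<times> T\<close> on a matrix entry, and \<open>\<langle>\<lambda>, d\<rangle>\<close>.\<close>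

definition weight :: "nat \<times> nat \<times> nat \<Rightarrow> xipoly" where
  "weight = (\<lambda>(i, j, m). mvar (i, j) - mvar (i - 1, m))"

definition pairing :: "nat \<times> nat \<times> nat \<Rightarrow> (nat \<times> nat \<Rightarrow>\<^sub>0 int) \<Rightarrow> int" where
  "pairing = (\<lambda>(i, j, m) d. Poly_Mapping.lookup d (i, j) - Poly_Mapping.lookup d (i - 1, m))"

definition bracket :: "nat \<Rightarrow> dimvec \<Rightarrow> xipoly \<Rightarrow> (nat \<times> nat \<Rightarrow>\<^sub>0 int) \<Rightarrow> qxipoly" where
  "bracket n v g d = mconst g *
     (mconst (\<Prod>x\<in>{x \<in> entry_index n v. pairing x d > 0}. weight x ^ nat (pairing x d))
      - Poly_Mapping.single (degree_bar n v d)
          ((- 1) ^ nat \<bar>two_rho n v d\<bar> *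
           (\<Prod>x\<in>{x \<in> entry_index n v. pairing x d < 0}. weight x ^ nat (- pairing x d))))"

definition antisym :: "nat \<Rightarrow> dimvec \<Rightarrow> qxipoly \<Rightarrow> qxipoly" where
  "antisym n v f =
     (\<Sum>w\<in>weyl_group n v. (- 1) ^ weyl_length n v w * Poly_Mapping.map (weyl_act w) f)"

text \<open>\<open>H\<^sub>T\<^sup>*(pt) \<otimes> H\<^sub>K\<^sup>*(pt)\<^sup>W[Q]\<close>\<close>

definition big_ring :: "nat \<Rightarrow> dimvec \<Rightarrow> (nat \<Rightarrow> int) \<Rightarrow> qxipoly ring" where
  "big_ring n v \<theta> = ring_of_type_algebra\<lparr>carrier :=
     {f. Poly_Mapping.keys f \<subseteq> Eff_X n v \<theta> \<and>
         (\<forall>d. Poly_Mapping.lookup f d \<in> invariants n v)}\<rparr>"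

text \<open>Division by \<open>e\<close> takes place in the domain of polynomials in the \<open>\<xi>\<close>, coefficientwise in \<open>Q\<close>.\<close>

definition J_poly :: "nat \<Rightarrow> dimvec \<Rightarrow> (nat \<Rightarrow> int) \<Rightarrow> qxipoly set" where
  "J_poly n v \<theta> = genideal (big_ring n v \<theta>)
     {f \<in> carrier (big_ring n v \<theta>). \<exists>g\<in>H_KT n v. \<exists>d\<in>Eff_Xab n v \<theta>.
        mconst (euler_e n v) * f = antisym n v (bracket n v g d)}"

definition QH :: "nat \<Rightarrow> dimvec \<Rightarrow> (nat \<Rightarrow> int) \<Rightarrow> qxipoly set ring" where
  "QH n v \<theta> = big_ring n v \<theta> Quot J_poly n v \<theta>"

definition QH_class :: "nat \<Rightarrow> dimvec \<Rightarrow> (nat \<Rightarrow> int) \<Rightarrow> qxipoly \<Rightarrow> qxipoly set" where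
  "QH_class n v \<theta> f = J_poly n v \<theta> +>\<^bsub>big_ring n v \<theta>\<^esub> f"

text \<open>The image in \<open>QH[t]\<close> of a polynomial in \<open>t\<close> with \<open>W\<close>-invariant coefficients.\<close>

definition QH_poly :: "nat \<Rightarrow> dimvec \<Rightarrow> (nat \<Rightarrow> int) \<Rightarrow> xipoly poly \<Rightarrow> nat \<Rightarrow> qxipoly set" where
  "QH_poly n v \<theta> p = (\<lambda>k. QH_class n v \<theta> (mconst (Polynomial.coeff p k)))"


section \<open>Chern polynomials\<close>

definition chern :: "dimvec \<Rightarrow> nat \<Rightarrow> xipoly poly" where
  "chern v i = (\<Prod>j<v i. [:mvar (i, j), 1:])"

text \<open>\<open>c\<^sub>t(V\<^sub>i)\<close> as a Laurent series in \<open>t\<^sup>-\<^sup>1\<close>, that is, \<open>fls_X\<close> is \<open>t\<^sup>-\<^sup>1\<close>. Its lowest coefficient is \<open>1\<close>,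
  so that \<open>fls_right_inverse _ 1\<close> is its inverse.\<close>

definition chern_fls :: "dimvec \<Rightarrow> nat \<Rightarrow> xipoly fls" where
  "chern_fls v i = (\<Prod>j<v i. fls_X_inv + fls_const (mvar (i, j)))"

definition chern_quotient :: "dimvec \<Rightarrow> nat \<Rightarrow> nat \<Rightarrow> xipoly fls" where
  "chern_quotient v k l = chern_fls v k * fls_right_inverse (chern_fls v l) 1"

definition delta :: "dimvec \<Rightarrow> nat \<Rightarrow> nat \<Rightarrow> xipoly poly" where
  "delta v k l = Abs_poly (\<lambda>p. fls_nth (chern_quotient v k l) (- int p))"


section \<open>Tensor products of commutative rings\<close>

text \<open>The tensor product of \<open>A\<close> and \<open>B\<close> over \<open>R\<close>, where \<open>f : R \<rightarrow> A\<close> and \<open>g : R \<rightarrow> B\<close> are ring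
  homomorphisms: the free abelian group on \<open>carrier A \<times> carrier B\<close>, with the multiplication induced
  by \<open>A\<close> and \<open>B\<close>, modulo the bilinearity relations. The latter are stable under multiplication by
  basis elements, so the ideal they generate is the subgroup they generate.\<close>

definition pair_ring ::
    "('a, 'm) ring_scheme \<Rightarrow> ('b, 'k) ring_scheme \<Rightarrow> ('a \<times> 'b \<Rightarrow>\<^sub>0 int) ring" where
  "pair_ring A B = \<lparr>
     carrier = {c. Poly_Mapping.keys c \<subseteq> carrier A \<times> carrier B},
     monoid.mult = (\<lambda>c d. \<Sum>p\<in>Poly_Mapping.keys c. \<Sum>q\<in>Poly_Mapping.keys d.
        Poly_Mapping.single (fst p \<otimes>\<^bsub>A\<^esub> fst q, snd p \<otimes>\<^bsub>B\<^esub> snd q)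
          (Poly_Mapping.lookup c p * Poly_Mapping.lookup d q)),
     one = Poly_Mapping.single (\<one>\<^bsub>A\<^esub>, \<one>\<^bsub>B\<^esub>) 1,
     ring.zero = 0,
     add = (+)\<rparr>"

definition tensor_relations ::
    "('r, 'l) ring_scheme \<Rightarrow> ('a, 'm) ring_scheme \<Rightarrow> ('b, 'k) ring_scheme \<Rightarrow>
     ('r \<Rightarrow> 'a) \<Rightarrow> ('r \<Rightarrow> 'b) \<Rightarrow> ('a \<times> 'b \<Rightarrow>\<^sub>0 int) set" where
  "tensor_relations R A B f g =
     {Poly_Mapping.single (a \<oplus>\<^bsub>A\<^esub> a', b) 1 - Poly_Mapping.single (a, b) 1
        - Poly_Mapping.single (a', b) 1 | a a' b.
        a \<in> carrier A \<and> a' \<in> carrier A \<and> b \<in> carrier B} \<union>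
     {Poly_Mapping.single (a, b \<oplus>\<^bsub>B\<^esub> b') 1 - Poly_Mapping.single (a, b) 1
        - Poly_Mapping.single (a, b') 1 | a b b'.
        a \<in> carrier A \<and> b \<in> carrier B \<and> b' \<in> carrier B} \<union>
     {Poly_Mapping.single (f r \<otimes>\<^bsub>A\<^esub> a, b) 1 - Poly_Mapping.single (a, g r \<otimes>\<^bsub>B\<^esub> b) 1 | r a b.
        r \<in> carrier R \<and> a \<in> carrier A \<and> b \<in> carrier B}"

definition tensor_ideal ::
    "('r, 'l) ring_scheme \<Rightarrow> ('a, 'm) ring_scheme \<Rightarrow> ('b, 'k) ring_scheme \<Rightarrow>
     ('r \<Rightarrow> 'a) \<Rightarrow> ('r \<Rightarrow> 'b) \<Rightarrow> ('a \<times> 'b \<Rightarrow>\<^sub>0 int) set" where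
  "tensor_ideal R A B f g = genideal (pair_ring A B) (tensor_relations R A B f g)"

definition tensor_ring ::
    "('r, 'l) ring_scheme \<Rightarrow> ('a, 'm) ring_scheme \<Rightarrow> ('b, 'k) ring_scheme \<Rightarrow>
     ('r \<Rightarrow> 'a) \<Rightarrow> ('r \<Rightarrow> 'b) \<Rightarrow> ('a \<times> 'b \<Rightarrow>\<^sub>0 int) set ring" where
  "tensor_ring R A B f g = pair_ring A B Quot tensor_ideal R A B f g"

definition pure_tensor ::
    "('r, 'l) ring_scheme \<Rightarrow> ('a, 'm) ring_scheme \<Rightarrow> ('b, 'k) ring_scheme \<Rightarrow>
     ('r \<Rightarrow> 'a) \<Rightarrow> ('r \<Rightarrow> 'b) \<Rightarrow> 'a \<Rightarrow> 'b \<Rightarrow> ('a \<times> 'b \<Rightarrow>\<^sub>0 int) set" where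
  "pure_tensor R A B f g a b =
     tensor_ideal R A B f g +>\<^bsub>pair_ring A B\<^esub> Poly_Mapping.single (a, b) 1"


section \<open>The target ring of \<open>\<psi>\<close>\<close>

type_synonym laurent = "(nat \<Rightarrow>\<^sub>0 int) \<Rightarrow>\<^sub>0 complex"

definition C_Q :: "nat \<Rightarrow> dimvec \<Rightarrow> (nat \<Rightarrow> int) \<Rightarrow> laurent ring" where
  "C_Q n v \<theta> = ring_of_type_algebra\<lparr>carrier := {q. Poly_Mapping.keys q \<subseteq> Eff_X n v \<theta>}\<rparr>"

definition C_zeta :: "nat \<Rightarrow> laurent ring" where
  "C_zeta n = ring_of_type_algebra\<lparr>carrier :=
     {z. \<forall>a\<in>Poly_Mapping.keys z. Poly_Mapping.keys a \<subseteq> {..n}}\<rparr>"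

text \<open>Exponent vector of \<open>\<zeta>\<^sub>i\<close>, with \<open>\<zeta>\<^sub>n\<^sub>+\<^sub>1 = 1\<close>.\<close>

definition zexp :: "nat \<Rightarrow> nat \<Rightarrow> (nat \<Rightarrow>\<^sub>0 int)" where
  "zexp n i = (if i \<le> n then Poly_Mapping.single i 1 else 0)"

definition zmon :: "(nat \<Rightarrow>\<^sub>0 int) \<Rightarrow> laurent" where
  "zmon a = Poly_Mapping.single a 1"

text \<open>\<open>Q\<^sup>d \<mapsto> \<Prod>\<^sub>k ((-1)\<^bsup>v(k-1) - v(k)\<^esup> \<zeta>\<^sub>k\<^sub>-\<^sub>1\<^sup>-\<^sup>1 \<zeta>\<^sub>k\<^sub>+\<^sub>1)\<^bsup>d(k)\<^esup>\<close>, where the exponents may a priori be negative.\<close>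

definition Q_monomial_to_zeta :: "nat \<Rightarrow> dimvec \<Rightarrow> (nat \<Rightarrow>\<^sub>0 int) \<Rightarrow> laurent" where
  "Q_monomial_to_zeta n v d = Poly_Mapping.single
     (\<Sum>k=1..n. Poly_Mapping.map (\<lambda>c. Poly_Mapping.lookup d k * c)
        (zexp n (k + 1) - zexp n (k - 1)))
     (\<Prod>k=1..n. ((- 1) powi (int (v (k - 1)) - int (v k))) powi Poly_Mapping.lookup d k)"

definition Q_to_zeta :: "nat \<Rightarrow> dimvec \<Rightarrow> laurent \<Rightarrow> laurent" where
  "Q_to_zeta n v q =
     (\<Sum>d\<in>Poly_Mapping.keys q. mconst (Poly_Mapping.lookup q d) * Q_monomial_to_zeta n v d)"

definition Q_to_QHt :: "nat \<Rightarrow> dimvec \<Rightarrow> (nat \<Rightarrow> int) \<Rightarrow> laurent \<Rightarrow> nat \<Rightarrow> qxipoly set" where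
  "Q_to_QHt n v \<theta> q = up_ring.monom (UP (QH n v \<theta>)) (QH_class n v \<theta> (Poly_Mapping.map mconst q)) 0"

definition target_ring ::
    "nat \<Rightarrow> dimvec \<Rightarrow> (nat \<Rightarrow> int) \<Rightarrow> ((nat \<Rightarrow> qxipoly set) \<times> laurent \<Rightarrow>\<^sub>0 int) set ring" where
  "target_ring n v \<theta> =
     tensor_ring (C_Q n v \<theta>) (UP (QH n v \<theta>)) (C_zeta n) (Q_to_QHt n v \<theta>) (Q_to_zeta n v)"

text \<open>The element \<open>\<zeta>\<^sup>a \<cdot> p\<close>, where \<open>p\<close> is a polynomial in \<open>t\<close> with \<open>W\<close>-invariant coefficients.\<close>

definition target_elt ::
    "nat \<Rightarrow> dimvec \<Rightarrow> (nat \<Rightarrow> int) \<Rightarrow> (nat \<Rightarrow>\<^sub>0 int) \<Rightarrow> xipoly poly \<Rightarrow>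
     ((nat \<Rightarrow> qxipoly set) \<times> laurent \<Rightarrow>\<^sub>0 int) set" where
  "target_elt n v \<theta> a p =
     pure_tensor (C_Q n v \<theta>) (UP (QH n v \<theta>)) (C_zeta n) (Q_to_QHt n v \<theta>) (Q_to_zeta n v)
       (QH_poly n v \<theta> p) (zmon a)"


section \<open>The cluster algebra\<close>

text \<open>Rational functions in \<open>x\<^sub>0, x\<^sub>1, \<dots>\<close>; only \<open>x\<^sub>0, \<dots>, x\<^sub>n\<close> will occur.\<close>

type_synonym ratfun = "nat mpoly_int fract"
type_synonym seed = "(nat \<Rightarrow> ratfun) \<times> (nat \<Rightarrow> nat \<Rightarrow> int)"

definition xvar :: "nat \<Rightarrow> ratfun" where
  "xvar i = Fract (mvar i) 1"

definition num_arrows :: "nat \<Rightarrow> nat \<Rightarrow> nat \<Rightarrow> int" where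
  "num_arrows n i j = (if j = i + 1 \<and> j \<le> n then 1 else 0)"

definition initial_seed :: "nat \<Rightarrow> seed" where
  "initial_seed n = (xvar, \<lambda>i j. num_arrows n i j - num_arrows n j i)"

definition mutate :: "nat \<Rightarrow> nat \<Rightarrow> seed \<Rightarrow> seed" where
  "mutate n k = (\<lambda>(x, b).
     (x(k := ((\<Prod>i\<le>n. x i ^ nat (b i k)) + (\<Prod>i\<le>n. x i ^ nat (- b i k))) / x k),
      \<lambda>i j. if i = k \<or> j = k then - b i j
            else b i j + max 0 (b i k) * max 0 (b k j) - max 0 (- b i k) * max 0 (- b k j)))"

inductive_set seeds :: "nat \<Rightarrow> seed set" for n where
  initial: "initial_seed n \<in> seeds n"
| mutation: "s \<in> seeds n \<Longrightarrow> k \<in> {1..n} \<Longrightarrow> mutate n k s \<in> seeds n"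

definition cluster_variables :: "nat \<Rightarrow> ratfun set" where
  "cluster_variables n = {fst s i | s i. s \<in> seeds n \<and> i \<in> {1..n}}"

definition cluster_algebra :: "nat \<Rightarrow> ratfun ring" where
  "cluster_algebra n = ring_of_type_algebra\<lparr>carrier :=
     generate_ring ring_of_type_algebra (insert (xvar 0) (cluster_variables n))\<rparr>"

text \<open>The Laurent expansion of \<open>x\<close> in the initial cluster has denominator \<open>\<Prod>i\<in>D. x\<^sub>i\<close>, in lowest terms
  with respect to the initial cluster variables.\<close>

definition has_denominator :: "nat \<Rightarrow> ratfun \<Rightarrow> nat set \<Rightarrow> bool" where
  "has_denominator n x D \<longleftrightarrow> (\<exists>P :: nat mpoly_int.
     x = Fract P (\<Prod>i\<in>D. mvar i) \<and> (\<forall>i\<in>{1..n}. \<not> mvar i dvd P))"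

definition x_neg_simple :: "nat \<Rightarrow> ratfun" where
  "x_neg_simple k = xvar k"

definition x_root :: "nat \<Rightarrow> nat \<Rightarrow> nat \<Rightarrow> ratfun" where
  "x_root n k l = (if k = l then 1
     else (THE x. x \<in> cluster_variables n \<and> has_denominator n x {k + 1..l}))"

definition x_mutated :: "nat \<Rightarrow> nat \<Rightarrow> ratfun" where
  "x_mutated n k = fst (mutate n k (initial_seed n)) k"

end

theory Submission
  imports Defs
begin

text \<open>
  The cluster algebra is that of an \<open>(n + 3)\<close>-gon with vertices \<open>0, \<dots>, n + 2\<close>: seeds are labelled
  triangulations, mutations are flips, and the exchange relations are Ptolemy relations. The chord
  \<open>{i, n + 2}\<close> has length \<open>x\<^sub>i\<close>, where the side \<open>{0, n + 2}\<close> is the frozen one, all other sides have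
  length \<open>1\<close>, and \<open>x[kl]\<close> is the length of \<open>{k, l + 1}\<close>. One Ptolemy relation reads
  \<open>x\<^sub>l x[kl] = x\<^sub>l\<^sub>+\<^sub>1 x[k, l - 1] + x\<^sub>k\<close>, with \<open>x\<^sub>n\<^sub>+\<^sub>1 = 1\<close>. By induction on \<open>l\<close>, its image under \<open>\<psi>\<close>
  says that \<open>\<zeta>\<^sub>l \<zeta>\<^sub>k\<^sup>-\<^sup>1 \<psi>(x[kl])\<close>, multiplied by \<open>c\<^sub>t(V\<^sub>l)\<close>, equals \<open>c\<^sub>t(V\<^sub>k)\<close> plus a multiple of
  \<open>c\<^sub>t(V\<^sub>l\<^sub>+\<^sub>1) \<delta>\<^sub>t(V\<^sub>k, V\<^sub>l\<^sub>-\<^sub>1)\<close>, and the latter has degree less than \<open>v\<^sub>l\<close> in \<open>t\<close> by the assumption on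
  the dimension vector. As \<open>c\<^sub>t(V\<^sub>l)\<close> is monic of degree \<open>v\<^sub>l\<close>, the factor is the quotient of
  \<open>c\<^sub>t(V\<^sub>k)\<close> by \<open>c\<^sub>t(V\<^sub>l)\<close>, which is \<open>\<delta>\<^sub>t(V\<^sub>k, V\<^sub>l)\<close>.
\<close>

section \<open>Triangulations and flips\<close>

text \<open>The exchange relations hold in the field of rational functions and reach the target
  through \<psi>. The obstacle is the cancellation of c_t(V_l) there: the target may have zero
  divisors, and it is presented as a quotient of a free abelian group of pairs, not as a polynomial
  ring in t. Degree arguments are therefore carried out with operators \<open>coeff_at\<close> on
  this free group that preserve the ideal of tensor relations. Leading coefficients are then 1 up to
  a monomial in the \<zeta>, which is a unit, and this is all that long division needs. The two
  remainders to be discarded carry different monomials in the \<zeta>; only their degrees in t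
  matter.

  Ptolemy relations are three-term Pluecker relations between 2 by 2 minors. For vectors x_i (1,
  s_i) the minor of i and i + 1 is x_i x_(i+1) (s_(i+1) - s_i), so unit sides force the differences
  of the s_i to be 1 / (x_i x_(i+1)), which explains the sums in \<open>chord\<close>. Clearing
  denominators leaves a polynomial with positive coefficients, from which the denominator of every
  chord is read off.\<close>

definition cyc :: "nat \<Rightarrow> nat \<Rightarrow> nat \<Rightarrow> bool" where
  "cyc a b c \<longleftrightarrow> a < b \<and> b < c \<or> b < c \<and> c < a \<or> c < a \<and> a < b"

text \<open>Everything is phrased through the cyclic order, so that flips need no case distinction
  on the position of the vertex \<open>0\<close>. Crossing is strict: chords with a common end point
  do not cross.\<close>

definition crossing :: "nat \<Rightarrow> nat \<Rightarrow> nat \<Rightarrow> nat \<Rightarrow> bool" where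
  "crossing a b c d \<longleftrightarrow> cyc a c b \<and> cyc b d a \<or> cyc a d b \<and> cyc b c a"

lemma cyc_rotate: "cyc a b c \<Longrightarrow> cyc b c a"
  by (auto simp: cyc_def)

lemma cyc_trans: "cyc a b c \<Longrightarrow> cyc a c d \<Longrightarrow> cyc a b d"
  by (auto simp: cyc_def)

lemma cyc_total: "a \<noteq> b \<Longrightarrow> b \<noteq> c \<Longrightarrow> c \<noteq> a \<Longrightarrow> cyc a b c \<or> cyc a c b"
  by (auto simp: cyc_def)

text \<open>\<open>p\<close> lies on the arc from \<open>d\<close> to \<open>b\<close> that contains
  \<open>a\<close>. If it differs from \<open>a\<close>, it lies strictly between \<open>d\<close>
  and \<open>a\<close> or between \<open>a\<close> and \<open>b\<close>, and then
  \<open>{p, q}\<close> crosses that side of the triangle \<open>d, a, b\<close>.\<close>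

lemma crossing_corner:
  assumes "cyc d a b" "cyc p b q" "cyc q d p" "\<not> crossing p q a b" "\<not> crossing p q d a"
  shows "p = a"
proof (rule ccontr)
  assume "p \<noteq> a"
  then have "cyc p a b \<or> cyc p b a"
    using assms(1,2) by (intro cyc_total) (auto simp: cyc_def)
  then show False
  proof
    assume "cyc p a b"
    then have "cyc p a q" using assms(2) cyc_trans by blast
    with assms show False by (auto simp: crossing_def)
  next
    assume "cyc p b a"
    then have "cyc d a p" using assms(1-3) by (meson cyc_rotate cyc_trans)
    then have "cyc q a p" using assms(3) by (meson cyc_rotate cyc_trans)
    with assms show False by (auto simp: crossing_def)
  qed
qed

text \<open>A chord that crosses \<open>{b, d}\<close> has one end on the side of \<open>a\<close>
  and one on the side of \<open>c\<close>. Applied at both corners, \<open>crossing_corner\<close>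
  forces these ends to be \<open>a\<close> and \<open>c\<close>.\<close>

lemma crossing_flip:
  assumes "cyc a b c" "cyc c d a"
    and "\<not> crossing p q a b" "\<not> crossing p q b c" "\<not> crossing p q c d" "\<not> crossing p q d a"
      "{p, q} \<noteq> {a, c}"
  shows "\<not> crossing p q b d"
proof
  have *: "cyc d a b" "cyc b c d" using assms(1,2) by (meson cyc_rotate cyc_trans)+
  assume "crossing p q b d"
  then consider "cyc p b q" "cyc q d p" | "cyc p d q" "cyc q b p" by (auto simp: crossing_def)
  then show False
  proof cases
    case 1
    have "p = a" using crossing_corner[OF *(1) 1] assms by blast
    moreover have "q = c" using crossing_corner[OF *(2), of q p] 1 assms by (auto simp: crossing_def)
    ultimately show False using assms by auto
  next
    case 2
    have "q = a" using crossing_corner[OF *(1), of q p] 2 assms by (auto simp: crossing_def)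
    moreover have "p = c" using crossing_corner[OF *(2), of p q] 2 assms by (auto simp: crossing_def)
    ultimately show False using assms by auto
  qed
qed

lemma crossing_commute:
  "crossing a b c d \<longleftrightarrow> crossing b a c d" "crossing a b c d \<longleftrightarrow> crossing a b d c"
  "crossing a b c d \<longleftrightarrow> crossing c d a b"
  unfolding crossing_def by (blast, blast, meson cyc_rotate cyc_trans)

lemma not_crossing_Suc: "\<not> crossing p q a (Suc a)" "\<not> crossing p q (Suc a) a"
  unfolding crossing_def cyc_def by auto

section \<open>Lengths as minors, and labelled triangulations\<close>

definition plucker :: "(nat \<Rightarrow> 'a) \<Rightarrow> (nat \<Rightarrow> 'a) \<Rightarrow> nat \<Rightarrow> nat \<Rightarrow> 'a::comm_ring_1" where
  "plucker u v i j = (if i < j then u i * v j - v i * u j else u j * v i - v j * u i)"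

lemma plucker_commute: "plucker u v i j = plucker u v j i"
  by (auto simp: plucker_def algebra_simps not_less order.order_iff_strict)

text \<open>This is the three-term Pluecker relation. Each minor in \<open>plucker\<close> is taken
  with the smaller index first, so the signs come out the same for all four rotations of
  \<open>a, b, c, d\<close> that can be increasing.\<close>

lemma ptolemy:
  assumes "cyc a b c" "cyc c d a"
  shows "plucker u v a c * plucker u v b d =
         plucker u v a b * plucker u v c d + plucker u v b c * plucker u v d a"
proof -
  have "a < b \<and> b < c \<and> c < d \<or> b < c \<and> c < d \<and> d < a \<or> c < d \<and> d < a \<and> a < b \<or> d < a \<and> a < b \<and> b < c"
    using assms unfolding cyc_def by linarith
  then show ?thesis
    by (elim disjE) (simp_all add: plucker_def algebra_simps)
qed

text \<open>The label \<open>0\<close> belongs to the side \<open>{0, n + 2}\<close>; the remaining sides are unlabelled.\<close>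

definition side :: "nat \<Rightarrow> (nat \<Rightarrow> nat set) \<Rightarrow> nat \<Rightarrow> nat \<Rightarrow> bool" where
  "side n D a b \<longleftrightarrow> (\<exists>i\<le>n. D i = {a, b}) \<or> b = Suc a \<and> b \<le> n + 2 \<or> a = Suc b \<and> a \<le> n + 2"

text \<open>The union of the two triangles that share the diagonal \<open>{a, c}\<close>. Rotation
  by two steps keeps this diagonal, rotation by one step passes to the other one.\<close>

definition quad :: "nat \<Rightarrow> (nat \<Rightarrow> nat set) \<Rightarrow> nat \<Rightarrow> nat \<Rightarrow> nat \<Rightarrow> nat \<Rightarrow> bool" where
  "quad n D a b c d \<longleftrightarrow> a \<le> n + 2 \<and> b \<le> n + 2 \<and> c \<le> n + 2 \<and> d \<le> n + 2 \<and> cyc a b c \<and> cyc c d a \<and>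
     side n D a b \<and> side n D b c \<and> side n D c d \<and> side n D d a"

text \<open>The exchange matrix entry in the column of the diagonal \<open>{a, c}\<close> of the quadrilateral \<open>a, b, c, d\<close>.\<close>

definition quad_sign :: "nat set \<Rightarrow> nat \<Rightarrow> nat \<Rightarrow> nat \<Rightarrow> nat \<Rightarrow> int" where
  "quad_sign e a b c d =
     of_bool (e = {a, b} \<or> e = {c, d}) - of_bool (e = {b, c} \<or> e = {d, a})"

text \<open>The label \<open>0\<close> takes part in the rows and in the non-crossing condition, but
  only mutable labels have a quadrilateral. Together with skew-symmetry, the columns given here
  determine the whole matrix on the labels up to \<open>n\<close>.\<close>

definition triangulated ::
    "nat \<Rightarrow> (nat \<Rightarrow> nat \<Rightarrow> 'a) \<Rightarrow> (nat \<Rightarrow> nat set) \<Rightarrow> (nat \<Rightarrow> 'a) \<times> (nat \<Rightarrow> nat \<Rightarrow> int) \<Rightarrow> bool" where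
  "triangulated n len D s \<longleftrightarrow>
     D 0 = {0, n + 2} \<and> inj_on D {..n} \<and>
     (\<forall>i\<le>n. \<exists>a c. a < c \<and> c \<le> n + 2 \<and> D i = {a, c} \<and> fst s i = len a c) \<and>
     (\<forall>i\<le>n. \<forall>j\<le>n. \<forall>a b c d. D i = {a, b} \<longrightarrow> D j = {c, d} \<longrightarrow> \<not> crossing a b c d) \<and>
     (\<forall>i\<le>n. \<forall>j\<le>n. snd s i j = - snd s j i) \<and>
     (\<forall>k\<in>{1..n}. \<exists>a b c d. D k = {a, c} \<and> quad n D a b c d \<and>
        (\<forall>i\<le>n. snd s i k = quad_sign (D i) a b c d))"

lemma quad_rotate: "quad n D a b c d \<Longrightarrow> quad n D c d a b"
  by (auto simp: quad_def)

lemma quad_sign_rotate: "quad_sign e a b c d = quad_sign e c d a b"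
  by (auto simp: quad_sign_def)

lemma side_commute: "side n D a b \<longleftrightarrow> side n D b a"
  by (auto simp: side_def insert_commute)

lemma quad_distinct: "quad n D a b c d \<Longrightarrow> distinct [a, b, c, d]"
  by (auto simp: quad_def cyc_def)

lemma side_update:
  assumes "side n D p q" "D k \<noteq> {p, q}"
  shows "side n (D(k := e)) p q"
  using assms by (auto simp: side_def)

lemma quad_sides_distinct:
  assumes "quad n D a b c d"
  shows "{a, b} \<noteq> {b, c}" "{a, b} \<noteq> {c, d}" "{a, b} \<noteq> {d, a}" "{b, c} \<noteq> {c, d}" "{b, c} \<noteq> {d, a}"
    "{c, d} \<noteq> {d, a}" "{a, c} \<noteq> {b, d}" "{a, c} \<noteq> {a, b}" "{a, c} \<noteq> {b, c}" "{a, c} \<noteq> {c, d}"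
    "{a, c} \<noteq> {d, a}"
  using quad_distinct[OF assms] by (auto simp: doubleton_eq_iff)

lemma mutate_entry:
  "snd (mutate n k s) i j = (if i = k \<or> j = k then - snd s i j
     else snd s i j + max 0 (snd s i k) * max 0 (snd s k j)
       - max 0 (- snd s i k) * max 0 (- snd s k j))"
  by (simp add: mutate_def case_prod_unfold)

text \<open>The four sides are distinct, so the indicators cannot cancel. The two parts are the
  exponents in the two exchange monomials.\<close>

lemma quad_sign_parts:
  assumes "quad n D a b c d"
  shows "max 0 (quad_sign e a b c d) = of_bool (e = {a, b}) + of_bool (e = {c, d})"
    "max 0 (- quad_sign e a b c d) = of_bool (e = {b, c}) + of_bool (e = {d, a})"
  using quad_sides_distinct[OF assms] by (auto simp: quad_sign_def)

lemma quad_sign_nonzero_iff: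
  assumes "quad n D a b c d"
  shows "quad_sign e a b c d \<noteq> 0 \<longleftrightarrow> e = {a, b} \<or> e = {c, d} \<or> e = {b, c} \<or> e = {d, a}"
  using quad_sides_distinct[OF assms] by (auto simp: quad_sign_def)

lemma quad_sign_diagonal:
  assumes "quad n D a b c d"
  shows "quad_sign {a, c} a b c d = 0"
  using quad_sign_nonzero_iff[OF assms, of "{a, c}"] quad_sides_distinct[OF assms] by blast

lemma quad_crossing: "quad n D a b c d \<Longrightarrow> crossing a c b d"
  by (auto simp: quad_def crossing_def)

locale polygon_lengths =
  fixes n :: nat and len :: "nat \<Rightarrow> nat \<Rightarrow> ratfun"
  assumes len_commute: "len a b = len b a"
    and len_Suc: "a \<le> n + 1 \<Longrightarrow> len a (Suc a) = 1"
    and len_nonzero: "a < b \<Longrightarrow> b \<le> n + 2 \<Longrightarrow> len a b \<noteq> 0"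
    and len_ptolemy: "cyc a b c \<Longrightarrow> cyc c d a \<Longrightarrow>
      len a c * len b d = len a b * len c d + len b c * len d a"
begin

section \<open>Mutation of a labelled triangulation as a flip\<close>

lemma triangulatedD:
  assumes "triangulated n len D s"
  shows "D 0 = {0, n + 2}" "inj_on D {..n}"
    "\<And>i. i \<le> n \<Longrightarrow> \<exists>a c. a < c \<and> c \<le> n + 2 \<and> D i = {a, c} \<and> fst s i = len a c"
    "\<And>i j a b c d. i \<le> n \<Longrightarrow> j \<le> n \<Longrightarrow> D i = {a, b} \<Longrightarrow> D j = {c, d} \<Longrightarrow> \<not> crossing a b c d"
    "\<And>i j. i \<le> n \<Longrightarrow> j \<le> n \<Longrightarrow> snd s i j = - snd s j i"
    "\<And>k. k \<in> {1..n} \<Longrightarrow> \<exists>a b c d. D k = {a, c} \<and> quad n D a b c d \<and>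
        (\<forall>i\<le>n. snd s i k = quad_sign (D i) a b c d)"
proof -
  note * = assms[unfolded triangulated_def]
  show "D 0 = {0, n + 2}" "inj_on D {..n}"
    using *[THEN conjunct1] *[THEN conjunct2, THEN conjunct1] .
  note * = *[THEN conjunct2, THEN conjunct2]
  show "\<And>i. i \<le> n \<Longrightarrow> \<exists>a c. a < c \<and> c \<le> n + 2 \<and> D i = {a, c} \<and> fst s i = len a c"
    using *[THEN conjunct1] by blast
  note * = *[THEN conjunct2]
  show "\<And>i j a b c d. i \<le> n \<Longrightarrow> j \<le> n \<Longrightarrow> D i = {a, b} \<Longrightarrow> D j = {c, d} \<Longrightarrow> \<not> crossing a b c d"
    using *[THEN conjunct1] by blast
  note * = *[THEN conjunct2]
  show "\<And>i j. i \<le> n \<Longrightarrow> j \<le> n \<Longrightarrow> snd s i j = - snd s j i"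
    using *[THEN conjunct1] by blast
  show "\<And>k. k \<in> {1..n} \<Longrightarrow> \<exists>a b c d. D k = {a, c} \<and> quad n D a b c d \<and>
        (\<forall>i\<le>n. snd s i k = quad_sign (D i) a b c d)"
    using *[THEN conjunct2] by blast
qed

lemma triangulated_len:
  assumes "triangulated n len D s" "i \<le> n" "D i = {a, b}"
  shows "fst s i = len a b"
  using triangulatedD(3)[OF assms(1,2)] assms(3) len_commute
  by (auto simp: doubleton_eq_iff)

lemma side_not_crossing:
  assumes "triangulated n len D s" "side n D a b" "i \<le> n" "D i = {p, q}"
  shows "\<not> crossing p q a b"
  using triangulatedD(4)[OF assms(1)] assms(2-) not_crossing_Suc unfolding side_def by blast

text \<open>By injectivity of \<open>D\<close> at most one factor differs from \<open>1\<close>; a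
  side that no label carries joins consecutive vertices and has length \<open>1\<close>. So
  unlabelled sides can be counted in exchange monomials like variables.\<close>

lemma prod_side:
  assumes T: "triangulated n len D s" and s: "side n D a b"
  shows "(\<Prod>i\<le>n. fst s i ^ of_bool (D i = {a, b})) = len a b"
proof (cases "\<exists>i\<le>n. D i = {a, b}")
  case True
  then obtain i where i: "i \<le> n" "D i = {a, b}" by blast
  have "(\<Prod>j\<in>{..n} - {i}. fst s j ^ of_bool (D j = {a, b})) = 1"
    using i triangulatedD(2)[OF T] by (intro prod.neutral) (auto dest: inj_onD)
  then show ?thesis
    using i triangulated_len[OF T i] by (subst prod.remove[of _ i]) auto
next
  case False
  then have "len a b = 1"
    using s len_Suc[of a] len_Suc[of b] len_commute[of a b] by (auto simp: side_def)
  with False show ?thesis by (auto intro!: prod.neutral)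
qed

lemma not_side_flip:
  assumes T: "triangulated n len D s" and k: "k \<le> n" "D k = {a, c}" and q: "quad n D a b c d"
  shows "\<not> side n D b d"
  using side_not_crossing[OF T _ k, of b d] quad_crossing[OF q] by blast

text \<open>The flip keeps the triangle of \<open>D j\<close> outside the quadrilateral and replaces
  the one inside, \<open>a, b, c\<close>, by \<open>a, b, d\<close> or \<open>b, c, d\<close>. So in
  the quadrilateral of \<open>j\<close> a single vertex moves, to \<open>d\<close>. The sides
  \<open>{c, d}\<close> and \<open>{d, a}\<close> are left to a rotation.\<close>

lemma flip_column_adjacent:
  assumes T: "triangulated n len D s" and k: "k \<in> {1..n}" "D k = {a, c}" and q: "quad n D a b c d"
    and col: "\<forall>i\<le>n. snd s i k = quad_sign (D i) a b c d"
    and j: "j \<in> {1..n}" "j \<noteq> k" and Dj: "D j = {a, b} \<or> D j = {b, c}"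
  defines "D' \<equiv> D(k := {b, d})" and "s' \<equiv> mutate n k s"
  shows "\<exists>p r q t. D' j = {p, q} \<and> quad n D' p r q t \<and> (\<forall>i\<le>n. snd s' i j = quad_sign (D' i) p r q t)"
proof -
  obtain p r q t where p: "D j = {p, q}" "quad n D p r q t"
      "\<forall>i\<le>n. snd s i j = quad_sign (D i) p r q t"
    using triangulatedD(6)[OF T j(1)] by blast
  note qd = quad_distinct[OF q]
  have inj: "D i \<noteq> D k" if "i \<le> n" "i \<noteq> k" for i
    using that triangulatedD(2)[OF T] k(1) by (auto dest: inj_onD)
  have nbd: "D i \<noteq> {b, d}" if "i \<le> n" for i
    using not_side_flip[OF T _ k(2) q] k(1) that by (auto simp: side_def)
  \<comment> \<open>Skew-symmetry turns \<open>D j\<close> being a side of the quadrilateral of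
    \<open>k\<close> into \<open>D k\<close> being a side of the quadrilateral of
    \<open>j\<close>.\<close>
  have bjk: "snd s j k \<noteq> 0"
    using col[rule_format, of j] j(1) Dj quad_sign_nonzero_iff[OF q, of "D j"] by simp blast
  then have bkj: "quad_sign (D k) p r q t \<noteq> 0"
    using p(3) triangulatedD(5)[OF T, of j k] j k by auto
  have cyc: "cyc a b c" "cyc c d a" "a \<le> n + 2" "b \<le> n + 2" "c \<le> n + 2" "d \<le> n + 2"
    and sides: "side n D a b" "side n D b c" "side n D c d" "side n D d a"
    using q by (auto simp: quad_def)
  have cyc': "cyc b d a" "cyc c d b" using cyc cyc_rotate cyc_trans by metis+
  show ?thesis
    using Dj
  proof
    assume Dj: "D j = {a, b}"
    have "p = a \<and> q = b \<or> p = b \<and> q = a" using p(1) Dj by (auto simp: doubleton_eq_iff)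
    then have "\<exists>r t. quad n D a r b t \<and> (\<forall>i\<le>n. snd s i j = quad_sign (D i) a r b t)"
      using p(2,3) quad_rotate[OF p(2)] quad_sign_rotate[of _ p r q t] by metis
    then obtain r t where p: "quad n D a r b t"
        "\<forall>i\<le>n. snd s i j = quad_sign (D i) a r b t"
      by blast
    note pd = quad_distinct[OF p(1)]
    have "quad_sign {a, c} a r b t \<noteq> 0"
      using bkj p(2) k triangulatedD(5)[OF T, of j k] bjk j by auto
    moreover have "cyc a r b" "cyc b t a" and ar: "side n D a r" "side n D r b" "r \<le> n + 2"
      using p(1) by (auto simp: quad_def)
    \<comment> \<open>\<open>r\<close> and \<open>c\<close> lie on opposite sides of
      \<open>{a, b}\<close>, so \<open>{a, c}\<close> can only be the side
      \<open>{t, a}\<close>.\<close>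
    moreover have "r \<noteq> c" using cyc(1) \<open>cyc a r b\<close> by (auto simp: cyc_def)
    ultimately have t: "t = c"
      using qd pd by (auto simp: quad_sign_nonzero_iff[OF p(1)] doubleton_eq_iff)
    have "r \<noteq> d" using cyc'(1) \<open>cyc a r b\<close> by (auto simp: cyc_def)
    have "quad n D' a r b d"
      unfolding quad_def
    proof (intro conjI)
      show "side n D' a r" "side n D' r b" "side n D' d a"
        using ar sides qd pd t k(2) unfolding D'_def
        by (auto intro!: side_update simp: doubleton_eq_iff)
      show "side n D' b d" using k by (auto simp: side_def D'_def)
    qed (use cyc ar cyc' \<open>cyc a r b\<close> in auto)
    moreover have "D' j = {a, b}" using Dj j by (simp add: D'_def)
    moreover have bk: "snd s k j = -1"
    proof -
      have "distinct [a, r, b, c]" using pd t by simp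
      then have "quad_sign {a, c} a r b c = -1"
        by (simp add: quad_sign_def doubleton_eq_iff)
      then show ?thesis using p(2) k t by simp
    qed
    moreover have "snd s' i j = quad_sign (D' i) a r b d" if i: "i \<le> n" for i
    proof (cases "i = k")
      case True
      then show ?thesis
        using True bk qd pd t \<open>r \<noteq> d\<close> by (auto simp: s'_def D'_def mutate_entry quad_sign_def doubleton_eq_iff)
    next
      case False
      \<comment> \<open>As \<open>snd s k j\<close> is \<open>-1\<close>, mutation subtracts the
        negative part of column \<open>k\<close>: this cancels the indicator of
        \<open>{b, c}\<close> in the old column and introduces that of
        \<open>{d, a}\<close>.\<close>
      then have "snd s' i j = quad_sign (D i) a r b c - (of_bool (D i = {b, c}) + of_bool (D i = {d, a}))"
        using bk j p(2) col i t quad_sign_parts[OF q, of "D i"]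
        by (simp add: s'_def mutate_entry)
      also have "\<dots> = quad_sign (D i) a r b d"
      proof -
        have "D i \<noteq> {c, a}" "D i \<noteq> {b, d}" "{a, r} \<noteq> {b, c}" "{d, a} \<noteq> {r, b}" "{b, c} \<noteq> {d, a}"
          using inj[OF i False] nbd[OF i] k(2) qd pd t by (auto simp: doubleton_eq_iff)
        then show ?thesis
          by (cases "D i = {a, r}"; cases "D i = {b, c}"; cases "D i = {r, b}"; cases "D i = {d, a}")
            (simp_all add: quad_sign_def)
      qed
      finally show ?thesis using False by (simp add: D'_def)
    qed
    ultimately show ?thesis by blast
  next
    assume Dj: "D j = {b, c}"
    have "p = b \<and> q = c \<or> p = c \<and> q = b" using p(1) Dj by (auto simp: doubleton_eq_iff)
    then have "\<exists>r t. quad n D b r c t \<and> (\<forall>i\<le>n. snd s i j = quad_sign (D i) b r c t)"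
      using p(2,3) quad_rotate[OF p(2)] quad_sign_rotate[of _ p r q t] by metis
    then obtain r t where p: "quad n D b r c t"
        "\<forall>i\<le>n. snd s i j = quad_sign (D i) b r c t"
      by blast
    note pd = quad_distinct[OF p(1)]
    have "quad_sign {a, c} b r c t \<noteq> 0"
      using bkj p(2) k triangulatedD(5)[OF T, of j k] bjk j by auto
    moreover have "cyc b r c" "cyc c t b" and ar: "side n D b r" "side n D r c" "r \<le> n + 2"
      using p(1) by (auto simp: quad_def)
    moreover have "r \<noteq> a" using cyc(1) \<open>cyc b r c\<close> by (auto simp: cyc_def)
    ultimately have t: "t = a"
      using qd pd by (auto simp: quad_sign_nonzero_iff[OF p(1)] doubleton_eq_iff)
    have "r \<noteq> d" using cyc'(2) \<open>cyc b r c\<close> by (auto simp: cyc_def)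
    have "quad n D' b r c d"
      unfolding quad_def
    proof (intro conjI)
      show "side n D' b r" "side n D' r c" "side n D' c d"
        using ar sides qd pd t k(2) unfolding D'_def
        by (auto intro!: side_update simp: doubleton_eq_iff)
      show "side n D' d b" using k by (auto simp: side_def D'_def)
    qed (use cyc ar cyc' \<open>cyc b r c\<close> in auto)
    moreover have "D' j = {b, c}" using Dj j by (simp add: D'_def)
    moreover have "snd s' i j = quad_sign (D' i) b r c d" if i: "i \<le> n" for i
    proof -
      have bk: "snd s k j = 1"
      proof -
        have "distinct [b, r, c, a]" using pd t by simp
        then have "quad_sign {a, c} b r c a = 1"
          by (simp add: quad_sign_def doubleton_eq_iff)
        then show ?thesis using p(2) k t by simp
      qed
      show ?thesis
      proof (cases "i = k")
        case True
        then show ?thesis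
          using bk qd pd t \<open>r \<noteq> d\<close> by (auto simp: s'_def D'_def mutate_entry quad_sign_def doubleton_eq_iff)
      next
        case False
        \<comment> \<open>Here \<open>snd s k j\<close> is \<open>1\<close>, and adding the positive
          part of column \<open>k\<close> cancels \<open>{a, b}\<close> and introduces
          \<open>{c, d}\<close>.\<close>
        have "snd s' i j = quad_sign (D i) b r c a + (of_bool (D i = {a, b}) + of_bool (D i = {c, d}))"
          using False j p(2) col i t quad_sign_parts[OF q, of "D i"] bk
          by (simp add: s'_def mutate_entry)
        also have "\<dots> = quad_sign (D i) b r c d"
        proof -
          have "D i \<noteq> {c, a}" "D i \<noteq> {d, b}" "{a, b} \<noteq> {r, c}" "{b, r} \<noteq> {c, d}" "{a, b} \<noteq> {c, d}"
            using inj[OF i False] nbd[OF i] k(2) qd pd t by (auto simp: doubleton_eq_iff)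
          then show ?thesis
            by (cases "D i = {b, r}"; cases "D i = {c, d}"; cases "D i = {r, c}"; cases "D i = {a, b}")
              (simp_all add: quad_sign_def)
        qed
        finally show ?thesis using False by (simp add: D'_def)
      qed
    qed
    ultimately show ?thesis by blast
  qed
qed

text \<open>If \<open>snd s k j\<close> vanishes, \<open>D k\<close> is not a side of the
  quadrilateral of \<open>j\<close>, which therefore survives the flip; the new diagonal is not
  among its sides either, because it crosses \<open>D k\<close>. Otherwise \<open>D j\<close> is a
  side of the flipped quadrilateral.\<close>

lemma flip_column:
  assumes T: "triangulated n len D s" and k: "k \<in> {1..n}" "D k = {a, c}" and q: "quad n D a b c d"
    and col: "\<forall>i\<le>n. snd s i k = quad_sign (D i) a b c d"
    and j: "j \<in> {1..n}" "j \<noteq> k"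
  defines "D' \<equiv> D(k := {b, d})" and "s' \<equiv> mutate n k s"
  shows "\<exists>p r q t. D' j = {p, q} \<and> quad n D' p r q t \<and> (\<forall>i\<le>n. snd s' i j = quad_sign (D' i) p r q t)"
proof (cases "snd s k j = 0")
  case True
  obtain p r q' t where p: "D j = {p, q'}" "quad n D p r q' t"
      "\<forall>i\<le>n. snd s i j = quad_sign (D i) p r q' t"
    using triangulatedD(6)[OF T j(1)] by blast
  have nk: "D k \<noteq> {p, r}" "D k \<noteq> {r, q'}" "D k \<noteq> {q', t}" "D k \<noteq> {t, p}"
    using True p(3) k(1) quad_sign_nonzero_iff[OF p(2), of "D k"] by auto
  have *: "{b, d} \<noteq> {x, y}" if "side n D x y" for x y
    using that not_side_flip[OF T _ k(2) q] k(1) side_commute[of n D b d] by (auto simp: doubleton_eq_iff)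
  have nbd: "{b, d} \<noteq> {p, r}" "{b, d} \<noteq> {r, q'}" "{b, d} \<noteq> {q', t}" "{b, d} \<noteq> {t, p}"
    by (rule *, use p(2) in \<open>simp add: quad_def\<close>)+
  have "quad n D' p r q' t"
    using p(2) nk by (simp add: quad_def D'_def side_update)
  moreover have "snd s' i j = quad_sign (D' i) p r q' t" if "i \<le> n" for i
    using that True p(3) j nbd
    by (cases "i = k") (auto simp: s'_def D'_def mutate_entry quad_sign_def)
  ultimately show ?thesis using p(1) j unfolding D'_def by auto
next
  case False
  then have "quad_sign (D j) a b c d \<noteq> 0"
    using col[rule_format, of j] triangulatedD(5)[OF T, of k j] j(1) k(1) by simp
  then have "D j = {a, b} \<or> D j = {b, c} \<or> D j = {c, d} \<or> D j = {d, a}"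
    using quad_sign_nonzero_iff[OF q] by blast
  moreover have ?thesis if "D j = {a, b} \<or> D j = {b, c}"
    using flip_column_adjacent[OF T k q col j that] unfolding D'_def s'_def .
  moreover have ?thesis if "D j = {c, d} \<or> D j = {d, a}"
    using flip_column_adjacent[OF T k(1) _ quad_rotate[OF q] _ j that] k(2) col quad_sign_rotate
    unfolding D'_def s'_def by (simp add: insert_commute)
  ultimately show ?thesis by blast
qed

text \<open>The two exchange monomials are the products of opposite sides, so the exchange relation
  is the Ptolemy relation solved for the other diagonal.\<close>

lemma mutated_variable:
  assumes T: "triangulated n len D s" and k: "k \<in> {1..n}" "D k = {a, c}" and q: "quad n D a b c d"
    and col: "\<forall>i\<le>n. snd s i k = quad_sign (D i) a b c d"
  shows "fst (mutate n k s) k = len b d"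
proof -
  have sides: "side n D a b" "side n D b c" "side n D c d" "side n D d a"
    and cyc: "cyc a b c" "cyc c d a" and le: "a \<le> n + 2" "c \<le> n + 2"
    using q by (auto simp: quad_def)
  have nat: "nat (x::int) = nat (max 0 x)" for x by simp
  have pos: "nat (snd s i k) = of_bool (D i = {a, b}) + of_bool (D i = {c, d})"
    and neg: "nat (- snd s i k) = of_bool (D i = {b, c}) + of_bool (D i = {d, a})" if "i \<le> n" for i
    using col that quad_sign_parts[OF q, of "D i"] nat[of "snd s i k"] nat[of "- snd s i k"] by auto
  have "(\<Prod>i\<le>n. fst s i ^ nat (snd s i k)) = len a b * len c d"
    using prod_side[OF T sides(1)] prod_side[OF T sides(3)] pos
    by (simp add: power_add prod.distrib)
  moreover have "(\<Prod>i\<le>n. fst s i ^ nat (- snd s i k)) = len b c * len d a"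
    using prod_side[OF T sides(2)] prod_side[OF T sides(4)] neg
    by (simp add: power_add prod.distrib)
  moreover have "fst s k = len a c" using triangulated_len[OF T _ k(2)] k(1) by auto
  moreover have "len a c \<noteq> 0"
    using len_nonzero[of a c] len_nonzero[of c a] len_commute[of a c] le quad_distinct[OF q]
    by (cases "a < c") auto
  ultimately show ?thesis
    using len_ptolemy[OF cyc] by (simp add: mutate_def case_prod_unfold field_simps)
qed

lemma triangulated_mutate:
  assumes T: "triangulated n len D s" and k: "k \<in> {1..n}" "D k = {a, c}" and q: "quad n D a b c d"
    and col: "\<forall>i\<le>n. snd s i k = quad_sign (D i) a b c d"
  shows "triangulated n len (D(k := {b, d})) (mutate n k s)"
proof -
  let ?D = "D(k := {b, d})" and ?s = "mutate n k s"
  have sides: "side n D a b" "side n D b c" "side n D c d" "side n D d a"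
    and cyc: "cyc a b c" "cyc c d a" and le: "b \<le> n + 2" "d \<le> n + 2"
    using q by (auto simp: quad_def)
  have kn: "k \<le> n" using k by simp
  have neq: "D i \<noteq> {b, d}" if "i \<le> n" for i
    using not_side_flip[OF T kn k(2) q] that by (auto simp: side_def)
  have nc: "\<not> crossing x y b d" if i: "i \<le> n" "D i = {x, y}" "i \<noteq> k" for i x y
  proof (rule crossing_flip[OF cyc])
    have "D i \<noteq> D k" using i triangulatedD(2)[OF T] kn by (auto dest: inj_onD)
    then show "{x, y} \<noteq> {a, c}" using i k by simp
  qed (use side_not_crossing[OF T] sides i in blast)+
  have col': "\<exists>x y z t. ?D j = {x, z} \<and> quad n ?D x y z t \<and> (\<forall>i\<le>n. snd ?s i j = quad_sign (?D i) x y z t)"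
    if j: "j \<in> {1..n}" for j
  proof (cases "j = k")
    case False
    then show ?thesis using flip_column[OF T k q col j] by blast
  next
    case True
    \<comment> \<open>The new diagonal has the same four sides, read from \<open>b\<close> on. This
      shift swaps the two pairs of opposite sides and so negates the column, as mutation
      does.\<close>
    have q': "quad n ?D b c d a"
      unfolding quad_def
    proof (intro conjI)
      show "cyc b c d" "cyc d a b" using cyc by (meson cyc_rotate cyc_trans)+
      show "side n ?D b c" "side n ?D c d" "side n ?D d a" "side n ?D a b"
        using sides quad_sides_distinct[OF q] k(2) side_update by metis+
    qed (use q in \<open>auto simp: quad_def\<close>)
    have "snd ?s i k = quad_sign (?D i) b c d a" if "i \<le> n" for i
    proof (cases "i = k")
      case True
      then show ?thesis
        using col[rule_format, OF kn] quad_sign_diagonal[OF q] quad_sign_diagonal[OF q'] k(2)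
        by (simp add: mutate_entry)
    next
      case False
      then show ?thesis
        using col[rule_format, OF that] by (simp add: mutate_entry quad_sign_def disj_commute)
    qed
    with q' show ?thesis using True by auto
  qed
  show ?thesis
    unfolding triangulated_def
  proof (intro conjI allI impI ballI)
    show "?D 0 = {0, n + 2}" using triangulatedD(1)[OF T] k by auto
    show "inj_on ?D {..n}"
      using triangulatedD(2)[OF T] neq by (auto simp: inj_on_def)
    show "\<exists>x y. x < y \<and> y \<le> n + 2 \<and> ?D i = {x, y} \<and> fst ?s i = len x y" if "i \<le> n" for i
    proof (cases "i = k")
      case True
      have "fst ?s k = len b d" by (rule mutated_variable[OF T k q col])
      moreover have "b < d \<or> d < b" using quad_distinct[OF q] by auto
      moreover have "{b, d} = {d, b}" by (rule insert_commute)
      ultimately show ?thesis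
        using True le len_commute[of b d] by (metis fun_upd_same)
    next
      case False
      then show ?thesis using triangulatedD(3)[OF T that] by (simp add: mutate_def case_prod_unfold)
    qed
    show "\<not> crossing x y z t" if "i \<le> n" "j \<le> n" "?D i = {x, y}" "?D j = {z, t}" for i j x y z t
    proof -
      have self: "\<not> crossing x y x y" "\<not> crossing x y y x" for x y by (auto simp: crossing_def cyc_def)
      show ?thesis
      proof (cases "i = k"; cases "j = k")
        assume *: "i = k" "j = k"
        then have "{b, d} = {x, y}" "{b, d} = {z, t}" using that by auto
        then show ?thesis using self by (auto simp: doubleton_eq_iff)
      next
        assume *: "i = k" "j \<noteq> k"
        then have "{b, d} = {x, y}" "D j = {z, t}" using that by auto
        then show ?thesis
          using nc[OF that(2) _ *(2)] crossing_commute doubleton_eq_iff by metis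
      next
        assume *: "i \<noteq> k" "j = k"
        then have "{b, d} = {z, t}" "D i = {x, y}" using that by auto
        then show ?thesis
          using nc[OF that(1) _ *(1)] crossing_commute(2) doubleton_eq_iff by metis
      next
        assume "i \<noteq> k" "j \<noteq> k"
        then show ?thesis using that triangulatedD(4)[OF T] by auto
      qed
    qed
    show "snd ?s i j = - snd ?s j i" if "i \<le> n" "j \<le> n" for i j
      using triangulatedD(5)[OF T, of i j] triangulatedD(5)[OF T, of i k] triangulatedD(5)[OF T, of k j] that kn
      by (simp add: mutate_entry)
  qed (use col' in blast)
qed

end

section \<open>Laurent expansions of the cluster variables\<close>

lemma poly_mapping_sum_monomials:
  "(\<Sum>m\<in>Poly_Mapping.keys P. Poly_Mapping.single m (Poly_Mapping.lookup P m)) = P"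
  by (rule poly_mapping_eqI) (simp add: lookup_sum lookup_single when_def in_keys_iff)

lemma mvar_dvd_iff:
  fixes P :: "('a \<Rightarrow>\<^sub>0 nat) \<Rightarrow>\<^sub>0 'b::comm_ring_1"
  shows "mvar i dvd P \<longleftrightarrow> (\<forall>m\<in>Poly_Mapping.keys P. Poly_Mapping.lookup m i > 0)"
proof
  assume "mvar i dvd P"
  then obtain R where P: "P = mvar i * R" by (elim dvdE)
  have "Poly_Mapping.keys P \<subseteq> {a + b | a b. a \<in> Poly_Mapping.keys (mvar i :: ('a \<Rightarrow>\<^sub>0 nat) \<Rightarrow>\<^sub>0 'b) \<and> b \<in> Poly_Mapping.keys R}"
    unfolding P by (rule keys_mult)
  then show "\<forall>m\<in>Poly_Mapping.keys P. Poly_Mapping.lookup m i > 0"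
    by (fastforce simp: mvar_def lookup_add)
next
  assume *: "\<forall>m\<in>Poly_Mapping.keys P. Poly_Mapping.lookup m i > 0"
  have "P = (\<Sum>m\<in>Poly_Mapping.keys P. Poly_Mapping.single m (Poly_Mapping.lookup P m))"
    by (simp only: poly_mapping_sum_monomials)
  moreover have "mvar i dvd Poly_Mapping.single m (Poly_Mapping.lookup P m)" if "m \<in> Poly_Mapping.keys P" for m
  proof
    have "m = Poly_Mapping.single i 1 + (m - Poly_Mapping.single i 1)"
      using * that by (intro poly_mapping_eqI) (auto simp: lookup_add lookup_minus lookup_single when_def)
    then show "Poly_Mapping.single m (Poly_Mapping.lookup P m) =
        mvar i * Poly_Mapping.single (m - Poly_Mapping.single i 1) (Poly_Mapping.lookup P m)"
      by (simp add: mvar_def mult_single)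
  qed
  ultimately show "mvar i dvd P" by (metis dvd_sum)
qed

lemma prod_mvar:
  "finite S \<Longrightarrow> (\<Prod>i\<in>S. mvar i) = (Poly_Mapping.single (\<Sum>i\<in>S. Poly_Mapping.single i 1) 1
    :: ('a \<Rightarrow>\<^sub>0 nat) \<Rightarrow>\<^sub>0 'b::comm_ring_1)"
  by (induction S rule: finite_induct) (auto simp: mvar_def mult_single)

lemma lookup_sum_single:
  "finite S \<Longrightarrow> Poly_Mapping.lookup (\<Sum>i\<in>S. Poly_Mapping.single i (1::nat)) j = of_bool (j \<in> S)"
  by (induction S rule: finite_induct) (auto simp: lookup_add lookup_single when_def)

text \<open>Multiplication by a monomial translates exponents injectively, so a term of
  \<open>P\<close> free of the variable \<open>i\<close> yields such a term of the product.\<close>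

lemma not_mvar_dvd_mult_prod:
  fixes P :: "('a \<Rightarrow>\<^sub>0 nat) \<Rightarrow>\<^sub>0 'b::comm_ring_1"
  assumes "\<not> mvar i dvd P" "i \<notin> S" "finite S"
  shows "\<not> mvar i dvd P * (\<Prod>j\<in>S. mvar j)"
proof -
  obtain m where m: "m \<in> Poly_Mapping.keys P" "Poly_Mapping.lookup m i = 0"
    using assms(1) by (auto simp: mvar_dvd_iff)
  define e where "e = (\<Sum>j\<in>S. Poly_Mapping.single j (1::nat))"
  have "P * Poly_Mapping.single e 1 =
      (\<Sum>m\<in>Poly_Mapping.keys P. Poly_Mapping.single m (Poly_Mapping.lookup P m)) * Poly_Mapping.single e 1"
    by (simp only: poly_mapping_sum_monomials)
  also have "\<dots> = (\<Sum>m\<in>Poly_Mapping.keys P. Poly_Mapping.single (m + e) (Poly_Mapping.lookup P m))"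
    by (simp add: sum_distrib_right mult_single)
  finally have "Poly_Mapping.lookup (P * Poly_Mapping.single e 1) (m + e) =
      (\<Sum>m'\<in>Poly_Mapping.keys P. if m' = m then Poly_Mapping.lookup P m' else 0)"
    by (simp add: lookup_sum lookup_single when_def)
  then have "m + e \<in> Poly_Mapping.keys (P * Poly_Mapping.single e 1)"
    using m(1) by (simp add: in_keys_iff)
  moreover have "Poly_Mapping.lookup (m + e) i = 0"
    using m assms lookup_sum_single[of S i] by (simp add: lookup_add e_def)
  ultimately show ?thesis
    using assms(3) by (auto simp: mvar_dvd_iff prod_mvar e_def)
qed

section \<open>Closed formula for the lengths, and denominators\<close>

definition xext :: "nat \<Rightarrow> nat \<Rightarrow> ratfun" where
  "xext n i = (if i \<le> n then xvar i else 1)"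

text \<open>Chord lengths are \<open>2 \<times> 2\<close> minors of the vectors \<open>x\<^sub>i (1, \<Sum>\<^sub>m\<^sub><\<^sub>i 1 / (x\<^sub>m x\<^sub>m\<^sub>+\<^sub>1))\<close>, \<open>i \<le> n + 1\<close>, and
  \<open>(0, 1)\<close>.\<close>

definition chord :: "nat \<Rightarrow> nat \<Rightarrow> nat \<Rightarrow> ratfun" where
  "chord n = plucker (\<lambda>i. if i = n + 2 then 0 else xext n i)
     (\<lambda>i. if i = n + 2 then 1 else xext n i * (\<Sum>m<i. 1 / (xext n m * xext n (Suc m))))"

text \<open>The sum of 1 / (x_j x_(j+1)) over j from k to l, multiplied by x_k ... x_(l+1). The
  intersection with \<open>{..n}\<close> drops the factor x_(n+1) = 1, which is no variable.\<close>

definition chord_numerator :: "nat \<Rightarrow> nat \<Rightarrow> nat \<Rightarrow> nat mpoly_int" where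
  "chord_numerator n k l = (\<Sum>j=k..l. \<Prod>i\<in>({k..Suc l} - {j, Suc j}) \<inter> {..n}. mvar i)"

lemma mvar_nonzero: "mvar i \<noteq> (0 :: ('a \<Rightarrow>\<^sub>0 nat) \<Rightarrow>\<^sub>0 'b::comm_ring_1)"
  by (metis lookup_single_eq lookup_zero mvar_def zero_neq_one)

lemma xext_nonzero: "xext n i \<noteq> 0"
  using mvar_nonzero[of i, where ?'b = int] by (simp add: xext_def xvar_def flip: to_fract_def)

lemma chord_commute: "chord n i j = chord n j i"
  unfolding chord_def by (rule plucker_commute)

lemma chord_apex: "j \<le> n + 1 \<Longrightarrow> chord n j (n + 2) = xext n j"
  by (auto simp: chord_def plucker_def)

lemma chord_eq:
  assumes "i < j" "j \<le> n + 1"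
  shows "chord n i j = xext n i * xext n j * (\<Sum>m=i..<j. 1 / (xext n m * xext n (Suc m)))"
proof -
  have "(\<Sum>m<j. 1 / (xext n m * xext n (Suc m))) =
     (\<Sum>m<i. 1 / (xext n m * xext n (Suc m))) + (\<Sum>m=i..<j. 1 / (xext n m * xext n (Suc m)))"
    using assms sum.atLeastLessThan_concat[of 0 i j "\<lambda>m. 1 / (xext n m * xext n (Suc m))"]
    by (simp add: atLeast0LessThan)
  then show ?thesis
    using assms by (simp add: chord_def plucker_def algebra_simps)
qed

lemma chord_Suc:
  assumes "a \<le> n + 1"
  shows "chord n a (Suc a) = 1"
proof (cases "a = n + 1")
  case True
  then show ?thesis using chord_apex[of a n] by (simp add: xext_def)
next
  case False
  then show ?thesis using assms
    xext_nonzero[of n a] xext_nonzero[of n "Suc a"] by (simp add: chord_eq)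
qed

lemma xext_prod:
  "finite S \<Longrightarrow> (\<Prod>i\<in>S. xext n i) = to_fract (\<Prod>i\<in>S \<inter> {..n}. mvar i)"
  by (induction S rule: finite_induct) (auto simp: xext_def xvar_def to_fract_def Int_insert_left One_fract_def)

lemma to_fract_sum': "to_fract (\<Sum>i\<in>S. f i) = (\<Sum>i\<in>S. to_fract (f i))"
  by (induction S rule: infinite_finite_induct) auto

lemma chord_numerator:
  assumes "k \<le> l" "l \<le> n"
  shows "chord n k (Suc l) * to_fract (\<Prod>i\<in>{k+1..l}. mvar i) = to_fract (chord_numerator n k l)"
proof -
  have D: "to_fract (\<Prod>i\<in>{k+1..l}. mvar i) = (\<Prod>i\<in>{k+1..l}. xext n i)"
    using xext_prod[of "{k+1..l}" n] assms by (simp add: Int_absorb2 atLeastAtMost_def Int_assoc)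
  have all: "xext n k * xext n (Suc l) * (\<Prod>i\<in>{k+1..l}. xext n i) = (\<Prod>i\<in>{k..Suc l}. xext n i)"
    using assms by (simp add: prod.atLeast_Suc_atMost mult_ac)
  have "(\<Prod>i\<in>{k..Suc l}. xext n i) * (1 / (xext n j * xext n (Suc j))) =
      (\<Prod>i\<in>{k..Suc l} - {j, Suc j}. xext n i)" if "j \<in> {k..l}" for j
  proof -
    have "(\<Prod>i\<in>{k..Suc l}. xext n i) =
        (\<Prod>i\<in>{k..Suc l} - {j, Suc j}. xext n i) * (\<Prod>i\<in>{j, Suc j}. xext n i)"
      using that by (intro prod.subset_diff) auto
    then show ?thesis using xext_nonzero by simp
  qed
  then have "(\<Prod>i\<in>{k..Suc l}. xext n i) * (\<Sum>j=k..l. 1 / (xext n j * xext n (Suc j))) =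
      (\<Sum>j=k..l. \<Prod>i\<in>{k..Suc l} - {j, Suc j}. xext n i)"
    by (simp add: sum_distrib_left)
  also have "\<dots> = to_fract (chord_numerator n k l)"
    by (simp add: chord_numerator_def to_fract_sum' xext_prod)
  finally show ?thesis
    using assms unfolding D all[symmetric]
    by (simp add: chord_eq atLeastLessThanSuc_atLeastAtMost mult_ac)
qed

text \<open>All coefficients are nonnegative, so no monomial cancels, and some summand is free of
  the variable \<open>i\<close>: the one with \<open>j = i - 1\<close>, or the one with
  \<open>j = k\<close> if \<open>i\<close> is \<open>k\<close> or out of range.\<close>

lemma not_mvar_dvd_chord_numerator:
  assumes "k \<le> l" "l \<le> n"
  shows "\<not> mvar i dvd chord_numerator n k l"
proof -
  define M where "M j = (\<Sum>i\<in>({k..Suc l} - {j, Suc j}) \<inter> {..n}. Poly_Mapping.single i (1::nat))" for j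
  have P: "chord_numerator n k l = (\<Sum>j=k..l. Poly_Mapping.single (M j) 1)"
    by (simp add: chord_numerator_def M_def prod_mvar)
  obtain j where j: "j \<in> {k..l}" "i \<notin> {k..Suc l} - {j, Suc j}"
  proof (cases "i \<in> {k+1..Suc l}")
    case True
    then show ?thesis by (intro that[of "i - 1"]) auto
  next
    case False
    then show ?thesis using assms by (intro that[of k]) auto
  qed
  have "Poly_Mapping.lookup (chord_numerator n k l) (M j) = (\<Sum>j'=k..l. of_bool (M j' = M j))"
    by (simp add: P lookup_sum lookup_single when_def of_bool_def eq_commute[of "M j"])
  also have "\<dots> \<ge> (\<Sum>j'\<in>{j}. of_bool (M j' = M j))"
    using j by (intro sum_mono2) auto
  finally have "M j \<in> Poly_Mapping.keys (chord_numerator n k l)"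
    by (simp add: in_keys_iff)
  moreover have "Poly_Mapping.lookup (M j) i = 0"
    using j lookup_sum_single[of "({k..Suc l} - {j, Suc j}) \<inter> {..n}" i] by (auto simp: M_def)
  ultimately show ?thesis by (auto simp: mvar_dvd_iff)
qed

lemma chord_nonzero:
  assumes "a < b" "b \<le> n + 2"
  shows "chord n a b \<noteq> 0"
proof (cases "b = n + 2")
  case True
  then show ?thesis using assms xext_nonzero by (simp add: chord_apex[of a n, simplified])
next
  case False
  then obtain l where l: "b = Suc l" "a \<le> l" "l \<le> n" using assms by (cases b) auto
  \<comment> \<open>Zero is divisible by every variable, so non-divisibility by a single one
    suffices.\<close>
  then have "chord_numerator n a l \<noteq> 0" using not_mvar_dvd_chord_numerator[of a l n 0] by auto
  then show ?thesis using chord_numerator[OF l(2,3)] l(1) by auto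
qed

lemma polygon_lengths_chord: "polygon_lengths n (chord n)"
proof
  show "chord n a c * chord n b d = chord n a b * chord n c d + chord n b c * chord n d a"
    if "cyc a b c" "cyc c d a" for a b c d
    unfolding chord_def using that by (rule ptolemy)
qed (use chord_commute chord_Suc chord_nonzero in auto)

lemma has_denominator_chord:
  assumes "k \<le> l" "l \<le> n"
  shows "has_denominator n (chord n k (Suc l)) {k+1..l}"
  unfolding has_denominator_def
proof (intro exI conjI ballI)
  have nz: "(\<Prod>i\<in>{k+1..l}. mvar i :: nat mpoly_int) \<noteq> 0"
    by (simp add: mvar_nonzero)
  then have "to_fract (\<Prod>i\<in>{k+1..l}. mvar i :: nat mpoly_int) \<noteq> 0" by simp
  then have "chord n k (Suc l) = to_fract (chord_numerator n k l) / to_fract (\<Prod>i\<in>{k+1..l}. mvar i)"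
    using chord_numerator[OF assms] by (simp add: eq_divide_eq)
  then show "chord n k (Suc l) = Fract (chord_numerator n k l) (\<Prod>i\<in>{k+1..l}. mvar i)"
    by (simp add: to_fract_def)
qed (use not_mvar_dvd_chord_numerator[OF assms] in auto)

text \<open>After cross-multiplication, a variable with index \<open>i\<close> in \<open>D\<close>
  divides \<open>P\<close> times the product over \<open>D'\<close>. As it does not divide
  \<open>P\<close>, it occurs in that product; by symmetry the sets agree.\<close>

lemma has_denominator_unique:
  assumes "has_denominator n x D" "has_denominator n x D'" "D \<subseteq> {1..n}" "D' \<subseteq> {1..n}"
  shows "D = D'"
proof -
  have "D \<subseteq> D'" if hD: "has_denominator n x D" "has_denominator n x D'" "D \<subseteq> {1..n}" "D' \<subseteq> {1..n}" for D D'
  proof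
    fix i assume i: "i \<in> D"
    obtain P where P: "x = Fract P (\<Prod>i\<in>D. mvar i)" "\<forall>i\<in>{1..n}. \<not> mvar i dvd P"
      using hD(1) by (auto simp: has_denominator_def)
    obtain P' where P': "x = Fract P' (\<Prod>i\<in>D'. mvar i)" "\<forall>i\<in>{1..n}. \<not> mvar i dvd P'"
      using hD(2) by (auto simp: has_denominator_def)
    have fin: "finite D" "finite D'" using hD by (auto intro: finite_subset)
    have "(\<Prod>i\<in>D. mvar i :: nat mpoly_int) \<noteq> 0" "(\<Prod>i\<in>D'. mvar i :: nat mpoly_int) \<noteq> 0"
      using fin by (simp_all add: mvar_nonzero)
    then have "P' * (\<Prod>i\<in>D. mvar i) = P * (\<Prod>i\<in>D'. mvar i)"
      using P(1) P'(1) by (simp add: eq_fract)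
    moreover have "mvar i dvd P' * (\<Prod>i\<in>D. mvar i)"
      using i fin by (intro dvd_mult dvd_prodI) auto
    ultimately have "mvar i dvd P * (\<Prod>i\<in>D'. mvar i)" by simp
    then show "i \<in> D'"
      using not_mvar_dvd_mult_prod[of i P D'] P(2) i fin hD(3) by auto
  qed
  from this[of D D'] this[of D' D] show ?thesis using assms by blast
qed

lemma not_has_denominator_xvar:
  assumes "k \<in> {1..n}" "D \<subseteq> {1..n}"
  shows "\<not> has_denominator n (xvar k) D"
proof
  assume "has_denominator n (xvar k) D"
  then obtain P where P: "xvar k = Fract P (\<Prod>i\<in>D. mvar i)" "\<forall>i\<in>{1..n}. \<not> mvar i dvd P"
    by (auto simp: has_denominator_def)
  have "finite D" using assms by (auto intro: finite_subset)
  then have "(\<Prod>i\<in>D. mvar i :: nat mpoly_int) \<noteq> 0" by (simp add: mvar_nonzero)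
  then have "P = mvar k * (\<Prod>i\<in>D. mvar i)"
    using P(1) by (simp add: xvar_def eq_fract)
  then show False using P(2) assms(1) dvd_triv_left by blast
qed

section \<open>Seeds as triangulations\<close>

lemma triangulated_initial: "triangulated n (chord n) (\<lambda>i. {i, n + 2}) (initial_seed n)"
  unfolding triangulated_def
proof (intro conjI allI impI ballI)
  show "inj_on (\<lambda>i. {i, n + 2}) {..n}"
    by (auto simp: inj_on_def doubleton_eq_iff)
  show "\<exists>a c. a < c \<and> c \<le> n + 2 \<and> {i, n + 2} = {a, c} \<and> fst (initial_seed n) i = chord n a c"
    if "i \<le> n" for i
    using that chord_apex[of i n]
    by (intro exI[of _ i] exI[of _ "n + 2"]) (simp add: initial_seed_def xext_def)
  show "\<not> crossing a b c d" if "{i, n + 2} = {a, b}" "{j, n + 2} = {c, d}" for i j a b c d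
    using that by (auto simp: crossing_def cyc_def doubleton_eq_iff)
  show "snd (initial_seed n) i j = - snd (initial_seed n) j i" for i j
    by (simp add: initial_seed_def)
  show "\<exists>a b c d. {k, n + 2} = {a, c} \<and> quad n (\<lambda>i. {i, n + 2}) a b c d \<and>
      (\<forall>i\<le>n. snd (initial_seed n) i k = quad_sign {i, n + 2} a b c d)" if "k \<in> {1..n}" for k
  proof (intro exI conjI allI impI)
    show "{k, n + 2} = {k, n + 2}" ..
    show "quad n (\<lambda>i. {i, n + 2}) k (k + 1) (n + 2) (k - 1)"
      unfolding quad_def
    proof (intro conjI)
      show "side n (\<lambda>i. {i, n + 2}) (n + 2) (k - 1)"
        unfolding side_def using that by (intro disjI1 exI[of _ "k - 1"]) auto
    qed (use that in \<open>auto simp: cyc_def side_def doubleton_eq_iff\<close>)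
    show "snd (initial_seed n) i k = quad_sign {i, n + 2} k (k + 1) (n + 2) (k - 1)" if "i \<le> n" for i
      using that \<open>k \<in> {1..n}\<close>
      by (auto simp: initial_seed_def num_arrows_def quad_sign_def doubleton_eq_iff)
  qed
qed auto

lemma seeds_triangulated:
  assumes "s \<in> seeds n"
  shows "\<exists>D. triangulated n (chord n) D s"
  using assms
proof induction
  case initial
  show ?case using triangulated_initial by blast
next
  case (mutation s k)
  then obtain D where D: "triangulated n (chord n) D s" by blast
  interpret polygon_lengths n "chord n" by (rule polygon_lengths_chord)
  show ?case using triangulatedD(6)[OF D mutation.hyps(2)] triangulated_mutate[OF D mutation.hyps(2)] by blast
qed

text \<open>A mutable label carries a genuine diagonal, since its quadrilateral has a vertex
  strictly on either side of it. Diagonals at \<open>n + 2\<close> are the initial variables, all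
  others belong to roots.\<close>

lemma triangulated_variable:
  assumes T: "triangulated n (chord n) D s" and i: "i \<in> {1..n}"
  shows "(\<exists>k\<in>{1..n}. fst s i = xvar k) \<or> (\<exists>k l. k < l \<and> l \<le> n \<and> fst s i = chord n k (Suc l))"
proof -
  interpret polygon_lengths n "chord n" by (rule polygon_lengths_chord)
  obtain a c where ac: "a < c" "c \<le> n + 2" "D i = {a, c}" "fst s i = chord n a c"
    using triangulatedD(3)[OF T, of i] i by auto
  obtain a' b c' d where q: "D i = {a', c'}" "cyc a' b c'" "cyc c' d a'" "b \<le> n + 2" "d \<le> n + 2"
    using triangulatedD(6)[OF T i] unfolding quad_def by blast
  have "a' = a \<and> c' = c \<or> a' = c \<and> c' = a"
    using q(1) ac(3) by (simp add: doubleton_eq_iff) blast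
  then have ends: "Suc a < c" "\<not> (a = 0 \<and> c = n + 2)"
    using q(2-) ac(1) by (auto simp: cyc_def)
  show ?thesis
  proof (cases "c = n + 2")
    case True
    then have "a \<in> {1..n}" using ends by auto
    moreover from this have "fst s i = xvar a" using chord_apex[of a n] ac True by (simp add: xext_def)
    ultimately show ?thesis by blast
  next
    case False
    then have "a < c - 1" "c - 1 \<le> n" "Suc (c - 1) = c" using ends ac by auto
    then show ?thesis using ac(4) by metis
  qed
qed

text \<open>Flipping \<open>k + 1\<close>, ..., \<open>m\<close> in this order moves ends from
  \<open>n + 2\<close> to \<open>k\<close>; the flip of \<open>{i, n + 2}\<close> produces
  \<open>{i + 1, k}\<close>, whence the shift of labels. The last flipped diagonal shows that every
  root occurs as a cluster variable.\<close>

lemma fan_seed: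
  assumes "k \<le> m" "m \<le> n"
  shows "\<exists>s\<in>seeds n. triangulated n (chord n) (\<lambda>i. if k < i \<and> i \<le> m then {Suc i, k} else {i, n + 2}) s"
  using assms
proof (induction m rule: dec_induct)
  case base
  have "(\<lambda>i. if k < i \<and> i \<le> k then {Suc i, k} else {i, n + 2}) = (\<lambda>i. {i, n + 2})"
    by (rule ext) auto
  then show ?case using triangulated_initial[of n] seeds.initial by auto
next
  case (step m)
  interpret polygon_lengths n "chord n" by (rule polygon_lengths_chord)
  define D where "D = (\<lambda>i. if k < i \<and> i \<le> m then {Suc i, k} else {i, n + 2})"
  obtain s where s: "s \<in> seeds n" "triangulated n (chord n) D s" using step.IH step.prems unfolding D_def by auto
  have m: "Suc m \<in> {1..n}" using step by auto
  obtain a b c d where q0: "{Suc m, n + 2} = {a, c}" "quad n D a b c d"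
      "\<forall>i\<le>n. snd s i (Suc m) = quad_sign (D i) a b c d"
    using triangulatedD(6)[OF s(2) m] by (auto simp: D_def)
  have "a = Suc m \<and> c = n + 2 \<or> c = Suc m \<and> a = n + 2" using q0(1) by (auto simp: doubleton_eq_iff)
  then have "\<exists>b d. quad n D (Suc m) b (n + 2) d \<and>
      (\<forall>i\<le>n. snd s i (Suc m) = quad_sign (D i) (Suc m) b (n + 2) d)"
  proof
    assume "a = Suc m \<and> c = n + 2"
    with q0(2,3) show ?thesis by blast
  next
    assume "c = Suc m \<and> a = n + 2"
    with q0(3) quad_rotate[OF q0(2)] quad_sign_rotate[of _ a b c d] show ?thesis by metis
  qed
  then obtain b d where q: "quad n D (Suc m) b (n + 2) d"
      "\<forall>i\<le>n. snd s i (Suc m) = quad_sign (D i) (Suc m) b (n + 2) d"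
    by blast
  have cyc: "cyc (Suc m) b (n + 2)" "cyc (n + 2) d (Suc m)"
    and sides: "side n D (Suc m) b" "side n D (n + 2) d" "side n D d (Suc m)"
    using q(1) by (simp_all add: quad_def)
  have b: "Suc m < b" "b < n + 2" and d: "d \<le> m"
    using cyc m q(1) by (auto simp: cyc_def quad_def)
  \<comment> \<open>The next flip is at \<open>{m + 1, n + 2}\<close>, and the arcs present leave no
    choice: \<open>b\<close> must be the next vertex, and \<open>d\<close> must be joined to both
    \<open>n + 2\<close> and \<open>m + 1\<close>, which singles out \<open>k\<close>.\<close>
  have "b = Suc (Suc m)"
    using sides(1) b m step.hyps by (auto simp: side_def D_def doubleton_eq_iff split: if_splits)
  moreover have "d \<le> k"
    using sides(2) d m step.hyps by (auto simp: side_def D_def doubleton_eq_iff split: if_splits)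
  then have "d = k"
    using sides(3) d m step.hyps by (auto simp: side_def D_def doubleton_eq_iff split: if_splits)
  moreover have "triangulated n (chord n) (D(Suc m := {b, d})) (mutate n (Suc m) s)"
    using triangulated_mutate[OF s(2) m _ q] by (simp add: D_def)
  moreover have "D(Suc m := {Suc (Suc m), k}) =
      (\<lambda>i. if k < i \<and> i \<le> Suc m then {Suc i, k} else {i, n + 2})"
    using step.hyps by (auto simp: fun_eq_iff D_def)
  ultimately show ?case using seeds.mutation[OF s(1) m] by metis
qed

lemma cluster_variables_eq:
  "cluster_variables n = xvar ` {1..n} \<union> {chord n k (Suc l) | k l. k < l \<and> l \<le> n}"
proof (intro equalityI subsetI)
  fix x assume "x \<in> cluster_variables n"
  then obtain s i where "s \<in> seeds n" "i \<in> {1..n}" "x = fst s i"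
    by (auto simp: cluster_variables_def)
  then show "x \<in> xvar ` {1..n} \<union> {chord n k (Suc l) | k l. k < l \<and> l \<le> n}"
    using seeds_triangulated triangulated_variable by blast
next
  fix x assume "x \<in> xvar ` {1..n} \<union> {chord n k (Suc l) | k l. k < l \<and> l \<le> n}"
  then consider k where "k \<in> {1..n}" "x = xvar k" | k l where "k < l" "l \<le> n" "x = chord n k (Suc l)"
    by blast
  then show "x \<in> cluster_variables n"
  proof cases
    case 1
    then have "x = fst (initial_seed n) k" by (simp add: initial_seed_def)
    with 1 seeds.initial show ?thesis unfolding cluster_variables_def by blast
  next
    case 2
    interpret polygon_lengths n "chord n" by (rule polygon_lengths_chord)
    obtain s where s: "s \<in> seeds n"
        "triangulated n (chord n) (\<lambda>i. if k < i \<and> i \<le> l then {Suc i, k} else {i, n + 2}) s"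
      using fan_seed[of k l n] 2 by auto
    have "fst s l = chord n (Suc l) k"
      by (rule triangulated_len[OF s(2)]) (use 2 in auto)
    then have "x = fst s l" using 2 chord_commute by simp
    moreover have "l \<in> {1..n}" using 2 by auto
    ultimately show ?thesis using s(1) unfolding cluster_variables_def by blast
  qed
qed

text \<open>Among chords the denominator determines \<open>k\<close> and \<open>l\<close>, and no
  initial variable has a denominator of this form, so the definite description picks out one chord.
  For \<open>k = l\<close> the chord is a side of length \<open>1\<close>.\<close>

lemma x_root_eq:
  assumes "k \<le> l" "l \<le> n"
  shows "x_root n k l = chord n k (Suc l)"
proof (cases "k = l")
  case True
  then show ?thesis using assms chord_Suc by (simp add: x_root_def)
next
  case False
  then have kl: "k < l" using assms by simp
  have "(THE x. x \<in> cluster_variables n \<and> has_denominator n x {k + 1..l}) = chord n k (Suc l)"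
  proof (rule the_equality)
    show "chord n k (Suc l) \<in> cluster_variables n \<and> has_denominator n (chord n k (Suc l)) {k + 1..l}"
      using kl assms has_denominator_chord[of k l n] by (auto simp: cluster_variables_eq)
  next
    fix x assume x: "x \<in> cluster_variables n \<and> has_denominator n x {k + 1..l}"
    have sub: "{k + 1..l} \<subseteq> {1..n}" using assms by auto
    then obtain k' l' where kl': "k' < l'" "l' \<le> n" "x = chord n k' (Suc l')"
      using x not_has_denominator_xvar[OF _ sub] by (auto simp: cluster_variables_eq)
    have "{k + 1..l} = {k' + 1..l'}"
      using x kl' sub has_denominator_chord[of k' l' n] by (intro has_denominator_unique[of n x]) auto
    then show "x = chord n k (Suc l)"
      using kl kl' by (simp add: Icc_eq_Icc)
  qed
  then show ?thesis using False by (simp add: x_root_def)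
qed

lemma chord_exchange:
  assumes "k < l" "l \<le> n"
  shows "xext n l * chord n k (Suc l) = xext n (Suc l) * chord n k l + xext n k"
proof -
  interpret polygon_lengths n "chord n" by (rule polygon_lengths_chord)
  have "chord n k (Suc l) * chord n l (n + 2) =
      chord n k l * chord n (Suc l) (n + 2) + chord n l (Suc l) * chord n (n + 2) k"
    using assms by (intro len_ptolemy) (auto simp: cyc_def)
  then show ?thesis
    using assms chord_apex[of l n] chord_apex[of "Suc l" n] chord_apex[of k n] chord_Suc[of l n]
      chord_commute[of n "n + 2" k]
    by (simp add: mult_ac)
qed

section \<open>Division by monic polynomials in a tensor product\<close>

lemma single_mult_eq_frag_cmul: "Poly_Mapping.single x (a * b) = frag_cmul (a * b) (frag_of x)"
  by (rule poly_mapping_eqI) (simp add: lookup_single when_def)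

text \<open>Written by \<open>frag_extend\<close> in each argument, the product is visibly
  biadditive and determined by its values on basis elements.\<close>

lemma pair_ring_mult:
  "c \<otimes>\<^bsub>pair_ring A B\<^esub> d =
     frag_extend (\<lambda>p. frag_extend (\<lambda>q. frag_of (fst p \<otimes>\<^bsub>A\<^esub> fst q, snd p \<otimes>\<^bsub>B\<^esub> snd q)) d) c"
  by (simp add: pair_ring_def frag_extend_def frag_cmul_sum single_mult_eq_frag_cmul)

lemma pair_ring_simps:
  "carrier (pair_ring A B) = {c. Poly_Mapping.keys c \<subseteq> carrier A \<times> carrier B}"
  "\<one>\<^bsub>pair_ring A B\<^esub> = frag_of (\<one>\<^bsub>A\<^esub>, \<one>\<^bsub>B\<^esub>)" "\<zero>\<^bsub>pair_ring A B\<^esub> = 0"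
  "c \<oplus>\<^bsub>pair_ring A B\<^esub> d = c + d"
  by (simp_all add: pair_ring_def)

lemma pair_ring_mult_of:
  "frag_of (a, b) \<otimes>\<^bsub>pair_ring A B\<^esub> frag_of (a', b') = frag_of (a \<otimes>\<^bsub>A\<^esub> a', b \<otimes>\<^bsub>B\<^esub> b')"
  by (simp add: pair_ring_mult)

lemma pair_ring_mult_diff_left:
  "(c - c') \<otimes>\<^bsub>pair_ring A B\<^esub> d = c \<otimes>\<^bsub>pair_ring A B\<^esub> d - c' \<otimes>\<^bsub>pair_ring A B\<^esub> d"
  by (simp add: pair_ring_mult frag_extend_diff)

lemma frag_cmul_diff: "frag_cmul k (a - b) = frag_cmul k a - frag_cmul k b"
  by (rule poly_mapping_eqI) (simp add: lookup_minus right_diff_distrib)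

lemma frag_extend_fun_diff: "frag_extend (\<lambda>x. f x - g x) c = frag_extend f c - frag_extend g c"
  by (simp add: frag_extend_def sum_subtractf frag_cmul_diff)

lemma pair_ring_mult_diff_right:
  "c \<otimes>\<^bsub>pair_ring A B\<^esub> (d - d') = c \<otimes>\<^bsub>pair_ring A B\<^esub> d - c \<otimes>\<^bsub>pair_ring A B\<^esub> d'"
  by (simp add: pair_ring_mult frag_extend_diff frag_extend_fun_diff)

lemma pair_ring_mult_zero:
  "0 \<otimes>\<^bsub>pair_ring A B\<^esub> d = 0" "c \<otimes>\<^bsub>pair_ring A B\<^esub> 0 = 0"
  using pair_ring_mult_diff_left[of A B 0 0 d] pair_ring_mult_diff_right[of A B c 0 0] by simp_all

lemma frag_of_in_pair_ring: "frag_of (a, b) \<in> carrier (pair_ring A B) \<longleftrightarrow> a \<in> carrier A \<and> b \<in> carrier B"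
  by (simp add: pair_ring_simps)

lemma pair_ring_zero_closed: "0 \<in> carrier (pair_ring A B)"
  by (simp add: pair_ring_simps)

lemma pair_ring_diff_closed:
  "c \<in> carrier (pair_ring A B) \<Longrightarrow> d \<in> carrier (pair_ring A B) \<Longrightarrow> c - d \<in> carrier (pair_ring A B)"
  using keys_diff[of c d] by (auto simp: pair_ring_simps)

lemma pair_ring_add_closed:
  "c \<in> carrier (pair_ring A B) \<Longrightarrow> d \<in> carrier (pair_ring A B) \<Longrightarrow> c + d \<in> carrier (pair_ring A B)"
  using keys_add[of c d] by (auto simp: pair_ring_simps)

lemma pair_ring_induct [consumes 1, case_names zero of diff]:
  assumes "c \<in> carrier (pair_ring A B)" "Q 0"
    and "\<And>a b. a \<in> carrier A \<Longrightarrow> b \<in> carrier B \<Longrightarrow> Q (frag_of (a, b))"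
    and "\<And>x y. Q x \<Longrightarrow> Q y \<Longrightarrow> Q (x - y)"
  shows "Q c"
proof -
  have "Poly_Mapping.keys c \<subseteq> carrier A \<times> carrier B"
    using assms(1) by (simp add: pair_ring_simps)
  then show ?thesis
  proof (induction c rule: frag_induction)
    case (one x)
    then have "Q (frag_of (fst x, snd x))" by (intro assms(3)) (simp_all add: mem_Times_iff)
    then show ?case by simp
  next
    case zero
    show ?case by (rule assms(2))
  next
    case (diff a b)
    then show ?case by (rule assms(4))
  qed
qed

text \<open>The multiplicative axioms are additive in each argument, so nested inductions reduce
  them to basis pairs, where they hold in \<open>A\<close> and \<open>B\<close>.\<close>

lemma cring_pair_ring:
  assumes "cring A" "cring B"
  shows "cring (pair_ring A B)"
proof -
  interpret A: cring A by fact
  interpret B: cring B by fact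
  let ?P = "pair_ring A B"
  have closed: "x \<otimes>\<^bsub>?P\<^esub> y \<in> carrier ?P" if "x \<in> carrier ?P" "y \<in> carrier ?P" for x y
    using that(1)
  proof (induction x rule: pair_ring_induct)
    case (of a b)
    show ?case using that(2)
      by (induction y rule: pair_ring_induct)
        (use of in \<open>simp_all add: pair_ring_mult_of frag_of_in_pair_ring pair_ring_mult_diff_right
          pair_ring_mult_zero pair_ring_zero_closed pair_ring_diff_closed\<close>)
  qed (simp_all add: pair_ring_mult_diff_left pair_ring_mult_zero pair_ring_zero_closed pair_ring_diff_closed)
  have assoc: "x \<otimes>\<^bsub>?P\<^esub> y \<otimes>\<^bsub>?P\<^esub> z = x \<otimes>\<^bsub>?P\<^esub> (y \<otimes>\<^bsub>?P\<^esub> z)"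
    if "x \<in> carrier ?P" "y \<in> carrier ?P" "z \<in> carrier ?P" for x y z
    using that(1)
  proof (induction x rule: pair_ring_induct)
    case (of a b)
    show ?case using that(2)
    proof (induction y rule: pair_ring_induct)
      case (of a' b')
      show ?case using that(3)
        by (induction z rule: pair_ring_induct)
          (use of \<open>a \<in> carrier A\<close> \<open>b \<in> carrier B\<close> in \<open>simp_all add: pair_ring_mult_of
             pair_ring_mult_diff_right pair_ring_mult_zero A.m_assoc B.m_assoc\<close>)
    qed (simp_all add: pair_ring_mult_diff_left pair_ring_mult_diff_right pair_ring_mult_zero)
  qed (simp_all add: pair_ring_mult_diff_left pair_ring_mult_zero)
  have comm: "x \<otimes>\<^bsub>?P\<^esub> y = y \<otimes>\<^bsub>?P\<^esub> x" if "x \<in> carrier ?P" "y \<in> carrier ?P" for x y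
    using that(1)
  proof (induction x rule: pair_ring_induct)
    case (of a b)
    show ?case using that(2)
      by (induction y rule: pair_ring_induct)
        (use of in \<open>simp_all add: pair_ring_mult_of pair_ring_mult_diff_left
           pair_ring_mult_diff_right pair_ring_mult_zero A.m_comm B.m_comm\<close>)
  qed (simp_all add: pair_ring_mult_diff_left pair_ring_mult_diff_right pair_ring_mult_zero)
  have one: "\<one>\<^bsub>?P\<^esub> \<otimes>\<^bsub>?P\<^esub> x = x" if "x \<in> carrier ?P" for x
    using that
    by (induction x rule: pair_ring_induct)
      (simp_all add: pair_ring_mult_of pair_ring_mult_diff_right pair_ring_mult_zero pair_ring_simps)
  have distr: "(x + y) \<otimes>\<^bsub>?P\<^esub> z = x \<otimes>\<^bsub>?P\<^esub> z + y \<otimes>\<^bsub>?P\<^esub> z" for x y z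
    by (simp add: pair_ring_mult frag_extend_add)
  show ?thesis
  proof (rule cringI)
    show "abelian_group ?P"
    proof (rule abelian_groupI)
      show "\<exists>y\<in>carrier ?P. y \<oplus>\<^bsub>?P\<^esub> x = \<zero>\<^bsub>?P\<^esub>" if "x \<in> carrier ?P" for x
        using that by (intro bexI[of _ "- x"]) (auto simp: pair_ring_simps)
    qed (simp_all add: pair_ring_simps(3,4) pair_ring_zero_closed pair_ring_add_closed add_ac)
    show "comm_monoid ?P"
      by (rule comm_monoidI) (use closed assoc comm one in \<open>auto simp: pair_ring_simps\<close>)
  qed (simp add: pair_ring_simps distr)
qed

section \<open>Coefficients in t modulo the tensor relations\<close>

locale polynomial_tensor = UP_cring R P + B: cring B for R (structure) and P (structure) and B (structure) +
  fixes C :: "('r, 's) ring_scheme" and f :: "'r \<Rightarrow> nat \<Rightarrow> 'a" and g :: "'r \<Rightarrow> 'c"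
  assumes f_const: "r \<in> carrier C \<Longrightarrow> \<exists>c\<in>carrier R. f r = up_ring.monom P c 0"
    and g_closed: "r \<in> carrier C \<Longrightarrow> g r \<in> carrier B"
begin

abbreviation (input) "F \<equiv> pair_ring P B"
abbreviation (input) "I \<equiv> tensor_ideal C P B f g"

sublocale F: cring F
  by (rule cring_pair_ring) (rule UP_cring B.cring_axioms)+

lemma tensor_relations_subset: "tensor_relations C P B f g \<subseteq> carrier F"
proof
  fix x assume x: "x \<in> tensor_relations C P B f g"
  have f: "f r \<in> carrier P" if "r \<in> carrier C" for r using f_const[OF that] by auto
  show "x \<in> carrier F"
    using x g_closed f unfolding tensor_relations_def by (auto intro!: pair_ring_diff_closed simp: frag_of_in_pair_ring)
qed

sublocale I: ideal I F
  unfolding tensor_ideal_def by (rule F.genideal_ideal[OF tensor_relations_subset])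

lemma relation_in_I: "x \<in> tensor_relations C P B f g \<Longrightarrow> x \<in> I"
  unfolding tensor_ideal_def using F.genideal_self[OF tensor_relations_subset] by blast

lemma zero_in_I: "0 \<in> I"
  using I.zero_closed by (simp add: pair_ring_simps)

lemmas minus_in_F = pair_ring_diff_closed[of _ P B]

lemmas add_in_F = pair_ring_add_closed[of _ P B]

lemma a_inv_F: "x \<in> carrier F \<Longrightarrow> \<ominus>\<^bsub>F\<^esub> x = - x"
  by (rule F.minus_equality) (auto simp: pair_ring_simps)

lemma minus_F: "x \<in> carrier F \<Longrightarrow> y \<in> carrier F \<Longrightarrow> x \<ominus>\<^bsub>F\<^esub> y = x - y"
  by (simp add: a_minus_def a_inv_F pair_ring_simps)

lemma add_in_I: "x \<in> I \<Longrightarrow> y \<in> I \<Longrightarrow> x + y \<in> I"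
  using I.a_closed by (simp add: pair_ring_simps)

lemma uminus_in_I: "x \<in> I \<Longrightarrow> - x \<in> I"
  using I.a_inv_closed a_inv_F I.Icarr by metis

lemma diff_in_I: "x \<in> I \<Longrightarrow> y \<in> I \<Longrightarrow> x - y \<in> I"
  using add_in_I[OF _ uminus_in_I] by fastforce

lemma sum_in_I: "(\<And>i. i \<in> S \<Longrightarrow> h i \<in> I) \<Longrightarrow> (\<Sum>i\<in>S. h i) \<in> I"
  by (induction S rule: infinite_finite_induct) (auto intro: add_in_I zero_in_I)

lemma of_add_in_I:
  assumes "a \<in> carrier P" "a' \<in> carrier P" "b \<in> carrier B"
  shows "frag_of (a \<oplus>\<^bsub>P\<^esub> a', b) - frag_of (a, b) - frag_of (a', b) \<in> I"
  using assms by (intro relation_in_I) (auto simp: tensor_relations_def)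

lemma of_zero_in_I:
  assumes "b \<in> carrier B"
  shows "frag_of (\<zero>\<^bsub>P\<^esub>, b) \<in> I"
proof -
  have "- (frag_of (\<zero>\<^bsub>P\<^esub> \<oplus>\<^bsub>P\<^esub> \<zero>\<^bsub>P\<^esub>, b) - frag_of (\<zero>\<^bsub>P\<^esub>, b) - frag_of (\<zero>\<^bsub>P\<^esub>, b)) \<in> I"
    using assms by (intro uminus_in_I of_add_in_I) auto
  then show ?thesis by simp
qed

lemma of_finsum_in_I:
  assumes "finite S" "\<And>i. i \<in> S \<Longrightarrow> a i \<in> carrier P" "b \<in> carrier B"
  shows "frag_of (finsum P a S, b) - (\<Sum>i\<in>S. frag_of (a i, b)) \<in> I"
  using assms(1,2)
proof (induction S rule: finite_induct)
  case empty
  then show ?case using of_zero_in_I[OF assms(3)] by simp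
next
  case (insert j S)
  have *: "a \<in> S \<rightarrow> carrier P" "a j \<in> carrier P" using insert by auto
  have "(frag_of (a j \<oplus>\<^bsub>P\<^esub> finsum P a S, b) - frag_of (a j, b) - frag_of (finsum P a S, b)) +
      (frag_of (finsum P a S, b) - (\<Sum>i\<in>S. frag_of (a i, b))) \<in> I"
    using insert * assms(3) by (intro add_in_I of_add_in_I) auto
  moreover have "finsum P a (insert j S) = a j \<oplus>\<^bsub>P\<^esub> finsum P a S"
    using insert * by (intro P.finsum_insert) auto
  ultimately show ?case using insert(1,2) by (simp add: algebra_simps)
qed

text \<open>Extracting the coefficient of \<open>t\<^sup>i\<close> preserves the tensor relations because the base acts on
  polynomials through constants.\<close>

definition coeff_at :: "nat \<Rightarrow> ((nat \<Rightarrow> 'a) \<times> 'c \<Rightarrow>\<^sub>0 int) \<Rightarrow> ((nat \<Rightarrow> 'a) \<times> 'c \<Rightarrow>\<^sub>0 int)" where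
  "coeff_at i = frag_extend (\<lambda>(p, z). frag_of (up_ring.monom P (up_ring.coeff P p i) 0, z))"

lemma coeff_at_of: "coeff_at i (frag_of (p, z)) = frag_of (up_ring.monom P (up_ring.coeff P p i) 0, z)"
  by (simp add: coeff_at_def)

lemma coeff_at_diff: "coeff_at i (x - y) = coeff_at i x - coeff_at i y"
  by (simp add: coeff_at_def frag_extend_diff)

lemma coeff_at_add: "coeff_at i (x + y) = coeff_at i x + coeff_at i y"
  by (simp add: coeff_at_def frag_extend_add)

lemma coeff_at_zero: "coeff_at i 0 = 0"
  by (simp add: coeff_at_def)

lemma coeff_at_closed: "x \<in> carrier F \<Longrightarrow> coeff_at i x \<in> carrier F"
  by (induction x rule: pair_ring_induct)
    (auto simp: coeff_at_of coeff_at_diff coeff_at_zero frag_of_in_pair_ring intro: pair_ring_diff_closed pair_ring_zero_closed)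

text \<open>The Cauchy product formula holds only modulo \<open>I\<close>: the coefficient of a
  product is a sum in \<open>P\<close>, and splitting a sum in the first slot uses the bilinearity
  relations.\<close>

lemma coeff_at_mult:
  assumes "x \<in> carrier F" "y \<in> carrier F"
  shows "coeff_at i (x \<otimes>\<^bsub>F\<^esub> y) - (\<Sum>j\<le>i. coeff_at j x \<otimes>\<^bsub>F\<^esub> coeff_at (i - j) y) \<in> I"
  using assms(1)
proof (induction x rule: pair_ring_induct)
  case zero
  then show ?case by (simp add: coeff_at_zero pair_ring_mult_zero zero_in_I)
next
  case (of p z)
  show ?case using assms(2)
  proof (induction y rule: pair_ring_induct)
    case zero
    then show ?case by (simp add: coeff_at_zero pair_ring_mult_zero zero_in_I)
  next
    case (of q w)
    let ?h = "\<lambda>j. up_ring.coeff P p j \<otimes> up_ring.coeff P q (i - j)"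
    have "up_ring.monom P (\<Oplus>j\<in>{..i}. ?h j) 0 = (\<Oplus>\<^bsub>P\<^esub>j\<in>{..i}. up_ring.monom P (?h j) 0)"
      using of \<open>p \<in> carrier P\<close>
      by (intro up_eqI) (auto simp: coeff_finsum Pi_def R.finsum_zero' intro!: R.finsum_cong')
    moreover have "frag_of (\<Oplus>\<^bsub>P\<^esub>j\<in>{..i}. up_ring.monom P (?h j) 0, z \<otimes>\<^bsub>B\<^esub> w) -
        (\<Sum>j\<le>i. frag_of (up_ring.monom P (?h j) 0, z \<otimes>\<^bsub>B\<^esub> w)) \<in> I"
      using of \<open>p \<in> carrier P\<close> \<open>z \<in> carrier B\<close> by (intro of_finsum_in_I) auto
    moreover have "up_ring.monom P (?h j) 0 = up_ring.monom P (up_ring.coeff P p j) 0 \<otimes>\<^bsub>P\<^esub> up_ring.monom P (up_ring.coeff P q (i - j)) 0" for j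
      using of \<open>p \<in> carrier P\<close> monom_mult[of "up_ring.coeff P p j" "up_ring.coeff P q (i - j)" 0 0] by simp
    ultimately show ?case
      using of \<open>p \<in> carrier P\<close> by (simp add: coeff_at_of pair_ring_mult_of)
  next
    case (diff y y')
    from diff_in_I[OF this] show ?case
      by (simp add: pair_ring_mult_diff_right coeff_at_diff sum_subtractf algebra_simps)
  qed
next
  case (diff x x')
  from diff_in_I[OF this] show ?case
    by (simp add: pair_ring_mult_diff_left coeff_at_diff sum_subtractf algebra_simps)
qed

lemma coeff_at_relation:
  assumes "x \<in> tensor_relations C P B f g"
  shows "coeff_at i x \<in> I"
proof -
  consider (left) a a' b where "a \<in> carrier P" "a' \<in> carrier P" "b \<in> carrier B"
      "x = frag_of (a \<oplus>\<^bsub>P\<^esub> a', b) - frag_of (a, b) - frag_of (a', b)"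
    | (right) a b b' where "a \<in> carrier P" "b \<in> carrier B" "b' \<in> carrier B"
      "x = frag_of (a, b \<oplus>\<^bsub>B\<^esub> b') - frag_of (a, b) - frag_of (a, b')"
    | (scalar) r a b where "r \<in> carrier C" "a \<in> carrier P" "b \<in> carrier B"
      "x = frag_of (f r \<otimes>\<^bsub>P\<^esub> a, b) - frag_of (a, g r \<otimes>\<^bsub>B\<^esub> b)"
    using assms unfolding tensor_relations_def by (elim UnE CollectE exE conjE) metis+
  then have "coeff_at i x \<in> tensor_relations C P B f g"
  proof cases
    case left
    then have "coeff_at i x = frag_of (up_ring.monom P (up_ring.coeff P a i) 0 \<oplus>\<^bsub>P\<^esub> up_ring.monom P (up_ring.coeff P a' i) 0, b)
        - frag_of (up_ring.monom P (up_ring.coeff P a i) 0, b) - frag_of (up_ring.monom P (up_ring.coeff P a' i) 0, b)"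
      by (simp add: coeff_at_diff coeff_at_of)
    moreover have "up_ring.monom P (up_ring.coeff P a i) 0 \<in> carrier P" "up_ring.monom P (up_ring.coeff P a' i) 0 \<in> carrier P"
      using left by auto
    ultimately show ?thesis unfolding tensor_relations_def using left(3) by blast
  next
    case right
    then have "coeff_at i x = frag_of (up_ring.monom P (up_ring.coeff P a i) 0, b \<oplus>\<^bsub>B\<^esub> b')
        - frag_of (up_ring.monom P (up_ring.coeff P a i) 0, b) - frag_of (up_ring.monom P (up_ring.coeff P a i) 0, b')"
      by (simp add: coeff_at_diff coeff_at_of)
    moreover have "up_ring.monom P (up_ring.coeff P a i) 0 \<in> carrier P" using right by auto
    ultimately show ?thesis unfolding tensor_relations_def using right(2,3) by blast
  next
    case scalar
    obtain c where c: "c \<in> carrier R" "f r = up_ring.monom P c 0" using f_const scalar(1) by blast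
    have "up_ring.coeff P (f r \<otimes>\<^bsub>P\<^esub> a) i = c \<otimes> up_ring.coeff P a i"
      using c scalar by (simp add: monom_mult_is_smult del: coeff_mult)
    moreover have "up_ring.monom P (c \<otimes> up_ring.coeff P a i) 0 = f r \<otimes>\<^bsub>P\<^esub> up_ring.monom P (up_ring.coeff P a i) 0"
      using monom_mult[of c "up_ring.coeff P a i" 0 0] c scalar by simp
    ultimately have "coeff_at i x = frag_of (f r \<otimes>\<^bsub>P\<^esub> up_ring.monom P (up_ring.coeff P a i) 0, b)
        - frag_of (up_ring.monom P (up_ring.coeff P a i) 0, g r \<otimes>\<^bsub>B\<^esub> b)"
      using scalar by (simp add: coeff_at_diff coeff_at_of)
    moreover have "up_ring.monom P (up_ring.coeff P a i) 0 \<in> carrier P" using scalar by auto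
    ultimately show ?thesis unfolding tensor_relations_def using scalar(1,3) by blast
  qed
  then show ?thesis by (rule relation_in_I)
qed

text \<open>By the Cauchy formula, the elements all of whose coefficients lie in \<open>I\<close>
  form an ideal. It contains the defining relations, hence all of \<open>I\<close>.\<close>

lemma coeff_at_in_I:
  assumes "x \<in> I"
  shows "coeff_at i x \<in> I"
proof -
  define K where "K = {x \<in> carrier F. \<forall>i. coeff_at i x \<in> I}"
  have mult: "y \<otimes>\<^bsub>F\<^esub> x \<in> K" if "x \<in> K" "y \<in> carrier F" for x y
  proof -
    have "coeff_at i (y \<otimes>\<^bsub>F\<^esub> x) \<in> I" for i
    proof -
      have "(\<Sum>j\<le>i. coeff_at j y \<otimes>\<^bsub>F\<^esub> coeff_at (i - j) x) \<in> I"
        using that by (intro sum_in_I I.I_l_closed) (auto simp: K_def coeff_at_closed)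
      moreover have "coeff_at i (y \<otimes>\<^bsub>F\<^esub> x) - (\<Sum>j\<le>i. coeff_at j y \<otimes>\<^bsub>F\<^esub> coeff_at (i - j) x) \<in> I"
        using that by (intro coeff_at_mult) (auto simp: K_def)
      ultimately show ?thesis using add_in_I by fastforce
    qed
    then show ?thesis using that by (auto simp: K_def)
  qed
  have "ideal K F"
  proof (rule idealI)
    show "subgroup K (add_monoid F)"
    proof (rule F.add.subgroupI)
      have "0 \<in> K" by (simp add: K_def zero_in_I coeff_at_zero pair_ring_zero_closed)
      then show "K \<noteq> {}" by blast
      show "\<ominus>\<^bsub>F\<^esub> x \<in> K" if "x \<in> K" for x
      proof -
        have "coeff_at i (- x) = - coeff_at i x" for i
          using coeff_at_diff[of i 0 x] by (simp add: coeff_at_zero)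
        then show ?thesis
          using that F.a_inv_closed[of x] by (simp add: K_def a_inv_F uminus_in_I)
      qed
      show "x \<oplus>\<^bsub>F\<^esub> y \<in> K" if "x \<in> K" "y \<in> K" for x y
        using that by (simp add: K_def coeff_at_add pair_ring_simps(4) add_in_I pair_ring_add_closed)
    qed (auto simp: K_def)
  next
    show "y \<otimes>\<^bsub>F\<^esub> x \<in> K" if "x \<in> K" "y \<in> carrier F" for x y using mult that .
    show "x \<otimes>\<^bsub>F\<^esub> y \<in> K" if "x \<in> K" "y \<in> carrier F" for x y
      using mult[OF that] that F.m_comm[of x y] by (simp add: K_def)
  qed (rule F.ring_axioms)
  moreover have "tensor_relations C P B f g \<subseteq> K"
    using tensor_relations_subset coeff_at_relation by (auto simp: K_def)
  ultimately have "I \<subseteq> K" unfolding tensor_ideal_def by (rule F.genideal_minimal)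
  then show ?thesis using assms by (auto simp: K_def)
qed

lemma coeff_at_eventually_in_I:
  assumes "x \<in> carrier F"
  shows "\<exists>N. \<forall>i>N. coeff_at i x \<in> I"
  using assms
proof (induction x rule: pair_ring_induct)
  case zero
  then show ?case by (simp add: coeff_at_zero zero_in_I)
next
  case (of p z)
  then show ?case
    by (intro exI[of _ "deg R p"]) (auto simp: coeff_at_of deg_aboveD of_zero_in_I)
next
  case (diff x y)
  then obtain N M where "\<forall>i>N. coeff_at i x \<in> I" "\<forall>i>M. coeff_at i y \<in> I" by blast
  then show ?case
    by (intro exI[of _ "max N M"]) (auto simp: coeff_at_diff intro: diff_in_I)
qed

text \<open>Asserted for all large \<open>M\<close>, so that the expansions of two elements can be
  subtracted at a common \<open>M\<close>.\<close>

lemma coeff_at_expansion: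
  assumes "x \<in> carrier F"
  shows "\<exists>N. \<forall>M\<ge>N. x - (\<Sum>i\<le>M. frag_of (up_ring.monom P \<one> i, \<one>\<^bsub>B\<^esub>) \<otimes>\<^bsub>F\<^esub> coeff_at i x) \<in> I"
  using assms
proof (induction x rule: pair_ring_induct)
  case zero
  then show ?case by (simp add: coeff_at_zero pair_ring_mult_zero zero_in_I)
next
  case (of p z)
  show ?case
  proof (intro exI[of _ "deg R p"] allI impI)
    fix M assume M: "deg R p \<le> M"
    have "p = (\<Oplus>\<^bsub>P\<^esub>i\<in>{..M}. up_ring.monom P (up_ring.coeff P p i) i)"
      using up_repr_le[OF M] of by simp
    moreover have "frag_of (\<Oplus>\<^bsub>P\<^esub>i\<in>{..M}. up_ring.monom P (up_ring.coeff P p i) i, z) -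
        (\<Sum>i\<le>M. frag_of (up_ring.monom P (up_ring.coeff P p i) i, z)) \<in> I"
      using of by (intro of_finsum_in_I) auto
    moreover have "up_ring.monom P (up_ring.coeff P p i) i = up_ring.monom P \<one> i \<otimes>\<^bsub>P\<^esub> up_ring.monom P (up_ring.coeff P p i) 0" for i
      using of monom_mult[of \<one> "up_ring.coeff P p i" i 0] by simp
    ultimately show "frag_of (p, z) - (\<Sum>i\<le>M. frag_of (up_ring.monom P \<one> i, \<one>\<^bsub>B\<^esub>) \<otimes>\<^bsub>F\<^esub> coeff_at i (frag_of (p, z))) \<in> I"
      using of by (simp add: coeff_at_of pair_ring_mult_of)
  qed
next
  case (diff x y)
  then obtain N N' where N: "\<forall>M\<ge>N. x - (\<Sum>i\<le>M. frag_of (up_ring.monom P \<one> i, \<one>\<^bsub>B\<^esub>) \<otimes>\<^bsub>F\<^esub> coeff_at i x) \<in> I"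
    "\<forall>M\<ge>N'. y - (\<Sum>i\<le>M. frag_of (up_ring.monom P \<one> i, \<one>\<^bsub>B\<^esub>) \<otimes>\<^bsub>F\<^esub> coeff_at i y) \<in> I" by blast
  show ?case
  proof (intro exI[of _ "max N N'"] allI impI)
    fix M assume M: "max N N' \<le> M"
    have "(x - (\<Sum>i\<le>M. frag_of (up_ring.monom P \<one> i, \<one>\<^bsub>B\<^esub>) \<otimes>\<^bsub>F\<^esub> coeff_at i x)) -
        (y - (\<Sum>i\<le>M. frag_of (up_ring.monom P \<one> i, \<one>\<^bsub>B\<^esub>) \<otimes>\<^bsub>F\<^esub> coeff_at i y)) \<in> I"
      by (rule diff_in_I[OF N(1)[rule_format] N(2)[rule_format]]) (use M in auto)
    then show "x - y - (\<Sum>i\<le>M. frag_of (up_ring.monom P \<one> i, \<one>\<^bsub>B\<^esub>) \<otimes>\<^bsub>F\<^esub> coeff_at i (x - y)) \<in> I"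
      by (simp add: pair_ring_mult_diff_right coeff_at_diff sum_subtractf algebra_simps)
  qed
qed

lemma in_I_if_coeff_at:
  assumes x: "x \<in> carrier F" and "\<And>i. coeff_at i x \<in> I"
  shows "x \<in> I"
proof -
  obtain N where "x - (\<Sum>i\<le>N. frag_of (up_ring.monom P \<one> i, \<one>\<^bsub>B\<^esub>) \<otimes>\<^bsub>F\<^esub> coeff_at i x) \<in> I"
    using coeff_at_expansion[OF x] by blast
  moreover have "(\<Sum>i\<le>N. frag_of (up_ring.monom P \<one> i, \<one>\<^bsub>B\<^esub>) \<otimes>\<^bsub>F\<^esub> coeff_at i x) \<in> I"
    using assms by (intro sum_in_I I.I_l_closed) (auto simp: frag_of_in_pair_ring)
  ultimately show ?thesis using add_in_I by fastforce
qed

text \<open>A leading coefficient argument that tolerates zero divisors. If \<open>y\<close> is not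
  in \<open>I\<close>, let \<open>N\<close> be the largest index of a coefficient outside
  \<open>I\<close>. Modulo \<open>I\<close>, coefficient \<open>N + d\<close> of the product reduces
  to the product of the coefficients \<open>d\<close> and \<open>N\<close>, and the former is a
  unit.\<close>

lemma monic_cancel:
  assumes p: "p \<in> carrier P" "up_ring.coeff P p d = \<one>" "\<And>i. i > d \<Longrightarrow> up_ring.coeff P p i = \<zero>"
    and z: "z \<in> carrier B" "z' \<in> carrier B" "z' \<otimes>\<^bsub>B\<^esub> z = \<one>\<^bsub>B\<^esub>"
    and y: "y \<in> carrier F" "\<And>i. i \<ge> d \<Longrightarrow> coeff_at i (frag_of (p, z) \<otimes>\<^bsub>F\<^esub> y) \<in> I"
  shows "y \<in> I"
proof (rule ccontr)
  let ?x = "frag_of (p, z)"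
  have x: "?x \<in> carrier F" using p z by (simp add: frag_of_in_pair_ring)
  assume "y \<notin> I"
  then obtain i0 where i0: "coeff_at i0 y \<notin> I" using in_I_if_coeff_at[OF y(1)] by blast
  obtain M where M: "\<forall>i>M. coeff_at i y \<in> I" using coeff_at_eventually_in_I[OF y(1)] by blast
  define N where "N = Max {i. coeff_at i y \<notin> I}"
  have fin: "finite {i. coeff_at i y \<notin> I}"
  proof (rule finite_subset)
    show "{i. coeff_at i y \<notin> I} \<subseteq> {..M}"
    proof
      fix i assume "i \<in> {i. coeff_at i y \<notin> I}"
      then have "\<not> i > M" using M by blast
      then show "i \<in> {..M}" by simp
    qed
  qed simp
  have N: "coeff_at N y \<notin> I" using Max_in[OF fin] i0 unfolding N_def by blast
  have above: "coeff_at i y \<in> I" if "i > N" for i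
    using Max_ge[OF fin, of i] that unfolding N_def by force
  have terms: "coeff_at j ?x \<otimes>\<^bsub>F\<^esub> coeff_at (N + d - j) y \<in> I" if "j \<in> {..N + d} - {d}" for j
  proof (cases "j > d")
    case True
    then have "coeff_at j ?x \<in> I" using p z of_zero_in_I by (simp add: coeff_at_of)
    then show ?thesis using coeff_at_closed[OF y(1)] by (rule I.I_r_closed)
  next
    case False
    then have "coeff_at (N + d - j) y \<in> I" using that by (intro above) auto
    then show ?thesis using coeff_at_closed[OF x] by (rule I.I_l_closed)
  qed
  let ?S = "\<lambda>A. \<Sum>j\<in>A. coeff_at j ?x \<otimes>\<^bsub>F\<^esub> coeff_at (N + d - j) y"
  have "coeff_at (N + d) (?x \<otimes>\<^bsub>F\<^esub> y) - ?S {..N + d} \<in> I" by (rule coeff_at_mult[OF x y(1)])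
  moreover have "coeff_at (N + d) (?x \<otimes>\<^bsub>F\<^esub> y) \<in> I" by (rule y(2)) simp
  ultimately have "?S {..N + d} \<in> I" using diff_in_I by fastforce
  moreover have "?S ({..N + d} - {d}) \<in> I" using terms by (rule sum_in_I)
  moreover have "?S {..N + d} = coeff_at d ?x \<otimes>\<^bsub>F\<^esub> coeff_at N y + ?S ({..N + d} - {d})"
    by (subst sum.remove[of _ d]) auto
  ultimately have "coeff_at d ?x \<otimes>\<^bsub>F\<^esub> coeff_at N y \<in> I" using diff_in_I by fastforce
  \<comment> \<open>Multiplication by \<open>z'\<close> cancels the factor \<open>z\<close> left in
    the leading coefficient.\<close>
  then have "frag_of (\<one>\<^bsub>P\<^esub>, z') \<otimes>\<^bsub>F\<^esub> (coeff_at d ?x \<otimes>\<^bsub>F\<^esub> coeff_at N y) \<in> I"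
    by (rule I.I_l_closed) (use z in \<open>simp add: frag_of_in_pair_ring\<close>)
  moreover have "frag_of (\<one>\<^bsub>P\<^esub>, z') \<otimes>\<^bsub>F\<^esub> (coeff_at d ?x \<otimes>\<^bsub>F\<^esub> coeff_at N y) =
      frag_of (\<one>\<^bsub>P\<^esub>, z') \<otimes>\<^bsub>F\<^esub> coeff_at d ?x \<otimes>\<^bsub>F\<^esub> coeff_at N y"
    using z by (intro F.m_assoc[symmetric] coeff_at_closed[OF x] coeff_at_closed[OF y(1)])
      (simp add: frag_of_in_pair_ring)
  moreover have "frag_of (\<one>\<^bsub>P\<^esub>, z') \<otimes>\<^bsub>F\<^esub> coeff_at d ?x = \<one>\<^bsub>F\<^esub>"
    using p z by (simp add: coeff_at_of pair_ring_mult_of pair_ring_simps(2))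
  ultimately have "coeff_at N y \<in> I" using coeff_at_closed[OF y(1)] by simp
  with N show False by simp
qed

section \<open>Division in the tensor ring\<close>

abbreviation (input) "T \<equiv> tensor_ring C P B f g"
abbreviation (input) "pt \<equiv> pure_tensor C P B f g"

lemma ring_hom_T: "(\<lambda>x. I +>\<^bsub>F\<^esub> x) \<in> ring_hom F T"
  unfolding tensor_ring_def by (rule I.rcos_ring_hom)

lemma coset_eq_iff: "x \<in> carrier F \<Longrightarrow> y \<in> carrier F \<Longrightarrow> I +>\<^bsub>F\<^esub> x = I +>\<^bsub>F\<^esub> y \<longleftrightarrow> x - y \<in> I"
  using F.quotient_eq_iff_same_a_r_cos[OF I.ideal_axioms, of x y] by (simp add: minus_F)

lemma pure_tensor_eq: "pt p z = I +>\<^bsub>F\<^esub> frag_of (p, z)"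
  by (simp add: pure_tensor_def)

lemma pure_tensor_mult:
  assumes "p \<in> carrier P" "q \<in> carrier P" "z \<in> carrier B" "w \<in> carrier B"
  shows "pt p z \<otimes>\<^bsub>T\<^esub> pt q w = pt (p \<otimes>\<^bsub>P\<^esub> q) (z \<otimes>\<^bsub>B\<^esub> w)"
  using assms ring_hom_mult[OF ring_hom_T, of "frag_of (p, z)" "frag_of (q, w)"]
  by (simp add: pure_tensor_eq frag_of_in_pair_ring pair_ring_mult_of)

lemma pure_tensor_one: "pt \<one>\<^bsub>P\<^esub> \<one>\<^bsub>B\<^esub> = \<one>\<^bsub>T\<^esub>"
  using ring_hom_one[OF ring_hom_T] by (simp add: pure_tensor_eq pair_ring_simps)

text \<open>Once the tensor of \<open>p\<close> and \<open>z\<close> times that of \<open>q\<close>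
  and \<open>u\<close> is subtracted from both sides, only the terms with \<open>r\<close> and
  \<open>s\<close> remain. Both have degree below \<open>d\<close>, so \<open>monic_cancel\<close>
  applies to the difference of \<open>Y\<close> and the claimed quotient. The second slots
  \<open>w\<close> and \<open>z u\<close> may differ, as only degrees in the first slot are
  compared.\<close>

lemma pure_tensor_division:
  assumes p: "p \<in> carrier P" "up_ring.coeff P p d = \<one>" "\<And>i. i > d \<Longrightarrow> up_ring.coeff P p i = \<zero>"
    and z: "z \<in> carrier B" "z' \<in> carrier B" "z' \<otimes>\<^bsub>B\<^esub> z = \<one>\<^bsub>B\<^esub>"
    and r: "r \<in> carrier P" "\<And>i. i \<ge> d \<Longrightarrow> up_ring.coeff P r i = \<zero>" "w \<in> carrier B"
    and s: "s \<in> carrier P" "\<And>i. i \<ge> d \<Longrightarrow> up_ring.coeff P s i = \<zero>"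
    and q: "q \<in> carrier P" "u \<in> carrier B"
    and Y: "Y \<in> carrier T"
    and eq: "pt p z \<otimes>\<^bsub>T\<^esub> Y = pt r w \<oplus>\<^bsub>T\<^esub> pt (p \<otimes>\<^bsub>P\<^esub> q \<oplus>\<^bsub>P\<^esub> s) (z \<otimes>\<^bsub>B\<^esub> u)"
  shows "Y = pt q u"
proof -
  obtain y where y: "y \<in> carrier F" "Y = I +>\<^bsub>F\<^esub> y"
    using Y unfolding tensor_ring_def FactRing_def A_RCOSETS_def' by auto
  let ?x = "frag_of (p, z)" and ?q = "frag_of (q, u)" and ?r = "frag_of (r, w)"
    and ?m = "frag_of (p \<otimes>\<^bsub>P\<^esub> q \<oplus>\<^bsub>P\<^esub> s, z \<otimes>\<^bsub>B\<^esub> u)" and ?s = "frag_of (s, z \<otimes>\<^bsub>B\<^esub> u)"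
  have closed: "?x \<in> carrier F" "?q \<in> carrier F" "?r \<in> carrier F" "?m \<in> carrier F" "?s \<in> carrier F"
    using p z r s q by (auto simp: frag_of_in_pair_ring)
  have "pt p z \<otimes>\<^bsub>T\<^esub> Y = I +>\<^bsub>F\<^esub> (?x \<otimes>\<^bsub>F\<^esub> y)"
    using ring_hom_mult[OF ring_hom_T closed(1) y(1)] y(2) by (simp add: pure_tensor_eq)
  moreover have "pt r w \<oplus>\<^bsub>T\<^esub> pt (p \<otimes>\<^bsub>P\<^esub> q \<oplus>\<^bsub>P\<^esub> s) (z \<otimes>\<^bsub>B\<^esub> u) = I +>\<^bsub>F\<^esub> (?r + ?m)"
    using ring_hom_add[OF ring_hom_T closed(3,4)] by (simp add: pure_tensor_eq pair_ring_simps)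
  ultimately have 1: "?x \<otimes>\<^bsub>F\<^esub> y - (?r + ?m) \<in> I"
    using eq closed y(1) by (subst coset_eq_iff[symmetric]) (auto intro: add_in_F)
  have "?m - ?x \<otimes>\<^bsub>F\<^esub> ?q - ?s \<in> I"
    using p z s q by (simp add: pair_ring_mult_of) (intro of_add_in_I, auto)
  with 1 have "(?x \<otimes>\<^bsub>F\<^esub> y - (?r + ?m)) + (?m - ?x \<otimes>\<^bsub>F\<^esub> ?q - ?s) \<in> I" by (rule add_in_I)
  then have 2: "?x \<otimes>\<^bsub>F\<^esub> (y - ?q) - (?r + ?s) \<in> I"
    by (simp add: pair_ring_mult_diff_right algebra_simps)
  have coeffs: "coeff_at i (?x \<otimes>\<^bsub>F\<^esub> (y - ?q)) \<in> I" if "i \<ge> d" for i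
  proof -
    have "coeff_at i (?r + ?s) \<in> I"
      using r s z q that by (auto simp: coeff_at_add coeff_at_of intro!: add_in_I of_zero_in_I)
    moreover have "coeff_at i (?x \<otimes>\<^bsub>F\<^esub> (y - ?q)) - coeff_at i (?r + ?s) \<in> I"
      using coeff_at_in_I[OF 2] by (simp add: coeff_at_diff)
    ultimately show ?thesis using add_in_I by fastforce
  qed
  have "y - ?q \<in> carrier F" using y(1) closed(2) by (rule minus_in_F)
  have "y - ?q \<in> I"
    by (rule monic_cancel[of p d z z']; fact)
  then show ?thesis using y closed coset_eq_iff by (simp add: pure_tensor_eq)
qed

end

section \<open>Invariant polynomials and Chern quotients\<close>

lemma poly_mapping_mult_eq_sum:
  "p * q = (\<Sum>a\<in>Poly_Mapping.keys p. \<Sum>b\<in>Poly_Mapping.keys q.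
     Poly_Mapping.single (a + b) (Poly_Mapping.lookup p a * Poly_Mapping.lookup q b))"
  for p q :: "'a::comm_monoid_add \<Rightarrow>\<^sub>0 'b::comm_ring_1"
proof -
  have "p * q = (\<Sum>a\<in>Poly_Mapping.keys p. Poly_Mapping.single a (Poly_Mapping.lookup p a)) *
      (\<Sum>b\<in>Poly_Mapping.keys q. Poly_Mapping.single b (Poly_Mapping.lookup q b))"
    by (simp only: poly_mapping_sum_monomials)
  then show ?thesis by (simp add: sum_product mult_single)
qed

lemma map_key_sum:
  "inj f \<Longrightarrow> Poly_Mapping.map_key f (\<Sum>i\<in>S. h i) = (\<Sum>i\<in>S. Poly_Mapping.map_key f (h i))"
  by (induction S rule: infinite_finite_induct) (auto simp: map_key_plus)

text \<open>Pulling back along \<open>f\<close> sends a monomial to the one whose exponent is its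
  preimage under \<open>f\<close>, and the inverse of an additive bijection is additive.\<close>

lemma map_key_mult:
  fixes p q :: "'a::comm_monoid_add \<Rightarrow>\<^sub>0 'b::comm_ring_1"
  assumes "bij f" "\<And>x y. f (x + y) = f x + f y"
  shows "Poly_Mapping.map_key f (p * q) = Poly_Mapping.map_key f p * Poly_Mapping.map_key f q"
proof -
  have inj: "inj f" using assms(1) by (rule bij_is_inj)
  have single: "Poly_Mapping.map_key f (Poly_Mapping.single a c) = Poly_Mapping.single (inv_into UNIV f a) c"
    for a and c :: 'b
    using map_key_single[OF inj, of "inv_into UNIV f a" c] assms(1) by (simp add: bij_is_surj surj_f_inv_f)
  have add: "inv_into UNIV f (a + b) = inv_into UNIV f a + inv_into UNIV f b" for a b
    using assms by (metis bij_inv_eq_iff)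
  have expand: "Poly_Mapping.map_key f p = (\<Sum>a\<in>Poly_Mapping.keys p. Poly_Mapping.single (inv_into UNIV f a) (Poly_Mapping.lookup p a))" for p :: "'a \<Rightarrow>\<^sub>0 'b"
    using arg_cong[OF poly_mapping_sum_monomials[of p], of "Poly_Mapping.map_key f"]
    by (simp add: map_key_sum[OF inj] single)
  show ?thesis
    unfolding expand[of p] expand[of q] sum_product mult_single
    unfolding poly_mapping_mult_eq_sum[of p q] map_key_sum[OF inj] single add ..
qed

lemma weyl_bij: "w \<in> weyl_group n v \<Longrightarrow> bij w"
  by (auto simp: weyl_group_def intro: permutes_bij)

lemma bij_map_key:
  fixes w :: "'a \<Rightarrow> 'a"
  assumes "bij w"
  shows "bij (Poly_Mapping.map_key w :: ('a \<Rightarrow>\<^sub>0 'b::zero) \<Rightarrow> _)"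
proof (rule bijI')
  have inj: "inj w" "inj (inv_into UNIV w)" using assms by (auto simp: bij_is_inj bij_imp_bij_inv)
  have id: "w \<circ> inv_into UNIV w = (\<lambda>x. x)" "inv_into UNIV w \<circ> w = (\<lambda>x. x)"
    using assms by (auto simp: fun_eq_iff bij_is_surj surj_f_inv_f bij_is_inj)
  have 1: "Poly_Mapping.map_key (inv_into UNIV w) (Poly_Mapping.map_key w p) = p" for p :: "'a \<Rightarrow>\<^sub>0 'b"
    using map_key_compose[OF inj(2,1), of p] by (simp add: id map_key_id)
  have 2: "Poly_Mapping.map_key w (Poly_Mapping.map_key (inv_into UNIV w) p) = p" for p :: "'a \<Rightarrow>\<^sub>0 'b"
    using map_key_compose[OF inj(1,2), of p] by (simp add: id map_key_id)
  show "Poly_Mapping.map_key w x = Poly_Mapping.map_key w y \<longleftrightarrow> x = y" for x y :: "'a \<Rightarrow>\<^sub>0 'b"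
    using 1 by metis
  show "\<exists>x. y = Poly_Mapping.map_key w x" for y :: "'a \<Rightarrow>\<^sub>0 'b"
    using 2 by metis
qed

text \<open>The inner \<open>map_key w\<close> is an additive bijection of exponent vectors, so the
  outer one is multiplicative by \<open>map_key_mult\<close>.\<close>

lemma weyl_act_hom:
  assumes "w \<in> weyl_group n v"
  shows "weyl_act w (p + q) = weyl_act w p + weyl_act w q"
    "weyl_act w (p * q) = weyl_act w p * weyl_act w q"
    "weyl_act w 0 = 0" "weyl_act w (Poly_Mapping.single 0 c) = Poly_Mapping.single 0 c"
    "weyl_act w (mvar x) = mvar (w x)"
proof -
  note w = weyl_bij[OF assms]
  have bij: "bij (Poly_Mapping.map_key w :: (_ \<Rightarrow>\<^sub>0 nat) \<Rightarrow> _)" by (rule bij_map_key[OF w])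
  note inj = bij_is_inj[OF bij] and injw = bij_is_inj[OF w]
  show "weyl_act w (p + q) = weyl_act w p + weyl_act w q" "weyl_act w 0 = 0"
    by (simp_all add: weyl_act_def map_key_plus[OF inj] map_key_zero[OF inj])
  show "weyl_act w (p * q) = weyl_act w p * weyl_act w q"
    unfolding weyl_act_def by (rule map_key_mult[OF bij]) (rule map_key_plus[OF injw])
  show "weyl_act w (Poly_Mapping.single 0 c) = Poly_Mapping.single 0 c"
    using map_key_single[OF inj, of 0 c] by (simp add: weyl_act_def map_key_zero[OF injw])
  have "Poly_Mapping.map_key w (Poly_Mapping.single (w x) (1::nat)) = Poly_Mapping.single x 1"
    by (rule map_key_single[OF injw])
  then show "weyl_act w (mvar x) = mvar (w x)"
    using map_key_single[OF inj, of "Poly_Mapping.single (w x) 1" "1 :: complex"]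
    by (simp add: weyl_act_def mvar_def)
qed

lemma H_KT_closed:
  "0 \<in> H_KT n v" "Poly_Mapping.single 0 c \<in> H_KT n v"
  "p \<in> H_KT n v \<Longrightarrow> q \<in> H_KT n v \<Longrightarrow> p + q \<in> H_KT n v"
  "p \<in> H_KT n v \<Longrightarrow> - p \<in> H_KT n v"
  "p \<in> H_KT n v \<Longrightarrow> q \<in> H_KT n v \<Longrightarrow> p * q \<in> H_KT n v"
proof -
  show "0 \<in> H_KT n v" "Poly_Mapping.single 0 c \<in> H_KT n v" by (auto simp: H_KT_def mvars_def)
  show "p \<in> H_KT n v \<Longrightarrow> - p \<in> H_KT n v"
    by (auto simp: H_KT_def mvars_def in_keys_iff)
  show "p \<in> H_KT n v \<Longrightarrow> q \<in> H_KT n v \<Longrightarrow> p + q \<in> H_KT n v"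
    using keys_add[of p q] by (fastforce simp: H_KT_def mvars_def)
  assume *: "p \<in> H_KT n v" "q \<in> H_KT n v"
  have "mvars (p * q) \<subseteq> mvars p \<union> mvars q"
  proof
    fix x assume "x \<in> mvars (p * q)"
    then obtain m where m: "m \<in> Poly_Mapping.keys (p * q)" "x \<in> Poly_Mapping.keys m"
      by (auto simp: mvars_def)
    then obtain a b where "a \<in> Poly_Mapping.keys p" "b \<in> Poly_Mapping.keys q" "m = a + b"
      using keys_mult[of p q] by blast
    then show "x \<in> mvars p \<union> mvars q" using m(2) keys_add[of a b] by (auto simp: mvars_def)
  qed
  then show "p * q \<in> H_KT n v" using * by (auto simp: H_KT_def)
qed

text \<open>A set-level notion that serves two purposes: closure of polynomial coefficients under
  arithmetic, and the ring structure on restricted carriers such as those of \<open>big_ring\<close>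
  and \<open>C_zeta\<close>.\<close>

definition subring_set :: "'a::comm_ring_1 set \<Rightarrow> bool" where
  "subring_set S \<longleftrightarrow> 1 \<in> S \<and> (\<forall>x\<in>S. - x \<in> S) \<and> (\<forall>x\<in>S. \<forall>y\<in>S. x + y \<in> S \<and> x * y \<in> S)"

lemma subring_setD:
  assumes "subring_set S"
  shows "1 \<in> S" "0 \<in> S" "x \<in> S \<Longrightarrow> - x \<in> S" "x \<in> S \<Longrightarrow> y \<in> S \<Longrightarrow> x + y \<in> S"
    "x \<in> S \<Longrightarrow> y \<in> S \<Longrightarrow> x - y \<in> S" "x \<in> S \<Longrightarrow> y \<in> S \<Longrightarrow> x * y \<in> S"
proof -
  have *: "1 \<in> S" "\<And>x. x \<in> S \<Longrightarrow> - x \<in> S" "\<And>x y. x \<in> S \<Longrightarrow> y \<in> S \<Longrightarrow> x + y \<in> S"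
    "\<And>x y. x \<in> S \<Longrightarrow> y \<in> S \<Longrightarrow> x * y \<in> S"
    using assms by (auto simp: subring_set_def)
  show "0 \<in> S" using *(3)[OF *(1) *(2)[OF *(1)]] by simp
  show "x \<in> S \<Longrightarrow> y \<in> S \<Longrightarrow> x - y \<in> S" using *(3)[OF _ *(2)] by fastforce
qed (use assms in \<open>auto simp: subring_set_def\<close>)

lemma subring_set_sum: "subring_set S \<Longrightarrow> (\<And>i. i \<in> A \<Longrightarrow> f i \<in> S) \<Longrightarrow> sum f A \<in> S"
  by (induction A rule: infinite_finite_induct) (auto intro: subring_setD)

lemma subring_set_invariants: "subring_set (invariants n v)"
proof -
  have one: "(1 :: xipoly) = Poly_Mapping.single 0 1" by simp
  have neg: "weyl_act w (- p) = - weyl_act w p" if "w \<in> weyl_group n v" for w p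
    using weyl_act_hom(1)[OF that, of "- p" p] weyl_act_hom(3)[OF that]
    by (simp add: eq_neg_iff_add_eq_0)
  show ?thesis
    unfolding subring_set_def invariants_def one
    using H_KT_closed[where n=n and v=v] weyl_act_hom[where n=n and v=v] neg by (auto simp del: single_one)
qed

lemma single_in_invariants: "Poly_Mapping.single 0 c \<in> invariants n v"
  using H_KT_closed[where n=n and v=v] weyl_act_hom[where n=n and v=v] by (auto simp: invariants_def)

section \<open>Polynomials over a subring and long division\<close>

definition poly_over :: "'a::comm_ring_1 set \<Rightarrow> 'a poly \<Rightarrow> bool" where
  "poly_over S p \<longleftrightarrow> (\<forall>i. Polynomial.coeff p i \<in> S)"

lemma poly_over_arith:
  assumes "subring_set S"
  shows "poly_over S p \<Longrightarrow> poly_over S q \<Longrightarrow> poly_over S (p + q)"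
    "poly_over S p \<Longrightarrow> poly_over S q \<Longrightarrow> poly_over S (p - q)"
    "poly_over S p \<Longrightarrow> poly_over S q \<Longrightarrow> poly_over S (p * q)"
    "poly_over S 0" "poly_over S 1" "c \<in> S \<Longrightarrow> poly_over S (Polynomial.monom c m)"
  using assms by (auto simp: poly_over_def coeff_mult coeff_1 coeff_monom intro!: subring_setD subring_set_sum)

text \<open>Long division by a monic polynomial, by induction on a degree bound \<open>N\<close>. It
  also records that coefficients stay in \<open>S\<close> and how far the quotient extends; both are
  needed for \<delta>.\<close>

lemma monic_division:
  fixes f g :: "'a::comm_ring_1 poly"
  assumes S: "subring_set S" and g: "poly_over S g" "Polynomial.coeff g d = 1" "\<And>i. i > d \<Longrightarrow> Polynomial.coeff g i = 0"
    and f: "poly_over S f" "\<And>i. i \<ge> N \<Longrightarrow> Polynomial.coeff f i = 0"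
  shows "\<exists>q r. poly_over S q \<and> poly_over S r \<and> f = g * q + r \<and>
    (\<forall>i\<ge>d. Polynomial.coeff r i = 0) \<and> (\<forall>i. i + d \<ge> N \<longrightarrow> Polynomial.coeff q i = 0)"
  using f
proof (induction N arbitrary: f)
  case 0
  then have "f = 0" by (intro poly_eqI) simp
  then show ?case using poly_over_arith[OF S] by (intro exI[of _ 0]) auto
next
  case (Suc N)
  show ?case
  proof (cases "Suc N \<le> d")
    case True
    then show ?thesis using Suc.prems poly_over_arith[OF S] by (intro exI[of _ 0] exI[of _ f]) auto
  next
    case False
    define m where "m = Polynomial.monom (Polynomial.coeff f N) (N - d)"
    have m: "poly_over S m"
      using Suc.prems(1) poly_over_arith(6)[OF S] by (simp add: m_def poly_over_def)
    have coeff: "Polynomial.coeff (g * m) i = (if i < N - d then 0 else Polynomial.coeff f N * Polynomial.coeff g (i - (N - d)))" for i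
      by (simp add: m_def mult.commute[of g] coeff_monom_mult)
    have "\<exists>q r. poly_over S q \<and> poly_over S r \<and> f - g * m = g * q + r \<and>
        (\<forall>i\<ge>d. Polynomial.coeff r i = 0) \<and> (\<forall>i. i + d \<ge> N \<longrightarrow> Polynomial.coeff q i = 0)"
    proof (rule Suc.IH)
      show "poly_over S (f - g * m)" using poly_over_arith[OF S] Suc.prems g m by blast
      show "Polynomial.coeff (f - g * m) i = 0" if "N \<le> i" for i
      proof (cases "i = N")
        case True
        then show ?thesis using False g by (simp add: coeff)
      next
        case neq: False
        then have "Polynomial.coeff f i = 0" "Polynomial.coeff g (i - (N - d)) = 0"
          using that False Suc.prems(2)[of i] g(3)[of "i - (N - d)"] by auto
        then show ?thesis by (simp add: coeff)
      qed
    qed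
    then obtain q r where qr: "poly_over S q" "poly_over S r" "f - g * m = g * q + r"
        "\<forall>i\<ge>d. Polynomial.coeff r i = 0" "\<forall>i. i + d \<ge> N \<longrightarrow> Polynomial.coeff q i = 0" by blast
    have "f = g * (q + m) + r" using qr(3) by (simp add: algebra_simps)
    moreover have "Polynomial.coeff (q + m) i = 0" if "Suc N \<le> i + d" for i
      using that False qr(5) by (auto simp: m_def)
    ultimately show ?thesis using qr(1,2,4) m poly_over_arith[OF S] by blast
  qed
qed

lemma map_poly_hom:
  assumes "f 0 = 0" "\<And>x y. f (x + y) = f x + f y" "\<And>x y. f (x * y) = f x * f y"
  shows "map_poly f (p * q) = map_poly f p * map_poly f q"
proof -
  have "f (sum h A) = (\<Sum>i\<in>A. f (h i))" if "finite A" for h and A :: "nat set"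
    using that assms by (induction A rule: finite_induct) auto
  then show ?thesis
    by (intro poly_eqI) (simp add: coeff_map_poly assms coeff_mult)
qed

lemma map_poly_prod:
  assumes "f 0 = 0" "f 1 = 1" "\<And>x y. f (x + y) = f x + f y" "\<And>x y. f (x * y) = f x * f y"
  shows "map_poly f (prod h A) = (\<Prod>i\<in>A. map_poly f (h i))"
  by (induction A rule: infinite_finite_induct) (auto simp: map_poly_hom assms map_poly_1')

text \<open>A Weyl group element permutes the Chern roots at each node, hence the linear factors of
  the product.\<close>

lemma poly_over_chern:
  assumes "\<forall>k>n. v k = 0"
  shows "poly_over (invariants n v) (chern v i)"
proof -
  have "subring_set (H_KT n v)"
    using H_KT_closed[where n=n and v=v] H_KT_closed(2)[where n=n and v=v and c=1] by (auto simp: subring_set_def)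
  note H = poly_over_arith[OF this] subring_setD[OF this]
  have "poly_over (H_KT n v) (\<Prod>j\<in>A. [:mvar (i, j), 1:])" if "finite A" "A \<subseteq> {..<v i}" for A
    using that
  proof (induction A rule: finite_induct)
    case (insert j A)
    have "i \<le> n" using insert assms by (cases "i \<le> n") auto
    then have "mvar (i, j) \<in> H_KT n v"
      using insert by (auto simp: H_KT_def mvars_def mvar_def)
    then have "poly_over (H_KT n v) [:mvar (i, j), 1:]"
      using H(7,8) by (auto simp: poly_over_def coeff_pCons split: nat.splits)
    then have "poly_over (H_KT n v) ([:mvar (i, j), 1:] * (\<Prod>j\<in>A. [:mvar (i, j), 1:]))"
      using insert by (intro H(3)) auto
    then show ?case using insert(1,2) by (subst prod.insert)
  qed (use H in auto)
  then have 1: "poly_over (H_KT n v) (chern v i)" by (simp add: chern_def)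
  have "map_poly (weyl_act w) (chern v i) = chern v i" if w: "w \<in> weyl_group n v" for w
  proof -
    have one: "weyl_act w 1 = 1" using weyl_act_hom(4)[OF w, of 1] by simp
    have lin: "map_poly (weyl_act w) [:mvar x, 1:] = [:mvar (w x), 1:]" for x
      using weyl_act_hom[OF w] one by (simp add: map_poly_pCons)
    have fst: "fst (w x) = fst x" for x using w by (cases x) (simp add: weyl_group_def)
    have perm: "w permutes gauge_index n v" using w by (simp add: weyl_group_def)
    have maps: "snd (w (i, j)) < v i" if "j < v i" for j
    proof (cases "(i, j) \<in> gauge_index n v")
      case True
      then have "w (i, j) \<in> gauge_index n v" using permutes_in_image[OF perm] by blast
      then show ?thesis using fst[of "(i, j)"] by (cases "w (i, j)") (auto simp: gauge_index_def)
    next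
      \<comment> \<open>This covers the equivariant parameters at node \<open>0\<close>, which
        \<open>w\<close> fixes.\<close>
      case False
      then show ?thesis using permutes_not_in[OF perm] that by simp
    qed
    have pair: "w (i, j) = (i, snd (w (i, j)))" for j using fst[of "(i, j)"] by (metis fst_conv prod.collapse)
    have inj: "inj_on (\<lambda>j. snd (w (i, j))) {..<v i}"
      using bij_is_inj[OF weyl_bij[OF w]] pair by (auto simp: inj_on_def) (metis Pair_inject injD)
    then have surj: "(\<lambda>j. snd (w (i, j))) ` {..<v i} = {..<v i}"
      using maps by (intro endo_inj_surj) auto
    have "map_poly (weyl_act w) (chern v i) = (\<Prod>j<v i. [:mvar (i, snd (w (i, j))), 1:])"
      unfolding chern_def
      by (subst map_poly_prod) (auto simp: weyl_act_hom[OF w] one lin pair[symmetric])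
    also have "\<dots> = chern v i"
      unfolding chern_def by (rule prod.reindex_cong[OF inj surj[symmetric], symmetric]) simp
    finally show ?thesis .
  qed
  then have "weyl_act w (Polynomial.coeff (chern v i) k) = Polynomial.coeff (chern v i) k"
    if "w \<in> weyl_group n v" for w k
    using that weyl_act_hom(3)[OF that] coeff_map_poly[of "weyl_act w" "chern v i" k] by simp
  with 1 show ?thesis by (simp add: poly_over_def invariants_def)
qed

lemma chern_monic:
  "Polynomial.coeff (chern v i) (v i) = 1" "k > v i \<Longrightarrow> Polynomial.coeff (chern v i) k = 0"
proof -
  have "Polynomial.coeff (\<Prod>j<N. [:mvar (i, j) :: xipoly, 1:]) N = 1 \<and>
      (\<forall>k>N. Polynomial.coeff (\<Prod>j<N. [:mvar (i, j) :: xipoly, 1:]) k = 0)" for N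
  proof (induction N)
    case (Suc N)
    show ?case using Suc by (auto simp: coeff_pCons mult.commute split: nat.splits)
  qed (auto simp: coeff_1)
  then show "Polynomial.coeff (chern v i) (v i) = 1" "k > v i \<Longrightarrow> Polynomial.coeff (chern v i) k = 0"
    by (auto simp: chern_def)
qed

text \<open>The variable of the polynomial is sent to the inverse of \<open>fls_X\<close>, as in \<^const>\<open>chern_fls\<close>.\<close>

definition fls_of_poly :: "'a::comm_ring_1 poly \<Rightarrow> 'a fls" where
  "fls_of_poly p = poly (map_poly fls_const p) fls_X_inv"

lemma fls_of_poly_pCons: "fls_of_poly (pCons a p) = fls_const a + fls_X_inv * fls_of_poly p"
  by (simp add: fls_of_poly_def map_poly_pCons)

lemma fls_of_poly_simps:
  "fls_of_poly 0 = 0" "fls_of_poly 1 = 1" "fls_of_poly (p + q) = fls_of_poly p + fls_of_poly q"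
  "fls_of_poly (p * q) = fls_of_poly p * fls_of_poly q"
proof -
  show "fls_of_poly 0 = 0" "fls_of_poly 1 = 1" by (simp_all add: fls_of_poly_def map_poly_1')
  have "map_poly fls_const (p + q) = map_poly fls_const p + map_poly fls_const q"
    by (intro poly_eqI) (auto simp: coeff_map_poly intro!: fls_eqI)
  then show "fls_of_poly (p + q) = fls_of_poly p + fls_of_poly q"
    by (simp add: fls_of_poly_def)
  have "map_poly fls_const (p * q) = map_poly fls_const p * map_poly fls_const q"
    by (rule map_poly_hom) (auto intro!: fls_eqI)
  then show "fls_of_poly (p * q) = fls_of_poly p * fls_of_poly q"
    by (simp add: fls_of_poly_def)
qed

lemma fls_nth_of_poly:
  "fls_nth (fls_of_poly p) m = (if m \<le> 0 then Polynomial.coeff p (nat (- m)) else 0)"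
proof (induction p arbitrary: m)
  case 0
  then show ?case by (simp add: fls_of_poly_simps)
next
  case (pCons a p)
  show ?case
    by (cases "nat (- m)")
      (auto simp: fls_of_poly_pCons fls_X_inv_times_conv_shift pCons.IH nat_diff_distrib coeff_pCons
        split: nat.splits)
qed

lemma chern_fls_eq: "chern_fls v i = fls_of_poly (chern v i)"
proof -
  have "fls_of_poly (prod h A) = (\<Prod>j\<in>A. fls_of_poly (h j))" for h :: "nat \<Rightarrow> xipoly poly" and A
    by (induction A rule: infinite_finite_induct) (auto simp: fls_of_poly_simps)
  then show ?thesis
    by (simp add: chern_fls_def chern_def fls_of_poly_pCons fls_of_poly_simps add.commute)
qed

text \<open>In powers of \<open>fls_X\<close>, the inverse of t, a nonzero \<open>r\<close> starts
  at order at least \<open>1 - v l\<close> and the inverse of c_t(V_l) at order \<open>v l\<close>.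
  Their product has only negative powers of t, so the polynomial part of the quotient is
  \<open>q\<close>.\<close>

lemma delta_eq:
  assumes "chern v k = chern v l * q + r" "\<And>i. i \<ge> v l \<Longrightarrow> Polynomial.coeff r i = 0"
  shows "delta v k l = q"
proof -
  let ?c = "fls_of_poly (chern v l)" and ?r = "fls_of_poly r"
  have sub: "fls_subdegree ?c = - int (v l)"
    using chern_monic[of v l] by (intro fls_subdegree_eqI) (auto simp: fls_nth_of_poly)
  define ic where "ic = fls_right_inverse ?c 1"
  have ic: "?c * ic = 1"
    unfolding ic_def by (rule fls_right_inverse) (use sub chern_monic[of v l] in \<open>simp add: fls_nth_of_poly\<close>)
  have subic: "fls_subdegree ic = int (v l)"
    unfolding ic_def using sub by (subst fls_lr_inverse_subdegree(2)) auto
  have "fls_nth (?r * ic) (- int p) = 0" for p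
  proof (cases "?r = 0")
    case False
    have "fls_subdegree ?r \<ge> 1 - int (v l)"
      using False assms(2) by (intro fls_subdegree_geI) (auto simp: fls_nth_of_poly)
    then show ?thesis using subic by (intro fls_times_nth_eq0) auto
  qed simp
  moreover have "chern_quotient v k l = fls_of_poly q + ?r * ic"
  proof -
    have "chern_quotient v k l = (?c * fls_of_poly q + ?r) * ic"
      by (simp add: chern_quotient_def chern_fls_eq assms(1) fls_of_poly_simps ic_def)
    also have "\<dots> = (?c * ic) * fls_of_poly q + ?r * ic" by (simp add: algebra_simps)
    finally show ?thesis by (simp add: ic)
  qed
  ultimately have "fls_nth (chern_quotient v k l) (- int p) = Polynomial.coeff q p" for p
    by (simp add: fls_nth_of_poly)
  then show ?thesis by (simp add: delta_def coeff_inverse)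
qed

section \<open>The target ring and the images of the cluster variables\<close>

lemma ring_of_type_algebra_simps:
  "x \<otimes>\<^bsub>ring_of_type_algebra\<^esub> y = x * y" "x \<oplus>\<^bsub>ring_of_type_algebra\<^esub> y = x + y"
  "\<one>\<^bsub>ring_of_type_algebra\<^esub> = 1" "\<zero>\<^bsub>ring_of_type_algebra\<^esub> = 0"
  by (simp_all add: ring_of_type_algebra_def)

lemma cring_subring_set:
  assumes "subring_set S"
  shows "cring (ring_of_type_algebra\<lparr>carrier := S\<rparr>)"
proof (rule cringI)
  note S = subring_setD[OF assms]
  show "abelian_group (ring_of_type_algebra\<lparr>carrier := S\<rparr>)"
  proof (rule abelian_groupI)
    show "\<exists>y\<in>carrier (ring_of_type_algebra\<lparr>carrier := S\<rparr>).
        y \<oplus>\<^bsub>ring_of_type_algebra\<lparr>carrier := S\<rparr>\<^esub> x = \<zero>\<^bsub>ring_of_type_algebra\<lparr>carrier := S\<rparr>\<^esub>"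
      if "x \<in> carrier (ring_of_type_algebra\<lparr>carrier := S\<rparr>)" for x
      using that S by (intro bexI[of _ "- x"]) (simp_all add: ring_of_type_algebra_simps)
  qed (simp_all add: ring_of_type_algebra_simps S add_ac)
  show "comm_monoid (ring_of_type_algebra\<lparr>carrier := S\<rparr>)"
    by (rule comm_monoidI) (simp_all add: ring_of_type_algebra_simps S mult_ac)
qed (simp add: ring_of_type_algebra_simps algebra_simps)

lemma Eff_X_monoid: "0 \<in> Eff_X n v \<theta>" "a \<in> Eff_X n v \<theta> \<Longrightarrow> b \<in> Eff_X n v \<theta> \<Longrightarrow> a + b \<in> Eff_X n v \<theta>"
proof -
  show "0 \<in> Eff_X n v \<theta>"
    unfolding Eff_X_def monoid_generated_def by (rule image_eqI[of _ _ "[]"]) auto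
  assume "a \<in> Eff_X n v \<theta>" "b \<in> Eff_X n v \<theta>"
  then obtain xs ys where "a = sum_list xs" "b = sum_list ys"
      "xs \<in> lists {degree_bar n v d | d. \<exists>F. is_quasimap n v \<theta> (group_G n v) d F}"
      "ys \<in> lists {degree_bar n v d | d. \<exists>F. is_quasimap n v \<theta> (group_G n v) d F}"
    unfolding Eff_X_def monoid_generated_def by blast
  then show "a + b \<in> Eff_X n v \<theta>"
    unfolding Eff_X_def monoid_generated_def by (intro image_eqI[of _ _ "xs @ ys"]) auto
qed

lemma subring_set_keys_coeffs:
  assumes "0 \<in> E" "\<And>a b. a \<in> E \<Longrightarrow> b \<in> E \<Longrightarrow> a + b \<in> E" and S: "subring_set S"
  shows "subring_set {f :: 'a::comm_monoid_add \<Rightarrow>\<^sub>0 'b::comm_ring_1.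
    Poly_Mapping.keys f \<subseteq> E \<and> (\<forall>d. Poly_Mapping.lookup f d \<in> S)}"
  unfolding subring_set_def
proof (intro conjI ballI)
  note SD = subring_setD[OF S]
  let ?C = "{f :: 'a \<Rightarrow>\<^sub>0 'b. Poly_Mapping.keys f \<subseteq> E \<and> (\<forall>d. Poly_Mapping.lookup f d \<in> S)}"
  show "1 \<in> ?C" using assms(1) SD by (auto simp: lookup_one when_def)
  show "- f \<in> ?C" if "f \<in> ?C" for f
    using that SD by (auto simp: in_keys_iff)
  fix f g assume fg: "f \<in> ?C" "g \<in> ?C"
  then show "f + g \<in> ?C" using keys_add[of f g] SD by (auto simp: lookup_add)
  have "Poly_Mapping.keys (f * g) \<subseteq> E"
  proof
    fix x assume "x \<in> Poly_Mapping.keys (f * g)"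
    then obtain a b where "a \<in> Poly_Mapping.keys f" "b \<in> Poly_Mapping.keys g" "x = a + b"
      using keys_mult[of f g] by blast
    then show "x \<in> E" using fg assms(2)[of a b] by blast
  qed
  moreover have "Poly_Mapping.lookup (f * g) d \<in> S" for d
    unfolding poly_mapping_mult_eq_sum[of f g] lookup_sum lookup_single when_def
    using fg SD by (intro subring_set_sum[OF S]) auto
  ultimately show "f * g \<in> ?C" by simp
qed

lemma subring_set_big_ring: "subring_set (carrier (big_ring n v \<theta>))"
proof -
  have "carrier (big_ring n v \<theta>) =
      {f. Poly_Mapping.keys f \<subseteq> Eff_X n v \<theta> \<and> (\<forall>d. Poly_Mapping.lookup f d \<in> invariants n v)}"
    by (simp add: big_ring_def)
  then show ?thesis
    using subring_set_keys_coeffs[OF Eff_X_monoid subring_set_invariants] by simp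
qed

lemma cring_big_ring: "cring (big_ring n v \<theta>)"
  using cring_subring_set[OF subring_set_big_ring[of n v \<theta>]]
  by (simp add: big_ring_def ring_of_type_algebra_simps)

lemma subring_set_C_zeta: "subring_set (carrier (C_zeta n))"
proof -
  have "carrier (C_zeta n) = {f. Poly_Mapping.keys f \<subseteq> {a. Poly_Mapping.keys a \<subseteq> {..n}} \<and>
      (\<forall>d. Poly_Mapping.lookup f d \<in> UNIV)}"
    by (auto simp: C_zeta_def ring_of_type_algebra_simps)
  moreover have "a + b \<in> {a. Poly_Mapping.keys a \<subseteq> {..n}}"
    if "a \<in> {a. Poly_Mapping.keys a \<subseteq> {..n}}" "b \<in> {a. Poly_Mapping.keys a \<subseteq> {..n}}"
    for a b :: "nat \<Rightarrow>\<^sub>0 int"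
    using that keys_add[of a b] by auto
  ultimately show ?thesis
    by (simp only:) (rule subring_set_keys_coeffs, auto simp: subring_set_def)
qed

lemma cring_C_zeta: "cring (C_zeta n)"
  using cring_subring_set[OF subring_set_C_zeta[of n]] by (simp add: C_zeta_def ring_of_type_algebra_simps)

lemma C_zeta_simps:
  "x \<otimes>\<^bsub>C_zeta n\<^esub> y = x * y" "\<one>\<^bsub>C_zeta n\<^esub> = 1"
  by (simp_all add: C_zeta_def ring_of_type_algebra_simps)

lemma big_ring_simps:
  "x \<otimes>\<^bsub>big_ring n v \<theta>\<^esub> y = x * y" "x \<oplus>\<^bsub>big_ring n v \<theta>\<^esub> y = x + y"
  "\<one>\<^bsub>big_ring n v \<theta>\<^esub> = 1" "\<zero>\<^bsub>big_ring n v \<theta>\<^esub> = 0"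
  by (simp_all add: big_ring_def ring_of_type_algebra_simps)

lemma ideal_J_poly: "ideal (J_poly n v \<theta>) (big_ring n v \<theta>)"
proof -
  interpret cring "big_ring n v \<theta>" by (rule cring_big_ring)
  show ?thesis unfolding J_poly_def by (rule genideal_ideal) auto
qed

lemma cring_QH: "cring (QH n v \<theta>)"
  unfolding QH_def by (rule ideal.quotient_is_cring[OF ideal_J_poly cring_big_ring])

lemma QH_class_hom: "QH_class n v \<theta> \<in> ring_hom (big_ring n v \<theta>) (QH n v \<theta>)"
  using ideal.rcos_ring_hom[OF ideal_J_poly[of n v \<theta>]] unfolding QH_def QH_class_def .

lemma QH_class_zero: "QH_class n v \<theta> 0 = \<zero>\<^bsub>QH n v \<theta>\<^esub>"
  using ring_hom_zero[OF QH_class_hom cring.axioms(1)[OF cring_big_ring] cring.axioms(1)[OF cring_QH]]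
  by (simp add: big_ring_simps)

lemma mconst_in_big_ring: "c \<in> invariants n v \<Longrightarrow> mconst c \<in> carrier (big_ring n v \<theta>)"
  using Eff_X_monoid(1) subring_setD(2)[OF subring_set_invariants]
  by (auto simp: big_ring_def ring_of_type_algebra_simps mconst_def lookup_single when_def)

section \<open>Polynomials with invariant coefficients in the target ring\<close>

definition QH_const :: "nat \<Rightarrow> dimvec \<Rightarrow> (nat \<Rightarrow> int) \<Rightarrow> xipoly \<Rightarrow> qxipoly set" where
  "QH_const n v \<theta> c = QH_class n v \<theta> (mconst c)"

lemma QH_const_closed:
  "c \<in> invariants n v \<Longrightarrow> QH_const n v \<theta> c \<in> carrier (QH n v \<theta>)"
  unfolding QH_const_def by (rule ring_hom_closed[OF QH_class_hom mconst_in_big_ring])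

lemma QH_const_hom:
  assumes "c \<in> invariants n v" "d \<in> invariants n v"
  shows "QH_const n v \<theta> (c + d) = QH_const n v \<theta> c \<oplus>\<^bsub>QH n v \<theta>\<^esub> QH_const n v \<theta> d"
    "QH_const n v \<theta> (c * d) = QH_const n v \<theta> c \<otimes>\<^bsub>QH n v \<theta>\<^esub> QH_const n v \<theta> d"
  using assms[THEN mconst_in_big_ring[of _ n v \<theta>]]
    ring_hom_add[OF QH_class_hom[of n v \<theta>], of "mconst c" "mconst d"]
    ring_hom_mult[OF QH_class_hom[of n v \<theta>], of "mconst c" "mconst d"]
  by (simp_all add: QH_const_def big_ring_simps mconst_def single_add mult_single)

lemma QH_const_0_1: "QH_const n v \<theta> 0 = \<zero>\<^bsub>QH n v \<theta>\<^esub>" "QH_const n v \<theta> 1 = \<one>\<^bsub>QH n v \<theta>\<^esub>"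
  using QH_class_zero[of n v \<theta>] ring_hom_one[OF QH_class_hom[of n v \<theta>]]
  by (simp_all add: QH_const_def mconst_def big_ring_simps)

lemma QH_const_sum:
  assumes "finite A" "\<And>i. i \<in> A \<Longrightarrow> h i \<in> invariants n v"
  shows "QH_const n v \<theta> (\<Sum>i\<in>A. h i) = (\<Oplus>\<^bsub>QH n v \<theta>\<^esub>i\<in>A. QH_const n v \<theta> (h i))"
proof -
  interpret cring "QH n v \<theta>" by (rule cring_QH)
  show ?thesis
    using assms
  proof (induction A rule: finite_induct)
    case empty
    then show ?case by (simp add: QH_const_0_1)
  next
    case (insert j A)
    have "sum h A \<in> invariants n v"
      using insert by (intro subring_set_sum[OF subring_set_invariants]) auto
    moreover have "(\<lambda>i. QH_const n v \<theta> (h i)) \<in> A \<rightarrow> carrier (QH n v \<theta>)"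
      using insert QH_const_closed by auto
    ultimately show ?case using insert QH_const_closed[of "h j" n v \<theta>] QH_const_hom[of "h j" n v _ \<theta>] by simp
  qed
qed

lemma QH_poly_closed:
  assumes "poly_over (invariants n v) p"
  shows "QH_poly n v \<theta> p \<in> carrier (UP (QH n v \<theta>))"
proof -
  have "bound \<zero>\<^bsub>QH n v \<theta>\<^esub> (Polynomial.degree p) (QH_poly n v \<theta> p)"
    using QH_const_0_1(1)[of n v \<theta>]
    by (auto simp: bound_def QH_poly_def QH_const_def coeff_eq_0)
  moreover have "QH_poly n v \<theta> p i \<in> carrier (QH n v \<theta>)" for i
    using assms QH_const_closed[of "Polynomial.coeff p i" n v \<theta>]
    by (auto simp: QH_poly_def QH_const_def poly_over_def)
  ultimately show ?thesis by (auto simp: UP_def up_def)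
qed

lemma coeff_QH_poly:
  assumes "poly_over (invariants n v) p"
  shows "up_ring.coeff (UP (QH n v \<theta>)) (QH_poly n v \<theta> p) i = QH_const n v \<theta> (Polynomial.coeff p i)"
  using QH_poly_closed[OF assms, of \<theta>] by (simp add: UP_def) (simp add: QH_poly_def QH_const_def)

lemma QH_poly_hom:
  assumes p: "poly_over (invariants n v) p" and q: "poly_over (invariants n v) q"
  shows "QH_poly n v \<theta> (p + q) = QH_poly n v \<theta> p \<oplus>\<^bsub>UP (QH n v \<theta>)\<^esub> QH_poly n v \<theta> q"
    "QH_poly n v \<theta> (p * q) = QH_poly n v \<theta> p \<otimes>\<^bsub>UP (QH n v \<theta>)\<^esub> QH_poly n v \<theta> q"
    "QH_poly n v \<theta> 1 = \<one>\<^bsub>UP (QH n v \<theta>)\<^esub>"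
proof -
  interpret UP_cring "QH n v \<theta>" "UP (QH n v \<theta>)"
    by (intro UP_cring.intro cring_QH) simp
  note arith = poly_over_arith[OF subring_set_invariants[of n v]]
  note closed = QH_poly_closed[of n v _ \<theta>] and coeff = coeff_QH_poly[of n v _ \<theta>]
  have inv: "Polynomial.coeff p i \<in> invariants n v" "Polynomial.coeff q i \<in> invariants n v" for i
    using p q by (auto simp: poly_over_def)
  show "QH_poly n v \<theta> (p + q) = QH_poly n v \<theta> p \<oplus>\<^bsub>UP (QH n v \<theta>)\<^esub> QH_poly n v \<theta> q"
    by (rule up_eqI) (simp_all add: coeff closed p q arith QH_const_hom QH_const_closed inv)
  show "QH_poly n v \<theta> (p * q) = QH_poly n v \<theta> p \<otimes>\<^bsub>UP (QH n v \<theta>)\<^esub> QH_poly n v \<theta> q"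
  proof (rule up_eqI)
    fix i
    have "QH_const n v \<theta> (Polynomial.coeff (p * q) i) =
        (\<Oplus>\<^bsub>QH n v \<theta>\<^esub>j\<in>{..i}. QH_const n v \<theta> (Polynomial.coeff p j * Polynomial.coeff q (i - j)))"
      using inv subring_setD(6)[OF subring_set_invariants[of n v]]
      by (simp only: Polynomial.coeff_mult) (rule QH_const_sum, auto)
    then show "up_ring.coeff (UP (QH n v \<theta>)) (QH_poly n v \<theta> (p * q)) i =
        up_ring.coeff (UP (QH n v \<theta>)) (QH_poly n v \<theta> p \<otimes>\<^bsub>UP (QH n v \<theta>)\<^esub> QH_poly n v \<theta> q) i"
      by (simp add: coeff closed p q arith QH_const_hom QH_const_closed inv)
  qed (simp_all add: closed p q arith)
  show "QH_poly n v \<theta> 1 = \<one>\<^bsub>UP (QH n v \<theta>)\<^esub>"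
    by (rule up_eqI) (auto simp: coeff closed arith QH_const_0_1 Polynomial.coeff_1)
qed

lemma polynomial_tensor_QH:
  "polynomial_tensor (QH n v \<theta>) (C_zeta n) (C_Q n v \<theta>) (Q_to_QHt n v \<theta>) (Q_to_zeta n v)"
proof (intro polynomial_tensor.intro polynomial_tensor_axioms.intro UP_cring.intro cring_QH cring_C_zeta)
  fix q assume q: "q \<in> carrier (C_Q n v \<theta>)"
  have "Poly_Mapping.map mconst q \<in> carrier (big_ring n v \<theta>)"
  proof -
    have "Poly_Mapping.keys (Poly_Mapping.map mconst q :: qxipoly) \<subseteq> Poly_Mapping.keys q"
      by (auto simp: in_keys_iff map.rep_eq when_def split: if_splits)
    moreover have "Poly_Mapping.lookup (Poly_Mapping.map mconst q) d \<in> invariants n v" for d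
      using single_in_invariants subring_setD(2)[OF subring_set_invariants]
      by (auto simp: map.rep_eq when_def mconst_def)
    ultimately show ?thesis
      using q by (auto simp: C_Q_def big_ring_def ring_of_type_algebra_simps)
  qed
  then have "QH_class n v \<theta> (Poly_Mapping.map mconst q) \<in> carrier (QH n v \<theta>)"
    by (rule ring_hom_closed[OF QH_class_hom])
  then show "\<exists>c\<in>carrier (QH n v \<theta>). Q_to_QHt n v \<theta> q = up_ring.monom (UP (QH n v \<theta>)) c 0"
    by (auto simp: Q_to_QHt_def)
  have mono: "Q_monomial_to_zeta n v d \<in> carrier (C_zeta n)" for d
  proof -
    have keys: "Poly_Mapping.keys (Poly_Mapping.map (\<lambda>c. Poly_Mapping.lookup d k * c)
        (zexp n (k + 1) - zexp n (k - 1))) \<subseteq> {..n}" for k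
    proof
      fix x assume "x \<in> Poly_Mapping.keys (Poly_Mapping.map (\<lambda>c. Poly_Mapping.lookup d k * c)
        (zexp n (k + 1) - zexp n (k - 1)))"
      then have "x \<in> Poly_Mapping.keys (zexp n (k + 1) - zexp n (k - 1))"
        by (auto simp: in_keys_iff map.rep_eq when_def split: if_splits)
      then show "x \<in> {..n}"
        using keys_diff[of "zexp n (k + 1)" "zexp n (k - 1)"] by (auto simp: zexp_def split: if_splits)
    qed
    have "Poly_Mapping.keys (\<Sum>k=1..n. Poly_Mapping.map (\<lambda>c. Poly_Mapping.lookup d k * c)
        (zexp n (k + 1) - zexp n (k - 1))) \<subseteq> {..n}"
      using keys_sum keys by (rule order_trans[OF _ UN_least])
    then show ?thesis
      by (auto simp: C_zeta_def ring_of_type_algebra_simps Q_monomial_to_zeta_def)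
  qed
  have const: "mconst c \<in> carrier (C_zeta n)" for c :: complex
    by (auto simp: C_zeta_def ring_of_type_algebra_simps mconst_def)
  show "Q_to_zeta n v q \<in> carrier (C_zeta n)"
    unfolding Q_to_zeta_def
    by (intro subring_set_sum[OF subring_set_C_zeta] subring_setD(6)[OF subring_set_C_zeta] mono const)
qed

lemma zmon_in_C_zeta: "Poly_Mapping.keys a \<subseteq> {..n} \<Longrightarrow> zmon a \<in> carrier (C_zeta n)"
  by (auto simp: C_zeta_def ring_of_type_algebra_simps zmon_def)

lemma zmon_mult: "zmon a * zmon b = zmon (a + b)"
  by (simp add: zmon_def mult_single)

lemma keys_zexp: "Poly_Mapping.keys (zexp n i) \<subseteq> {..n}"
  by (auto simp: zexp_def)

lemma zexp_diff_keys: "Poly_Mapping.keys (zexp n i - zexp n j) \<subseteq> {..n}"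
  using keys_diff[of "zexp n i" "zexp n j"] keys_zexp by blast

lemma target_elt_mult:
  assumes "poly_over (invariants n v) p" "poly_over (invariants n v) q"
    "Poly_Mapping.keys a \<subseteq> {..n}" "Poly_Mapping.keys b \<subseteq> {..n}"
  shows "target_elt n v \<theta> a p \<otimes>\<^bsub>target_ring n v \<theta>\<^esub> target_elt n v \<theta> b q = target_elt n v \<theta> (a + b) (p * q)"
  unfolding target_elt_def target_ring_def
  using polynomial_tensor.pure_tensor_mult[OF polynomial_tensor_QH QH_poly_closed[OF assms(1)]
      QH_poly_closed[OF assms(2)] zmon_in_C_zeta[OF assms(3)] zmon_in_C_zeta[OF assms(4)]]
  by (simp add: QH_poly_hom assms C_zeta_simps zmon_mult)

lemma target_elt_one: "target_elt n v \<theta> 0 1 = \<one>\<^bsub>target_ring n v \<theta>\<^esub>"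
proof -
  have "QH_poly n v \<theta> 1 = \<one>\<^bsub>UP (QH n v \<theta>)\<^esub>"
    using QH_poly_hom(3)[of n v 1 1] poly_over_arith(5)[OF subring_set_invariants] by blast
  moreover have "zmon 0 = \<one>\<^bsub>C_zeta n\<^esub>" by (simp add: zmon_def C_zeta_simps)
  ultimately show ?thesis
    unfolding target_elt_def target_ring_def
    using polynomial_tensor.pure_tensor_one[OF polynomial_tensor_QH] by simp
qed

lemma target_elt_division:
  assumes p: "poly_over (invariants n v) p" "Polynomial.coeff p d = 1" "\<And>i. i > d \<Longrightarrow> Polynomial.coeff p i = 0"
    and r: "poly_over (invariants n v) r" "\<And>i. i \<ge> d \<Longrightarrow> Polynomial.coeff r i = 0"
    and s: "poly_over (invariants n v) s" "\<And>i. i \<ge> d \<Longrightarrow> Polynomial.coeff s i = 0"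
    and q: "poly_over (invariants n v) q"
    and keys: "Poly_Mapping.keys a \<subseteq> {..n}" "Poly_Mapping.keys b \<subseteq> {..n}" "Poly_Mapping.keys c \<subseteq> {..n}"
    and Y: "Y \<in> carrier (target_ring n v \<theta>)"
    and eq: "target_elt n v \<theta> a p \<otimes>\<^bsub>target_ring n v \<theta>\<^esub> Y =
      target_elt n v \<theta> b r \<oplus>\<^bsub>target_ring n v \<theta>\<^esub> target_elt n v \<theta> (a + c) (p * q + s)"
  shows "Y = target_elt n v \<theta> c q"
proof -
  interpret polynomial_tensor "QH n v \<theta>" "UP (QH n v \<theta>)" "C_zeta n" "C_Q n v \<theta>" "Q_to_QHt n v \<theta>" "Q_to_zeta n v"
    by (rule polynomial_tensor_QH)
  note arith = poly_over_arith[OF subring_set_invariants[of n v]]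
  show ?thesis
    unfolding target_elt_def
  proof (rule pure_tensor_division[where p = "QH_poly n v \<theta> p" and d = d and z = "zmon a" and z' = "zmon (- a)"
        and r = "QH_poly n v \<theta> r" and w = "zmon b" and s = "QH_poly n v \<theta> s"])
    show "QH_poly n v \<theta> p \<in> carrier (UP (QH n v \<theta>))" "QH_poly n v \<theta> r \<in> carrier (UP (QH n v \<theta>))"
      "QH_poly n v \<theta> s \<in> carrier (UP (QH n v \<theta>))" "QH_poly n v \<theta> q \<in> carrier (UP (QH n v \<theta>))"
      using p r s q QH_poly_closed by auto
    show "up_ring.coeff (UP (QH n v \<theta>)) (QH_poly n v \<theta> p) d = \<one>\<^bsub>QH n v \<theta>\<^esub>"
      using p by (simp add: coeff_QH_poly QH_const_0_1)
    show "up_ring.coeff (UP (QH n v \<theta>)) (QH_poly n v \<theta> p) i = \<zero>\<^bsub>QH n v \<theta>\<^esub>" if "i > d" for i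
      using p that by (simp add: coeff_QH_poly QH_const_0_1)
    show "up_ring.coeff (UP (QH n v \<theta>)) (QH_poly n v \<theta> r) i = \<zero>\<^bsub>QH n v \<theta>\<^esub>" if "i \<ge> d" for i
      using r that by (simp add: coeff_QH_poly QH_const_0_1)
    show "up_ring.coeff (UP (QH n v \<theta>)) (QH_poly n v \<theta> s) i = \<zero>\<^bsub>QH n v \<theta>\<^esub>" if "i \<ge> d" for i
      using s that by (simp add: coeff_QH_poly QH_const_0_1)
    show "zmon a \<in> carrier (C_zeta n)" "zmon b \<in> carrier (C_zeta n)" "zmon c \<in> carrier (C_zeta n)"
      "zmon (- a) \<in> carrier (C_zeta n)"
      using keys by (auto intro!: zmon_in_C_zeta)
    show "zmon (- a) \<otimes>\<^bsub>C_zeta n\<^esub> zmon a = \<one>\<^bsub>C_zeta n\<^esub>"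
      by (simp add: C_zeta_simps zmon_mult) (simp add: zmon_def)
    show "Y \<in> carrier (tensor_ring (C_Q n v \<theta>) (UP (QH n v \<theta>)) (C_zeta n) (Q_to_QHt n v \<theta>) (Q_to_zeta n v))"
      using Y by (simp add: target_ring_def)
    show "pure_tensor (C_Q n v \<theta>) (UP (QH n v \<theta>)) (C_zeta n) (Q_to_QHt n v \<theta>) (Q_to_zeta n v)
          (QH_poly n v \<theta> p) (zmon a)
        \<otimes>\<^bsub>tensor_ring (C_Q n v \<theta>) (UP (QH n v \<theta>)) (C_zeta n) (Q_to_QHt n v \<theta>) (Q_to_zeta n v)\<^esub> Y =
        pure_tensor (C_Q n v \<theta>) (UP (QH n v \<theta>)) (C_zeta n) (Q_to_QHt n v \<theta>) (Q_to_zeta n v)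
          (QH_poly n v \<theta> r) (zmon b)
        \<oplus>\<^bsub>tensor_ring (C_Q n v \<theta>) (UP (QH n v \<theta>)) (C_zeta n) (Q_to_QHt n v \<theta>) (Q_to_zeta n v)\<^esub>
        pure_tensor (C_Q n v \<theta>) (UP (QH n v \<theta>)) (C_zeta n) (Q_to_QHt n v \<theta>) (Q_to_zeta n v)
          (QH_poly n v \<theta> p \<otimes>\<^bsub>UP (QH n v \<theta>)\<^esub> QH_poly n v \<theta> q \<oplus>\<^bsub>UP (QH n v \<theta>)\<^esub> QH_poly n v \<theta> s)
          (zmon a \<otimes>\<^bsub>C_zeta n\<^esub> zmon c)"
      using eq p q s arith
      by (simp add: target_elt_def target_ring_def QH_poly_hom C_zeta_simps zmon_mult)
  qed
qed

section \<open>Transport of the exchange relations along \<psi>\<close>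

lemma cluster_algebra_simps:
  "x \<otimes>\<^bsub>cluster_algebra n\<^esub> y = x * y" "x \<oplus>\<^bsub>cluster_algebra n\<^esub> y = x + y" "\<one>\<^bsub>cluster_algebra n\<^esub> = 1"
  by (simp_all add: cluster_algebra_def ring_of_type_algebra_simps)

lemma cluster_algebra_carrier:
  "1 \<in> carrier (cluster_algebra n)"
  "x \<in> insert (xvar 0) (cluster_variables n) \<Longrightarrow> x \<in> carrier (cluster_algebra n)"
  "x \<in> carrier (cluster_algebra n) \<Longrightarrow> y \<in> carrier (cluster_algebra n) \<Longrightarrow> x * y \<in> carrier (cluster_algebra n)"
proof -
  have alg: "x \<otimes>\<^bsub>ring_of_type_algebra\<^esub> y = x * y" "\<one>\<^bsub>ring_of_type_algebra\<^esub> = (1 :: ratfun)" for x y :: ratfun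
    by (simp_all add: ring_of_type_algebra_def)
  show "1 \<in> carrier (cluster_algebra n)"
    using generate_ring.one[of "ring_of_type_algebra :: ratfun ring"]
    by (simp add: cluster_algebra_def alg)
  show "x \<in> insert (xvar 0) (cluster_variables n) \<Longrightarrow> x \<in> carrier (cluster_algebra n)"
    by (simp add: cluster_algebra_def) (rule generate_ring.incl, simp)
  show "x \<in> carrier (cluster_algebra n) \<Longrightarrow> y \<in> carrier (cluster_algebra n) \<Longrightarrow> x * y \<in> carrier (cluster_algebra n)"
    using generate_ring.eng_mult[of x "ring_of_type_algebra :: ratfun ring" _ y]
    by (simp add: cluster_algebra_def alg)
qed

text \<open>The left side of the first inequality bounds the degree of c_t(V_(l+2)) \<delta>_t(V_k,
  V_l). Since \<open>v k\<close> is at most \<open>v 0\<close>, the inequality follows from the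
  assumption on the dimension vector at \<open>l\<close>.\<close>

lemma division_remainder_bound:
  fixes v :: "nat \<Rightarrow> nat"
  assumes anti: "\<forall>k<n. v k > v (k + 1)"
    and bd: "\<forall>k<n. int (v 0) - int (v k) < int (v (k + 1)) - int (v (k + 2))"
    and kl: "k \<le> l" "l < n"
  shows "v (l + 2) + (v k - v l) < v (l + 1)" "v (l + 1) \<le> v k" "v l \<le> v k"
proof -
  have dec: "v j \<le> v i" if "i \<le> j" "j \<le> n" for i j
    using that
  proof (induction j rule: dec_induct)
    case (step j)
    then show ?case using anti[rule_format, of j] by simp
  qed simp
  have "v l \<le> v k" "v k \<le> v 0" "v (l + 1) \<le> v l" using dec[of k l] dec[of 0 k] dec[of l "l + 1"] kl by auto
  then show "v (l + 2) + (v k - v l) < v (l + 1)" "v (l + 1) \<le> v k" "v l \<le> v k"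
    using bd[rule_format, of l] kl by auto
qed

text \<open>Long division inside the invariants gives an invariant quotient, which
  \<open>delta_eq\<close> identifies with \<delta>. The bound \<open>Suc (v k)\<close> is one above
  the degree of c_t(V_k), whence the strict inequality in the last clause.\<close>

lemma delta_division:
  assumes v: "\<forall>k>n. v k = 0" and le: "v l \<le> v k"
  obtains r where "poly_over (invariants n v) (delta v k l)" "poly_over (invariants n v) r"
    "chern v k = chern v l * delta v k l + r" "\<forall>i\<ge>v l. Polynomial.coeff r i = 0"
    "\<forall>i. i + v l > v k \<longrightarrow> Polynomial.coeff (delta v k l) i = 0"
proof -
  obtain q r where qr: "poly_over (invariants n v) q" "poly_over (invariants n v) r"
      "chern v k = chern v l * q + r" "\<forall>i\<ge>v l. Polynomial.coeff r i = 0"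
      "\<forall>i. i + v l \<ge> Suc (v k) \<longrightarrow> Polynomial.coeff q i = 0"
    using monic_division[OF subring_set_invariants poly_over_chern[OF v, of l] chern_monic(1) chern_monic(2)
        poly_over_chern[OF v, of k], of "Suc (v k)"] chern_monic(2)[of v k]
    by auto
  have "delta v k l = q" using qr(3,4) by (intro delta_eq) auto
  with qr show ?thesis by (intro that[of r]) auto
qed

lemma coeff_mult_eq_0:
  fixes p q :: "'a::comm_ring_1 poly"
  assumes "\<And>i. i > a \<Longrightarrow> Polynomial.coeff p i = 0" "\<And>i. i > b \<Longrightarrow> Polynomial.coeff q i = 0" "a + b < i"
  shows "Polynomial.coeff (p * q) i = 0"
  unfolding Polynomial.coeff_mult
proof (intro sum.neutral ballI)
  fix j assume "j \<in> {..i}"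
  then have "j > a \<or> i - j > b" using assms(3) by auto
  then show "Polynomial.coeff p j * Polynomial.coeff q (i - j) = 0" using assms(1,2) by auto
qed

theorem proposition4p9:
  fixes n :: nat and v :: "nat \<Rightarrow> nat" and \<theta> :: "nat \<Rightarrow> int"
    and \<psi> :: "ratfun \<Rightarrow> ((nat \<Rightarrow> qxipoly set) \<times> laurent \<Rightarrow>\<^sub>0 int) set"
  assumes "n \<ge> 1"
    and "\<forall>k>n. v k = 0"
    and "\<forall>k\<in>{1..n}. \<theta> k > 0"
    and "\<forall>k<n. v k > v (k + 1)"
    and "\<forall>k<n. int (v 0) - int (v k) < int (v (k + 1)) - int (v (k + 2))"
    and "\<psi> \<in> ring_hom (cluster_algebra n) (target_ring n v \<theta>)"
    and "inj_on \<psi> (carrier (cluster_algebra n))"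
    and "\<forall>i\<le>n. \<psi> (xvar i) = target_elt n v \<theta> (zexp n i) (chern v i)"
    and "\<forall>k\<in>{1..n}. \<psi> (x_mutated n k) =
           target_elt n v \<theta> (zexp n (k - 1) - zexp n k) (delta v (k - 1) k)
           \<oplus>\<^bsub>target_ring n v \<theta>\<^esub>
           target_elt n v \<theta> (zexp n (k + 1) - zexp n k) (delta v (k + 1) k)"
  shows "cluster_variables n =
           {x_neg_simple k | k. 1 \<le> k \<and> k \<le> n} \<union> {x_root n k l | k l. k < l \<and> l \<le> n}
       \<and> (\<forall>k\<in>{1..n}. \<psi> (x_neg_simple k) = target_elt n v \<theta> (zexp n k) (chern v k))
       \<and> (\<forall>k l. k \<le> l \<and> l \<le> n \<longrightarrow>
            \<psi> (x_root n k l) = target_elt n v \<theta> (zexp n k - zexp n l) (delta v k l))"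
proof (intro conjI allI ballI impI)
  note hom = assms(6) and v0 = assms(2)
  note arith = poly_over_arith[OF subring_set_invariants[of n v]]
  note chern = poly_over_chern[OF v0]
  let ?T = "target_ring n v \<theta>" and ?A = "cluster_algebra n"
  have "{x_root n k l | k l. k < l \<and> l \<le> n} = {chord n k (Suc l) | k l. k < l \<and> l \<le> n}"
    by (intro Collect_cong iff_exI) (auto simp: x_root_eq)
  then show "cluster_variables n =
      {x_neg_simple k | k. 1 \<le> k \<and> k \<le> n} \<union> {x_root n k l | k l. k < l \<and> l \<le> n}"
    by (auto simp: cluster_variables_eq x_neg_simple_def)
  show "\<psi> (x_neg_simple k) = target_elt n v \<theta> (zexp n k) (chern v k)" if "k \<in> {1..n}" for k
    using that assms(8) by (simp add: x_neg_simple_def)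
  have one: "\<psi> 1 = target_elt n v \<theta> 0 1"
    using ring_hom_one[OF hom] by (simp add: cluster_algebra_simps target_elt_one)
  \<comment> \<open>Beyond \<open>n\<close> all conventions agree: the variable is \<open>1\<close>,
    the exponent is \<open>0\<close> and the Chern polynomial is an empty product.\<close>
  have xext_psi: "\<psi> (xext n i) = target_elt n v \<theta> (zexp n i) (chern v i)" for i
    using assms(8) one v0 by (auto simp: xext_def zexp_def chern_def)
  have xext_carrier: "xext n i \<in> carrier ?A" for i
    using cluster_algebra_carrier(1,2)[where n = n] by (cases "i = 0") (auto simp: xext_def cluster_variables_eq)
  have chord_carrier: "chord n k (Suc l) \<in> carrier ?A" if "k \<le> l" "l \<le> n" for k l
  proof (cases "k = l")
    case True
    then show ?thesis using that chord_Suc[of k n] cluster_algebra_carrier(1) by simp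
  next
    case False
    then have "k < l" using that by simp
    then have "chord n k (Suc l) \<in> cluster_variables n"
      using that unfolding cluster_variables_eq by blast
    then show ?thesis by (intro cluster_algebra_carrier(2)) simp
  qed
  fix k l assume kl: "k \<le> l \<and> l \<le> n"
  then have "k \<le> l" "l \<le> n" by auto
  then have "\<psi> (chord n k (Suc l)) = target_elt n v \<theta> (zexp n k - zexp n l) (delta v k l)"
  proof (induction l rule: dec_induct)
    case base
    have "delta v k k = 1" by (rule delta_eq[of v k k 1 0]) auto
    then show ?case using one chord_Suc[of k n] base by simp
  next
    case (step l)
    \<comment> \<open>The step concerns node \<open>l + 1\<close>, so the divisor is c_t(V_(l+1)),
      and the neighbour V_(l+2) is zero when \<open>l + 1 = n\<close>.\<close>
    then have l: "k \<le> l" "l < n" "Suc l \<le> n" by auto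
    note bounds = division_remainder_bound[OF assms(4,5) l(1,2)]
    obtain r where r: "poly_over (invariants n v) (delta v k (Suc l))" "poly_over (invariants n v) r"
        "chern v k = chern v (Suc l) * delta v k (Suc l) + r" "\<forall>i\<ge>v (Suc l). Polynomial.coeff r i = 0"
      using delta_division[OF v0, of "Suc l" k] bounds(2) by (metis Suc_eq_plus1)
    have d: "poly_over (invariants n v) (delta v k l)"
      "\<forall>i. i + v l > v k \<longrightarrow> Polynomial.coeff (delta v k l) i = 0"
      using delta_division[OF v0 bounds(3)] by metis+
    \<comment> \<open>This is the summand of the exchange relation that must not contribute to the
      quotient: its degree is below that of the divisor.\<close>
    have low: "Polynomial.coeff (chern v (Suc (Suc l)) * delta v k l) i = 0" if "i \<ge> v (Suc l)" for i
      by (rule coeff_mult_eq_0[of "v (Suc (Suc l))" _ "v k - v l"])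
        (use chern_monic(2) d(2) that bounds in auto)
    have keys: "Poly_Mapping.keys (zexp n (Suc (Suc l)) + (zexp n k - zexp n l)) \<subseteq> {..n}"
      using keys_add[of "zexp n (Suc (Suc l))" "zexp n k - zexp n l"] keys_zexp zexp_diff_keys by blast
    have "\<psi> (xext n (Suc l)) \<otimes>\<^bsub>?T\<^esub> \<psi> (chord n k (Suc (Suc l))) =
        \<psi> (xext n (Suc l) * chord n k (Suc (Suc l)))"
      using ring_hom_mult[OF hom xext_carrier chord_carrier[of k "Suc l"]] l
      by (simp add: cluster_algebra_simps)
    also have "xext n (Suc l) * chord n k (Suc (Suc l)) = xext n (Suc (Suc l)) * chord n k (Suc l) + xext n k"
      using l by (intro chord_exchange) auto
    also have "\<psi> \<dots> = \<psi> (xext n (Suc (Suc l))) \<otimes>\<^bsub>?T\<^esub> \<psi> (chord n k (Suc l)) \<oplus>\<^bsub>?T\<^esub> \<psi> (xext n k)"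
      using ring_hom_mult[OF hom xext_carrier chord_carrier[of k l]] l
        ring_hom_add[OF hom cluster_algebra_carrier(3)[OF xext_carrier chord_carrier[of k l]] xext_carrier]
      by (simp add: cluster_algebra_simps)
    also have "\<psi> (xext n (Suc (Suc l))) \<otimes>\<^bsub>?T\<^esub> \<psi> (chord n k (Suc l)) =
        target_elt n v \<theta> (zexp n (Suc (Suc l)) + (zexp n k - zexp n l)) (chern v (Suc (Suc l)) * delta v k l)"
      using step.IH l target_elt_mult[OF chern d(1) keys_zexp zexp_diff_keys] by (simp add: xext_psi)
    \<comment> \<open>The exponent is written as a sum to split off the monomial of the divisor;
      what remains is the exponent claimed for the quotient.\<close>
    also have "\<psi> (xext n k) = target_elt n v \<theta> (zexp n (Suc l) + (zexp n k - zexp n (Suc l)))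
        (chern v (Suc l) * delta v k (Suc l) + r)"
      using r(3) by (simp add: xext_psi)
    finally have eq: "target_elt n v \<theta> (zexp n (Suc l)) (chern v (Suc l)) \<otimes>\<^bsub>?T\<^esub> \<psi> (chord n k (Suc (Suc l))) =
        target_elt n v \<theta> (zexp n (Suc (Suc l)) + (zexp n k - zexp n l)) (chern v (Suc (Suc l)) * delta v k l)
        \<oplus>\<^bsub>?T\<^esub> target_elt n v \<theta> (zexp n (Suc l) + (zexp n k - zexp n (Suc l)))
          (chern v (Suc l) * delta v k (Suc l) + r)"
      by (simp add: xext_psi)
    show ?case
    proof (rule target_elt_division[OF _ _ _ _ _ _ _ _ _ _ _ _ eq])
      show "\<psi> (chord n k (Suc (Suc l))) \<in> carrier ?T"
        using ring_hom_closed[OF hom chord_carrier[of k "Suc l"]] l by simp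
    qed (use chern chern_monic r d(1) low arith keys keys_zexp zexp_diff_keys in auto)
  qed
  then show "\<psi> (x_root n k l) = target_elt n v \<theta> (zexp n k - zexp n l) (delta v k l)"
    using x_root_eq kl by simp
qed

end
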